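(* Let $n\ge 1$ and $w\in S_n$. Then the co-bumpless pipe dream $\mathrm{co}(B)$ is reduced for every bumpless pipe dream $B\in \mathrm{BPD}(w)$ if and only if $w$ avoids all seven patterns in $$\Pi=\{1423,\ 12543,\ 13254,\ 25143,\ 215643,\ 216543,\ 241653\}.$$
   Context: Permutations are written in one-line notation $w=w_1\cdots w_n$. A permutation $w\in S_n$ contains $v\in S_k$ as a pattern if there are indices $i_1<\cdots<i_k$ such that $w_{i_r}<w_{i_s}$ if and only if $v_r<v_s$; otherwise $w$ avoids $v$. A bumpless pipe dream (BPD) of size $n$ is a tiling of an $n\times n$ grid (rows numbered top to bottom, columns left to right) by the following six tiles: the blank tile; the vertical tile (joins the bottom and top edges); the horizontal tile or "flat" (joins the left and right edges); the "are" elbow (joins the bottom and right edges); the "jay" elbow (joins the left and top edges); and the cross tile (a vertical strand and a horizontal strand crossing). The tiles must fit together to form $n$ pipes, one entering from the bottom edge of each column and one exiting through the right edge of each row (no pipe meets the top or left boundary of the grid). Label the pipes $1,\dots,n$ from left to right by the column in which they enter. The permutation associated to a BPD is obtained by reading the labels of the pipes from top to bottom as they exit on the right, where, if two pipes cross more than once, only their first crossing (following pipes from their entry) is treated as a crossing and every later crossing tile between that pair is treated as a pair of turns (the two pipes touch without crossing). $\mathrm{BPD}(w)$ is the set of all BPDs (reduced or not) with associated permutation $w$. For a BPD $B$, the co-bumpless pipe dream (co-BPD) $\mathrm{co}(B)$ is obtained by replacing tiles in place: an are elbow becomes an elbow joining the top and right edges; a jay elbow becomes an elbow joining the left and bottom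 edges; vertical tiles and blank tiles are exchanged; horizontal tiles and cross tiles are exchanged. In $\mathrm{co}(B)$ there are $n$ pipes, one entering from the top of each column and one exiting at the right end of each row. A co-BPD is reduced if no two of its pipes cross more than once, and non-reduced otherwise. *)

theory Defs
  imports Main "HOL-Combinatorics.Permutations"
begin

text \<open>Permutations of \<^term>\<open>{1..n}\<close> are functions \<^term>\<open>w\<close> with \<^prop>\<open>w permutes {1..n}\<close>;
  patterns are lists in one-line notation.\<close>

definition contains_pattern :: "nat \<Rightarrow> (nat \<Rightarrow> nat) \<Rightarrow> nat list \<Rightarrow> bool" where
  "contains_pattern n w v \<longleftrightarrow>
     (\<exists>\<iota>. strict_mono_on {..<length v} \<iota> \<and> \<iota> ` {..<length v} \<subseteq> {1..n} \<and>
          (\<forall>r<length v. \<forall>s<length v. w (\<iota> r) < w (\<iota> s) \<longleftrightarrow> v ! r < v ! s))"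

definition avoids_pattern :: "nat \<Rightarrow> (nat \<Rightarrow> nat) \<Rightarrow> nat list \<Rightarrow> bool" where
  "avoids_pattern n w v \<longleftrightarrow> \<not> contains_pattern n w v"

definition patterns :: "nat list set" where
  "patterns =
     {[1,4,2,3], [1,2,5,4,3], [1,3,2,5,4], [2,5,1,4,3],
      [2,1,5,6,4,3], [2,1,6,5,4,3], [2,4,1,6,5,3]}"

datatype edge = Top | Bottom | Left | Right

text \<open>The first six tiles are those of bumpless pipe dreams. \<open>CoAre\<close> and \<open>CoJay\<close> are the elbows of
  co-bumpless pipe dreams. \<open>Touch\<close> is a crossing tile whose two strands are treated as a pair of
  turns; it only occurs in resolved tilings (see \<open>resolves\<close> below).\<close>

datatype tile = Blank | Vert | Horiz | Are | Jay | Cross | CoAre | CoJay | Touch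

fun strands :: "tile \<Rightarrow> edge set set" where
  "strands Blank = {}"
| "strands Vert = {{Bottom, Top}}"
| "strands Horiz = {{Left, Right}}"
| "strands Are = {{Bottom, Right}}"
| "strands Jay = {{Left, Top}}"
| "strands Cross = {{Bottom, Top}, {Left, Right}}"
| "strands CoAre = {{Top, Right}}"
| "strands CoJay = {{Left, Bottom}}"
| "strands Touch = {{Left, Top}, {Bottom, Right}}"

definition edges :: "tile \<Rightarrow> edge set" where
  "edges t = \<Union> (strands t)"

text \<open>\<open>T i j\<close> is the tile in row \<open>i\<close> (from the top) and column \<open>j\<close> (from the left), both counted
  from \<open>1\<close>.\<close>

type_synonym tiling = "nat \<Rightarrow> nat \<Rightarrow> tile"

text \<open>The value outside the grid is fixed so that each bumpless pipe dream is represented by exactly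
  one function.\<close>

definition is_bpd :: "nat \<Rightarrow> tiling \<Rightarrow> bool" where
  "is_bpd n B \<longleftrightarrow>
     (\<forall>i j. B i j \<in> {Blank, Vert, Horiz, Are, Jay, Cross}) \<and>
     (\<forall>i j. i \<notin> {1..n} \<or> j \<notin> {1..n} \<longrightarrow> B i j = Blank) \<and>
     (\<forall>i\<in>{1..n}. \<forall>j\<in>{1..<n}. Right \<in> edges (B i j) \<longleftrightarrow> Left \<in> edges (B i (Suc j))) \<and>
     (\<forall>i\<in>{1..<n}. \<forall>j\<in>{1..n}. Bottom \<in> edges (B i j) \<longleftrightarrow> Top \<in> edges (B (Suc i) j)) \<and>
     (\<forall>j\<in>{1..n}. Bottom \<in> edges (B n j)) \<and>
     (\<forall>i\<in>{1..n}. Right \<in> edges (B i n)) \<and>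
     (\<forall>j\<in>{1..n}. Top \<notin> edges (B 1 j)) \<and>
     (\<forall>i\<in>{1..n}. Left \<notin> edges (B i 1))"

text \<open>\<open>enters n T a p i j e\<close>: pipe \<open>p\<close>, which comes into the grid at column \<open>p\<close> from side \<open>a\<close>
  (\<open>Bottom\<close> for bumpless pipe dreams, \<open>Top\<close> for co-bumpless ones), enters the tile \<open>(i, j)\<close> through
  its edge \<open>e\<close>. There is no rule for leftward steps because pipes never make one.\<close>

inductive enters :: "nat \<Rightarrow> tiling \<Rightarrow> edge \<Rightarrow> nat \<Rightarrow> nat \<Rightarrow> nat \<Rightarrow> edge \<Rightarrow> bool"
  for n :: nat and T :: tiling and a :: edge where
  from_bottom: "\<lbrakk>a = Bottom; p \<in> {1..n}\<rbrakk> \<Longrightarrow> enters n T a p n p Bottom"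
| from_top: "\<lbrakk>a = Top; p \<in> {1..n}\<rbrakk> \<Longrightarrow> enters n T a p 1 p Top"
| up: "\<lbrakk>enters n T a p (Suc i) j e; {e, Top} \<in> strands (T (Suc i) j); 1 \<le> i\<rbrakk>
        \<Longrightarrow> enters n T a p i j Bottom"
| down: "\<lbrakk>enters n T a p i j e; {e, Bottom} \<in> strands (T i j); i < n\<rbrakk>
        \<Longrightarrow> enters n T a p (Suc i) j Top"
| right: "\<lbrakk>enters n T a p i j e; {e, Right} \<in> strands (T i j); j < n\<rbrakk>
        \<Longrightarrow> enters n T a p i (Suc j) Left"

definition passes :: "nat \<Rightarrow> tiling \<Rightarrow> edge \<Rightarrow> nat \<Rightarrow> nat \<Rightarrow> nat \<Rightarrow> bool" where
  "passes n T a p i j \<longleftrightarrow> (\<exists>e. enters n T a p i j e)"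

definition exits_at_row :: "nat \<Rightarrow> tiling \<Rightarrow> edge \<Rightarrow> nat \<Rightarrow> nat \<Rightarrow> bool" where
  "exits_at_row n T a p i \<longleftrightarrow>
     (\<exists>e. enters n T a p i n e \<and> {e, Right} \<in> strands (T i n))"

definition cross_at :: "nat \<Rightarrow> tiling \<Rightarrow> edge \<Rightarrow> nat \<Rightarrow> nat \<Rightarrow> nat \<Rightarrow> nat \<Rightarrow> bool" where
  "cross_at n T a p q i j \<longleftrightarrow>
     p \<noteq> q \<and> passes n T a p i j \<and> passes n T a q i j \<and> T i j = Cross"

text \<open>\<open>resolves n B T\<close>: \<open>T\<close> arises from the bumpless pipe dream \<open>B\<close> by turning exactly those crossing
  tiles into a pair of turns whose two pipes have already crossed. The pipes meant here are those of
  \<open>T\<close> itself, that is, with the turns taken into account. This determines \<open>T\<close>, because the pipes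
  move up and right only: which pipes reach a tile depends only on the tiles weakly below and weakly
  left of it, and for two tiles visited by the same pipe, being visited earlier means lying weakly
  below and weakly left.\<close>

definition resolves :: "nat \<Rightarrow> tiling \<Rightarrow> tiling \<Rightarrow> bool" where
  "resolves n B T \<longleftrightarrow>
     (\<forall>i j. B i j \<noteq> Cross \<longrightarrow> T i j = B i j) \<and>
     (\<forall>i j. B i j = Cross \<longrightarrow> T i j \<in> {Cross, Touch}) \<and>
     (\<forall>i j p q. B i j = Cross \<and> p \<noteq> q \<and> passes n T Bottom p i j \<and> passes n T Bottom q i j \<longrightarrow>
        (T i j = Touch \<longleftrightarrow>
          (\<exists>i' j'. i \<le> i' \<and> j' \<le> j \<and> (i', j') \<noteq> (i, j) \<and> cross_at n T Bottom p q i' j')))"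

definition has_permutation :: "nat \<Rightarrow> tiling \<Rightarrow> (nat \<Rightarrow> nat) \<Rightarrow> bool" where
  "has_permutation n B w \<longleftrightarrow>
     (\<exists>T. resolves n B T \<and> (\<forall>i\<in>{1..n}. exits_at_row n T Bottom (w i) i))"

definition BPD :: "nat \<Rightarrow> (nat \<Rightarrow> nat) \<Rightarrow> tiling set" where
  "BPD n w = {B. is_bpd n B \<and> has_permutation n B w}"

text \<open>The last three equations concern tiles that do not occur in a bumpless pipe dream.\<close>

fun co_tile :: "tile \<Rightarrow> tile" where
  "co_tile Are = CoAre"
| "co_tile Jay = CoJay"
| "co_tile Vert = Blank"
| "co_tile Blank = Vert"
| "co_tile Horiz = Cross"
| "co_tile Cross = Horiz"
| "co_tile CoAre = Are"
| "co_tile CoJay = Jay"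
| "co_tile Touch = Touch"

definition co :: "tiling \<Rightarrow> tiling" where
  "co B = (\<lambda>i j. co_tile (B i j))"

definition co_reduced :: "nat \<Rightarrow> tiling \<Rightarrow> bool" where
  "co_reduced n C \<longleftrightarrow>
     (\<forall>p q i j i' j'. cross_at n C Top p q i j \<and> cross_at n C Top p q i' j' \<longrightarrow> (i, j) = (i', j'))"

end

theory Submission
  imports Defs
begin

text \<open>\<^bold>\<open>Labels.\<close> Give every edge of a bumpless pipe dream the label of the pipe that
uses it, with the rule on repeated crossings taken into account, and \<open>0\<close> if it is not
used. Where two pipes meet, the smaller label always leaves to the right and the larger one upwards:
before the first crossing the smaller pipe comes from the left and they cross, afterwards it comes
from below and they touch. So the rule on repeated crossings is the local rule \<open>cell\<close>,
and the elements of \<open>BPD n w\<close> are exactly the labellings in which row \<open>i\<close>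
exits with \<open>w i\<close> (\<open>labelling_BPD\<close>, \<open>BPD_labelling\<close>). Co-pipes
use the vertical edges without a label and the horizontal edges with one, so they only depend on
where labels are \<open>0\<close>.

\<^bold>\<open>Avoidance implies that co-pipes cross at most once.\<close> If two co-pipes cross and
later meet again, the upper one turns down at a jay \<open>(r, c)\<close> and follows column
\<open>c\<close> until a carried label passes it in some row \<open>y\<close>; the lower one has
left an empty column \<open>q < c\<close> on the line below row \<open>r\<close>; and some label
below \<open>q\<close> exits above row \<open>r\<close>. This is the locale
\<open>certificate\<close>. Its contradiction (\<open>no_certificate\<close>) comes from counting:
on the line below row \<open>i\<close>, if no label up to \<open>l\<close> has been pushed beyond
column \<open>l\<close>, the empty columns in \<open>{j<..l}\<close> together with the labels up to
\<open>j\<close> pushed beyond \<open>j\<close> are as many as the labels of \<open>{j<..l}\<close>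
that exit further down (\<open>count\<close>). Take \<open>l\<close> to be the rightmost column with
a jay below row \<open>r\<close>, and \<open>k\<close> the row of the jay. The rows between
\<open>r\<close> and \<open>k\<close> leave empty columns of their own (\<open>barrier\<close>), so
the count forces labels that exit after the label \<open>l\<close>. The patterns restrict the order
of these late labels so much that the counts on the lines \<open>r\<close>, \<open>k\<close> and
\<open>y\<close> cannot all hold; the cases \<open>y \<le> k\<close> and \<open>k < y\<close> are
\<open>shallow\<close> and \<open>deep\<close>.

\<^bold>\<open>A pattern forces a double crossing.\<close> Diagrams are built from the top, one row
at a time. A row can always be added in which the exiting pipe takes a single turn
(\<open>straight_row\<close>). It can also droop: from a diagram for \<open>w(b := d)\<close> above
row \<open>i\<close> one gets a diagram for \<open>w\<close> in which row \<open>i\<close> carries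
the label \<open>w b\<close> from its own column to column \<open>d\<close> before it goes up
(\<open>droop_row\<close>). A droop makes a co-pipe cross all the co-pipes that fall through its
run, and moves a co-pipe from column \<open>w b\<close> to column \<open>d\<close>. From these moves
\<open>can_cross_at_corner\<close> produces two co-pipes that have crossed and come down in two
prescribed empty columns. When a later exit or droop sends the left one to the right across the
column of the other one, they cross again. The lemmas \<open>crosses_twice_1423\<close> to
\<open>crosses_twice_241653\<close> carry this out for each pattern.\<close>

section \<open>Labels of pipes\<close>

text \<open>The arguments are the labels on the left, bottom, right and top edge. If two labels come in, the
smaller one leaves to the right: when it comes from the left this is a crossing, and when it comes
from below it is a pair of turns.\<close>

definition cell :: "nat \<Rightarrow> nat \<Rightarrow> nat \<Rightarrow> nat \<Rightarrow> bool" where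
  "cell a b r t \<longleftrightarrow>
     (if a = 0 \<and> b = 0 then r = 0 \<and> t = 0
      else if a = 0 \<or> b = 0 then (r = a + b \<and> t = 0) \<or> (r = 0 \<and> t = a + b)
      else r = min a b \<and> t = max a b)"

lemma
  assumes "cell a b r t"
  shows cell_left: "a \<noteq> 0 \<Longrightarrow> t = a \<or> r = a"
    and cell_bottom: "b \<noteq> 0 \<Longrightarrow> t = b \<or> r = b"
    and cell_right: "r \<noteq> 0 \<Longrightarrow> r = b \<or> r = a"
    and cell_top: "t \<noteq> 0 \<Longrightarrow> t = b \<or> t = a"
    and cell_twice: "r = x \<Longrightarrow> t = x \<Longrightarrow> x \<noteq> 0 \<Longrightarrow> a = x \<and> b = x"
    and cell_cross: "a \<noteq> 0 \<Longrightarrow> b \<noteq> 0 \<Longrightarrow> r = min a b \<and> t = max a b"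
  using assms by (auto simp: cell_def min_def max_def split: if_splits)

text \<open>The label on the bottom edge of cell \<open>(i, j)\<close> is \<open>lv i j\<close>, the label on
its right edge is \<open>lh i j\<close>; line \<open>i\<close> is the boundary between row
\<open>i\<close> and row \<open>i + 1\<close>. A diagram with only \<open>m\<close> rows is
completed below by vertical pipes, so each label of \<open>S\<close> starts in its own column.\<close>

locale tableau =
  fixes N m :: nat and S :: "nat set" and lv lh :: "nat \<Rightarrow> nat \<Rightarrow> nat"
  assumes cells: "\<And>i j. \<lbrakk>1 \<le> i; i \<le> m; 1 \<le> j; j \<le> N\<rbrakk> \<Longrightarrow>
      cell (lh i (j - 1)) (lv i j) (lh i j) (lv (i - 1) j)"
    and left_empty: "\<And>i. \<lbrakk>1 \<le> i; i \<le> m\<rbrakk> \<Longrightarrow> lh i 0 = 0"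
    and top_empty: "\<And>j. lv 0 j = 0"
    and outside: "\<And>i j. \<lbrakk>i \<le> m; j = 0 \<or> N < j\<rbrakk> \<Longrightarrow> lv i j = 0"
    and bottom: "\<And>j. lv m j = (if j \<in> S then j else 0)"
begin

lemma in_columns:
  assumes "lv i p \<noteq> 0" "i \<le> m" shows "1 \<le> p" "p \<le> N"
proof -
  have "\<not> (p = 0 \<or> N < p)" using outside[of i p] assms by blast
  then show "1 \<le> p" "p \<le> N" by auto
qed

lemma up_or_right:
  assumes "1 \<le> i" "i \<le> m" "lv i p = x" "x \<noteq> 0"
  shows "lv (i - 1) p = x \<or> lh i p = x"
proof -
  have "lv i p \<noteq> 0" using assms by simp
  from cell_bottom[OF cells[OF assms(1,2) in_columns[OF this assms(2)]] this] assms(3)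
  show ?thesis by simp
qed

lemma carried_on:
  assumes "1 \<le> i" "i \<le> m" "lh i j = x" "x \<noteq> 0" "j < N"
  shows "lv (i - 1) (Suc j) = x \<or> lh i (Suc j) = x"
  using cell_left[OF cells[OF assms(1,2), of "Suc j"]] assms by simp

lemma came_up:
  assumes "1 \<le> i" "i \<le> m" "lv (i - 1) p = x" "x \<noteq> 0"
  shows "lv i p = x \<or> lh i (p - 1) = x"
proof -
  have "lv (i - 1) p \<noteq> 0" "i - 1 \<le> m" using assms by simp_all
  from cell_top[OF cells[OF assms(1,2) in_columns[OF this]] this(1)] assms(3)
  show ?thesis by auto
qed

lemma came_right:
  assumes "1 \<le> i" "i \<le> m" "lh i j = x" "x \<noteq> 0" "j \<le> N"
  shows "1 \<le> j \<and> (lv i j = x \<or> lh i (j - 1) = x)"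
proof -
  have "j \<noteq> 0" using left_empty assms by (metis)
  then have "1 \<le> j" by simp
  then show ?thesis using cell_right[OF cells[OF assms(1,2) _ assms(5)]] assms(3,4) by auto
qed

lemma carry_back:
  assumes "1 \<le> i" "i \<le> m" "lh i j = x" "x \<noteq> 0" "j \<le> N"
  shows "\<exists>p. 1 \<le> p \<and> p \<le> j \<and> lv i p = x \<and> (\<forall>k. p \<le> k \<and> k \<le> j \<longrightarrow> lh i k = x)"
  using assms(3,5)
proof (induction j)
  case 0 then show ?case using left_empty assms by simp
next
  case (Suc j)
  from came_right[OF assms(1,2) Suc.prems(1) assms(4) Suc.prems(2)]
  have "lv i (Suc j) = x \<or> lh i j = x" by simp
  then show ?case
  proof
    assume "lv i (Suc j) = x"
    then show ?thesis using Suc.prems(1) by (intro exI[of _ "Suc j"]) (auto simp: le_antisym)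
  next
    assume "lh i j = x"
    then obtain p where p: "1 \<le> p" "p \<le> j" "lv i p = x" "\<forall>k. p \<le> k \<and> k \<le> j \<longrightarrow> lh i k = x"
      using Suc by auto
    then show ?thesis using Suc.prems(1) by (intro exI[of _ p]) (auto simp: le_Suc_eq)
  qed
qed

lemma up_back:
  assumes "1 \<le> i" "i \<le> m" "lv (i - 1) q = x" "x \<noteq> 0"
  shows "\<exists>p. 1 \<le> p \<and> p \<le> q \<and> lv i p = x \<and> (\<forall>k. p \<le> k \<and> k < q \<longrightarrow> lh i k = x)"
proof -
  have q: "1 \<le> q" "q \<le> N" using in_columns[of "i - 1" q] assms by auto
  from came_up[OF assms] show ?thesis
  proof
    assume "lv i q = x" then show ?thesis using q by (intro exI[of _ q]) auto
  next
    assume "lh i (q - 1) = x"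
    have "q - 1 \<le> N" using q by simp
    from carry_back[OF assms(1,2) \<open>lh i (q - 1) = x\<close> assms(4) this]
    obtain p where p: "1 \<le> p" "p \<le> q - 1" "lv i p = x" "\<forall>k. p \<le> k \<and> k \<le> q - 1 \<longrightarrow> lh i k = x"
      by blast
    with q show ?thesis by (intro exI[of _ p]) auto
  qed
qed

lemma carry_forward:
  assumes "1 \<le> i" "i \<le> m" "lh i j = x" "x \<noteq> 0" "j \<le> N"
  shows "(\<forall>k. j \<le> k \<and> k \<le> N \<longrightarrow> lh i k = x) \<or>
    (\<exists>p. j < p \<and> p \<le> N \<and> lv (i - 1) p = x \<and> (\<forall>k. j \<le> k \<and> k < p \<longrightarrow> lh i k = x))"
  using assms(3,5)
proof (induction "N - j" arbitrary: j)
  case 0 then show ?case by (auto simp: le_antisym)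
next
  case (Suc d)
  then have "j < N" by auto
  from carried_on[OF assms(1,2) Suc.prems(1) assms(4) this] show ?case
  proof
    assume "lv (i - 1) (Suc j) = x"
    then show ?thesis using Suc.prems \<open>j < N\<close>
      by (intro disjI2 exI[of _ "Suc j"]) (auto simp: less_Suc_eq le_antisym)
  next
    assume A: "lh i (Suc j) = x"
    have "d = N - Suc j" using Suc by auto
    from Suc.hyps(1)[OF this A] \<open>j < N\<close>
    consider "\<forall>k. Suc j \<le> k \<and> k \<le> N \<longrightarrow> lh i k = x"
      | p where "Suc j < p" "p \<le> N" "lv (i - 1) p = x" "\<forall>k. Suc j \<le> k \<and> k < p \<longrightarrow> lh i k = x"
      by auto
    then show ?thesis
    proof cases
      case 1
      have "lh i k = x" if "j \<le> k" "k \<le> N" for k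
        using 1 that Suc.prems(1) by (cases "k = j") auto
      then show ?thesis by blast
    next
      case 2
      have "lh i k = x" if "j \<le> k" "k < p" for k
        using 2 that Suc.prems(1) by (cases "k = j") auto
      then show ?thesis using 2 by (intro disjI2 exI[of _ p]) auto
    qed
  qed
qed

lemma line_next:
  assumes "1 \<le> i" "i \<le> m" "lv i p = x" "x \<noteq> 0"
  shows "(lh i N = x \<and> (\<forall>k. p \<le> k \<and> k \<le> N \<longrightarrow> lh i k = x)) \<or>
    (\<exists>q. p \<le> q \<and> q \<le> N \<and> lv (i - 1) q = x \<and> (\<forall>k. p \<le> k \<and> k < q \<longrightarrow> lh i k = x))"
proof -
  have p: "1 \<le> p" "p \<le> N" using in_columns[of i p] assms by auto
  from up_or_right[OF assms] show ?thesis
  proof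
    assume "lv (i - 1) p = x" then show ?thesis using p by (intro disjI2 exI[of _ p]) auto
  next
    assume "lh i p = x"
    from carry_forward[OF assms(1,2) this assms(4) p(2)] show ?thesis
    proof
      assume A: "\<forall>k. p \<le> k \<and> k \<le> N \<longrightarrow> lh i k = x"
      then have "lh i N = x" using p by simp
      with A show ?thesis by simp
    next
      assume "\<exists>q. p < q \<and> q \<le> N \<and> lv (i - 1) q = x \<and> (\<forall>k. p \<le> k \<and> k < q \<longrightarrow> lh i k = x)"
      then show ?thesis using less_imp_le by blast
    qed
  qed
qed

text \<open>Going up from the bottom line, a label could only be doubled within a cell by leaving it through two
edges, and \<open>cell_twice\<close> says that it then came in twice.\<close>

lemma line_inj:
  assumes "i \<le> m" "lv i p = x" "lv i q = x" "x \<noteq> 0"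
  shows "p = q"
  using assms(1,2,3)
proof (induction "m - i" arbitrary: i p q)
  case 0 then show ?case using bottom assms(4) by (auto split: if_splits)
next
  case (Suc d)
  have i: "1 \<le> Suc i" "Suc i \<le> m" using Suc.hyps(2) by auto
  have IH: "a = b" if "lv (Suc i) a = x" "lv (Suc i) b = x" for a b
    by (rule Suc.hyps(1)[OF _ i(2) that]) (use Suc.hyps(2) in arith)
  have main: "\<not> p < q" if pq: "lv i p = x" "lv i q = x" for p q
  proof
    assume "p < q"
    have pq': "lv (Suc i - 1) p = x" "lv (Suc i - 1) q = x" using pq by simp_all
    obtain a where a: "1 \<le> a" "a \<le> p" "lv (Suc i) a = x"
      using up_back[OF i pq'(1) assms(4)] by blast
    obtain b where b: "b \<le> q" "lv (Suc i) b = x" "\<forall>k. b \<le> k \<and> k < q \<longrightarrow> lh (Suc i) k = x"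
      using up_back[OF i pq'(2) assms(4)] by blast
    have ba: "b = a" using IH a b by blast
    have pN: "p \<le> N" "1 \<le> p" using in_columns[of i p] pq assms(4) i by auto
    have r: "lh (Suc i) p = x" using b(3) a(2) ba \<open>p < q\<close> by blast
    have "cell (lh (Suc i) (p - 1)) (lv (Suc i) p) (lh (Suc i) p) (lv i p)"
      using cells[of "Suc i" p] i pN by simp
    then have eq: "lh (Suc i) (p - 1) = x" "lv (Suc i) p = x"
      using cell_twice[OF _ r pq(1) assms(4)] by auto
    have "p - 1 \<le> N" using pN by simp
    then obtain c where c: "c \<le> p - 1" "lv (Suc i) c = x"
      using carry_back[OF i eq(1) assms(4)] by blast
    have "c = p" using IH c(2) eq(2) by blast
    then show False using c(1) pN by simp
  qed
  show ?case using main[of p q] main[of q p] Suc.prems by (meson linorder_neqE_nat)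
qed

lemma line_label_le:
  assumes "i \<le> m" "lv i p = x" "x \<noteq> 0" shows "x \<le> p"
  using assms(1,2)
proof (induction "m - i" arbitrary: i p)
  case 0 then show ?case using bottom assms(3) by (auto split: if_splits)
next
  case (Suc d)
  then have i: "1 \<le> Suc i" "Suc i \<le> m" and "lv (Suc i - 1) p = x" by auto
  from up_back[OF this assms(3)] obtain a where a: "a \<le> p" "lv (Suc i) a = x" by blast
  then have "x \<le> a" using Suc.hyps(1)[of "Suc i" a] Suc.hyps(2) i by simp
  then show ?case using a by simp
qed

lemma carried_label_le:
  assumes "1 \<le> i" "i \<le> m" "lh i j = x" "x \<noteq> 0" "j \<le> N"
  shows "x \<le> j"
proof -
  obtain p where "p \<le> j" "lv i p = x" using carry_back[OF assms] by auto
  then show ?thesis using line_label_le[of i p x] assms by simp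
qed

text \<open>Wherever two labels meet, the larger one goes up and the smaller one goes right. So the smaller one
cannot get back to the left of the larger one.\<close>

lemma inverted_row:
  assumes i: "1 \<le> i" "i \<le> m" and z: "lv i p = z" and x: "lv i q = x" "x \<noteq> 0" and "p < q" "x < z"
  shows "\<exists>p'. lv (i - 1) p' = z \<and> (lh i N = x \<or> (\<exists>q'. p' < q' \<and> lv (i - 1) q' = x))"
proof -
  have z0: "z \<noteq> 0" using assms by auto
  have qN: "1 \<le> q" "q \<le> N" using in_columns[of i q] x i by auto
  have xn: "lh i N = x \<or> (\<exists>q'. q \<le> q' \<and> lv (i - 1) q' = x)" using line_next[OF i x] by auto
  show ?thesis
  proof (cases "lh i (q - 1) = z")
    case True
    then have "lh i q = x" "lv (i - 1) q = z"
      using cell_cross[OF cells[OF i qN]] x z0 \<open>x < z\<close> by auto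
    moreover have "lh i N = x \<or> (\<exists>q'. q < q' \<and> lv (i - 1) q' = x)"
      using carry_forward[OF i \<open>lh i q = x\<close> x(2) qN(2)] qN by auto
    ultimately show ?thesis by blast
  next
    case False
    have np: "\<not> (\<forall>k. p \<le> k \<and> k < b \<longrightarrow> lh i k = z)" if "q \<le> b" for b
    proof
      assume "\<forall>k. p \<le> k \<and> k < b \<longrightarrow> lh i k = z"
      moreover have "p \<le> q - 1" "q - 1 < b" using that \<open>p < q\<close> by auto
      ultimately show False using False by blast
    qed
    from line_next[OF i z z0] obtain p' where p': "lv (i - 1) p' = z" "p' < q"
    proof
      assume "lh i N = z \<and> (\<forall>k. p \<le> k \<and> k \<le> N \<longrightarrow> lh i k = z)"
      then show ?thesis using np[of q] qN by auto
    next
      assume "\<exists>r\<ge>p. r \<le> N \<and> lv (i - 1) r = z \<and> (\<forall>k. p \<le> k \<and> k < r \<longrightarrow> lh i k = z)"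
      then obtain r where r: "lv (i - 1) r = z" "\<forall>k. p \<le> k \<and> k < r \<longrightarrow> lh i k = z" by blast
      then have "\<not> q \<le> r" using np[of r] by blast
      then show ?thesis using that[of r] r by simp
    qed
    from xn show ?thesis
    proof
      assume "\<exists>q'\<ge>q. lv (i - 1) q' = x"
      then obtain q' where "q \<le> q'" "lv (i - 1) q' = x" by auto
      then have "p' < q'" using p' by simp
      then show ?thesis using p' \<open>lv (i - 1) q' = x\<close> by blast
    qed (use p' in blast)
  qed
qed

text \<open>On the bottom line the labels are increasing, so an inversion comes from a cell where the smaller
label arrives from the left.\<close>

lemma crossed_of_inverted:
  assumes "i \<le> m" "lv i p = z" "lv i q = x" "p < q" "x < z" "x \<noteq> 0"
  shows "\<exists>i' j'. i < i' \<and> i' \<le> m \<and> 1 \<le> j' \<and> j' \<le> p \<and> lh i' (j' - 1) = x \<and> lv i' j' = z"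
  using assms(1-4)
proof (induction "m - i" arbitrary: i p q)
  case 0
  then have "i = m" by simp
  then have "z = p \<or> z = 0" "x = q \<or> x = 0" using 0 bottom by metis+
  then show ?case using 0 assms by simp
next
  case (Suc d)
  have i: "1 \<le> Suc i" "Suc i \<le> m" using Suc.hyps(2) by auto
  have z0: "z \<noteq> 0" using assms(5) by simp
  have pq: "lv (Suc i - 1) p = z" "lv (Suc i - 1) q = x" using Suc.prems by simp_all
  obtain a where a: "1 \<le> a" "a \<le> p" "lv (Suc i) a = z" using up_back[OF i pq(1) z0] by blast
  obtain b where b: "b \<le> q" "lv (Suc i) b = x" "\<forall>k. b \<le> k \<and> k < q \<longrightarrow> lh (Suc i) k = x"
    using up_back[OF i pq(2) assms(6)] by blast
  consider "a < b" | "b < a" | "a = b" by linarith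
  then show ?case
  proof cases
    case 1
    have "d = m - Suc i" using Suc.hyps(2) by simp
    from Suc.hyps(1)[OF this i(2) a(3) b(2) 1] obtain i' j' where
      "Suc i < i'" "i' \<le> m" "1 \<le> j'" "j' \<le> a" "lh i' (j' - 1) = x" "lv i' j' = z" by blast
    then show ?thesis using a(2) by (intro exI[of _ i'] exI[of _ j']) simp
  next
    case 2
    have "b \<le> a - 1" "a - 1 < q" using 2 a(2) Suc.prems(4) by auto
    then have "lh (Suc i) (a - 1) = x" using b(3) by blast
    then show ?thesis using a i by (intro exI[of _ "Suc i"] exI[of _ a]) simp
  next
    case 3 then show ?thesis using a b assms by simp
  qed
qed

text \<open>Such a cell inverts its two labels on the line above, and by \<open>inverted_row\<close> they stay
inverted.\<close>

lemma inverted_of_crossed: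
  assumes c: "1 \<le> i'" "i' \<le> m" "1 \<le> j'" "j' \<le> N" "lh i' (j' - 1) = x" "lv i' j' = z" "x < z" "x \<noteq> 0"
    and "i < i'" "lv i p = z" "lv i q = x"
  shows "p < q"
  using assms(9-11)
proof (induction "i' - i" arbitrary: i p q)
  case 0 then show ?case by simp
next
  case (Suc d)
  have z0: "z \<noteq> 0" using c by simp
  show ?case
  proof (cases "Suc i = i'")
    case True
    have rt: "lh i' j' = x" "lv i j' = z" using cell_cross[OF cells[OF c(1-4)]] c True by auto
    have im: "i \<le> m" using c True by simp
    have pj: "p = j'" by (rule line_inj[OF im Suc.prems(2) rt(2) z0])
    have "q \<noteq> p" using Suc.prems c(7) by auto
    have "lv (i' - 1) q = x" using Suc.prems(3) True by auto
    then obtain b where b: "lv i' b = x" "b \<le> q" using up_back[OF c(1,2) _ c(8)] by blast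
    have jN: "j' - 1 \<le> N" using c(4) by simp
    obtain b' where b': "b' \<le> j' - 1" "lv i' b' = x" "\<forall>k. b' \<le> k \<and> k \<le> j' - 1 \<longrightarrow> lh i' k = x"
      using carry_back[OF c(1,2,5,8) jN] by blast
    show ?thesis
    proof (rule ccontr)
      assume "\<not> p < q"
      then have qj: "q < j'" using pj \<open>q \<noteq> p\<close> by simp
      have "b = b'" by (rule line_inj[OF c(2) b(1) b'(2) c(8)])
      then have "b' \<le> q" "q \<le> j' - 1" using b qj by auto
      then have "lh i' q = x" using b'(3) by simp
      moreover have q1: "1 \<le> q" "q \<le> N" using in_columns[of i q] Suc.prems(3) c(8) im by auto
      ultimately have "lh i' (q - 1) = x" "lv i' q = x"
        using cell_twice[OF cells[OF c(1,2) q1]] \<open>lv (i' - 1) q = x\<close> c(8) by auto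
      moreover have "q - 1 \<le> N" using q1 by simp
      ultimately obtain e where e: "e \<le> q - 1" "lv i' e = x" using carry_back[OF c(1,2) _ c(8)] by blast
      have "e = q" by (rule line_inj[OF c(2) e(2) \<open>lv i' q = x\<close> c(8)])
      then show False using e q1 by simp
    qed
  next
    case False
    then have i: "1 \<le> Suc i" "Suc i \<le> m" "Suc i < i'" using Suc c by auto
    have im: "i \<le> m" using i by simp
    have pq: "lv (Suc i - 1) p = z" "lv (Suc i - 1) q = x" using Suc.prems by simp_all
    obtain a where a: "lv (Suc i) a = z" using up_back[OF i(1,2) pq(1) z0] by blast
    obtain b where b: "lv (Suc i) b = x" using up_back[OF i(1,2) pq(2) c(8)] by blast
    have "a < b" by (rule Suc.hyps(1)[OF _ i(3) a b]) (use Suc.hyps(2) in simp)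
    from inverted_row[OF i(1,2) a b c(8) this c(7)] obtain p' where
      p': "lv i p' = z" "lh (Suc i) N = x \<or> (\<exists>q'. p' < q' \<and> lv i q' = x)" by auto
    have pp: "p' = p" by (rule line_inj[OF im p'(1) Suc.prems(2) z0])
    from p'(2) show ?thesis
    proof
      assume "\<exists>q'. p' < q' \<and> lv i q' = x"
      then obtain q' where "p' < q'" "lv i q' = x" by blast
      moreover have "q' = q" by (rule line_inj[OF im calculation(2) Suc.prems(3) c(8)])
      ultimately show ?thesis using pp by simp
    next
      assume ex: "lh (Suc i) N = x"
      have q1: "1 \<le> q" "q \<le> N" using in_columns[of i q] Suc.prems(3) c(8) im by auto
      obtain b' where b': "lv (Suc i) b' = x" "\<forall>k. b' \<le> k \<and> k \<le> N \<longrightarrow> lh (Suc i) k = x"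
        using carry_back[OF i(1,2) ex c(8)] by blast
      obtain b2 where b2: "b2 \<le> q" "lv (Suc i) b2 = x" using up_back[OF i(1,2) pq(2) c(8)] by blast
      have "b' = b2" by (rule line_inj[OF i(2) b'(1) b2(2) c(8)])
      then have "lh (Suc i) q = x" using b' b2 q1 by simp
      then have "lh (Suc i) (q - 1) = x" "lv (Suc i) q = x"
        using cell_twice[OF cells[OF i(1,2) q1]] pq(2) c(8) by auto
      moreover have "q - 1 \<le> N" using q1 by simp
      ultimately obtain e where e: "e \<le> q - 1" "lv (Suc i) e = x"
        using carry_back[OF i(1,2) _ c(8)] by blast
      have "e = q" by (rule line_inj[OF i(2) e(2) \<open>lv (Suc i) q = x\<close> c(8)])
      then show ?thesis using e q1 by simp
    qed
  qed
qed

lemma cell_labels_distinct: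
  assumes i: "1 \<le> i" "i \<le> m" and j: "1 \<le> j" "j \<le> N" and "lv i j \<noteq> 0"
  shows "lh i (j - 1) \<noteq> lv i j"
proof
  assume eq: "lh i (j - 1) = lv i j"
  have "j - 1 \<le> N" using j by simp
  then obtain p where p: "p \<le> j - 1" "lv i p = lv i j" using carry_back[OF i eq assms(5)] by blast
  have "p = j" by (rule line_inj[OF i(2) p(2) refl assms(5)])
  then show False using p j by simp
qed

text \<open>This makes the rule on repeated crossings local: comparing the two incoming labels of a cell tells
whether their pipes have crossed before.\<close>

lemma crossed_before_iff:
  assumes i: "1 \<le> i" "i \<le> m" and j: "1 \<le> j" "j \<le> N"
    and x: "x \<noteq> 0" "x < z" and ab: "{lh i (j - 1), lv i j} = {x, z}"
  shows "lv i j < lh i (j - 1) \<longleftrightarrow>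
    (\<exists>i' j'. i \<le> i' \<and> i' \<le> m \<and> 1 \<le> j' \<and> j' \<le> j \<and> (i', j') \<noteq> (i, j) \<and> lh i' (j' - 1) = x \<and> lv i' j' = z)"
proof
  assume "lv i j < lh i (j - 1)"
  then have a: "lh i (j - 1) = z" "lv i j = x" using ab x by (auto simp: doubleton_eq_iff)
  have "z \<noteq> 0" "j - 1 \<le> N" using x j by auto
  then obtain p where p: "p \<le> j - 1" "lv i p = z" using carry_back[OF i a(1)] by blast
  have "p < j" using p j by simp
  from crossed_of_inverted[OF i(2) p(2) a(2) this x(2,1)] obtain i' j' where
    "i < i'" "i' \<le> m" "1 \<le> j'" "j' \<le> p" "lh i' (j' - 1) = x" "lv i' j' = z" by blast
  then show "\<exists>i' j'. i \<le> i' \<and> i' \<le> m \<and> 1 \<le> j' \<and> j' \<le> j \<and> (i', j') \<noteq> (i, j) \<and> lh i' (j' - 1) = x \<and> lv i' j' = z"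
    using \<open>p < j\<close> by (intro exI[of _ i'] exI[of _ j']) auto
next
  assume "\<exists>i' j'. i \<le> i' \<and> i' \<le> m \<and> 1 \<le> j' \<and> j' \<le> j \<and> (i', j') \<noteq> (i, j) \<and> lh i' (j' - 1) = x \<and> lv i' j' = z"
  then obtain i' j' where c: "i \<le> i'" "i' \<le> m" "1 \<le> j'" "j' \<le> j" "(i', j') \<noteq> (i, j)"
    "lh i' (j' - 1) = x" "lv i' j' = z" by blast
  show "lv i j < lh i (j - 1)"
  proof (rule ccontr)
    assume "\<not> lv i j < lh i (j - 1)"
    then have a: "lh i (j - 1) = x" "lv i j = z" using ab x by (auto simp: doubleton_eq_iff)
    have z0: "z \<noteq> 0" "j - 1 \<le> N" using x j by auto
    obtain p where p: "p \<le> j - 1" "lv i p = x" using carry_back[OF i a(1) x(1) z0(2)] by blast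
    show False
    proof (cases "i' = i")
      case True
      then have "j' = j" using line_inj[OF i(2) _ a(2) z0(1), of j'] c(7) by simp
      then show False using True c(5) by simp
    next
      case False
      then have ii: "1 \<le> i'" "i < i'" "j' \<le> N" using c i j by auto
      have "j < p" by (rule inverted_of_crossed[OF ii(1) c(2,3) ii(3) c(6,7) x(2,1) ii(2) a(2) p(2)])
      then show False using p by simp
    qed
  qed
qed

end

text \<open>Having fewer rows than columns is allowed because diagrams are built row by row.\<close>

locale labelling = tableau N m "w ` {1..m}" lv lh for N m :: nat and w :: "nat \<Rightarrow> nat" and lv lh +
  assumes exits: "\<And>i. \<lbrakk>1 \<le> i; i \<le> m\<rbrakk> \<Longrightarrow> lh i N = w i"
    and inj: "inj_on w {1..m}"
    and range: "w ` {1..m} \<subseteq> {1..N}"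
begin

lemma exit_nonzero: "\<lbrakk>1 \<le> i; i \<le> m\<rbrakk> \<Longrightarrow> 1 \<le> w i \<and> w i \<le> N"
  using range by force

lemma exit_inj: "\<lbrakk>w k = w l; 1 \<le> k; k \<le> m; 1 \<le> l; l \<le> m\<rbrakk> \<Longrightarrow> k = l"
  by (rule inj_onD[OF inj]) simp_all

text \<open>From one line to the line above it, exactly one label is lost: the one that exits in the row in
between.\<close>

lemma line_labels:
  assumes "i \<le> m"
  shows "lv i ` {1..N} - {0} = w ` {1..i}"
  using assms
proof (induction "m - i" arbitrary: i)
  case 0
  then have [simp]: "i = m" by simp
  have "lv m p \<in> w ` {1..m}" if "lv m p \<noteq> 0" for p
    using that bottom[of p] by (auto split: if_splits)
  moreover have "x \<in> lv m ` {1..N} - {0}" if "x \<in> w ` {1..m}" for x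
    using that range bottom[of x] by (intro DiffI image_eqI[of _ _ x]) auto
  moreover have "0 \<notin> w ` {1..m}" using range by auto
  ultimately show ?case by auto
next
  case (Suc d)
  have i: "1 \<le> Suc i" "Suc i \<le> m" using Suc by auto
  have IH: "lv (Suc i) ` {1..N} - {0} = w ` {1..Suc i}"
    by (rule Suc.hyps(1)[OF _ i(2)]) (use Suc.hyps(2) in arith)
  have w0: "w (Suc i) \<noteq> 0" using exit_nonzero[of "Suc i"] i by auto
  obtain p where p: "lv (Suc i) p = w (Suc i)" "\<forall>k. p \<le> k \<and> k \<le> N \<longrightarrow> lh (Suc i) k = w (Suc i)"
    using carry_back[OF i exits[OF i] w0 order_refl] by blast
  show ?case
  proof (intro set_eqI iffI)
    fix x assume "x \<in> lv i ` {1..N} - {0}"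
    then obtain q where q: "lv i q = x" "x \<noteq> 0" "1 \<le> q" "q \<le> N" by auto
    have "lv (Suc i - 1) q = x" using q by simp
    then obtain a where a: "1 \<le> a" "a \<le> q" "lv (Suc i) a = x" "\<forall>k. a \<le> k \<and> k < q \<longrightarrow> lh (Suc i) k = x"
      using up_back[OF i _ q(2)] by blast
    have "a \<in> {1..N}" using a q by simp
    then have "x \<in> lv (Suc i) ` {1..N} - {0}" using q(2) a(3) by (intro DiffI image_eqI[of _ _ a]) simp_all
    then have "x \<in> w ` {1..Suc i}" unfolding IH .
    moreover have "x \<noteq> w (Suc i)"
    proof
      assume xw: "x = w (Suc i)"
      have "lv (Suc i) p = x" using p(1) xw by simp
      then have "a = p" by (rule line_inj[OF i(2) a(3) _ q(2)])
      then have "p \<le> q \<and> q \<le> N" using a(2) q(4) by simp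
      then have r: "lh (Suc i) q = x" using p(2) xw by simp
      have "cell (lh (Suc i) (q - 1)) (lv (Suc i) q) (lh (Suc i) q) (lv i q)"
        using cells[of "Suc i" q] i q by simp
      then have eq: "lh (Suc i) (q - 1) = x" "lv (Suc i) q = x"
        using cell_twice[OF _ r q(1,2)] by auto
      have "q - 1 \<le> N" using q by simp
      then obtain c where c: "c \<le> q - 1" "lv (Suc i) c = x"
        using carry_back[OF i eq(1) q(2)] by blast
      have "c = q" using line_inj[OF i(2) c(2) eq(2) q(2)] .
      then show False using c(1) q by simp
    qed
    ultimately obtain k where "x = w k" "1 \<le> k" "k \<le> Suc i" "k \<noteq> Suc i" by fastforce
    then show "x \<in> w ` {1..i}" by (intro image_eqI[of _ _ k]) auto
  next
    fix x assume x: "x \<in> w ` {1..i}"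
    then obtain k where k: "x = w k" "1 \<le> k" "k \<le> i" by auto
    have xw: "x \<noteq> w (Suc i)" using exit_inj[of k "Suc i"] k i by auto
    have "x \<in> lv (Suc i) ` {1..N} - {0}" unfolding IH using k by auto
    then obtain a where a: "lv (Suc i) a = x" "x \<noteq> 0" by blast
    then obtain q where q: "q \<le> N" "lv i q = x" using line_next[OF i a] xw exits[OF i] by auto
    have "i \<le> m" using i by simp
    have "q \<noteq> 0"
    proof
      assume "q = 0"
      then have "lv i q = 0" using outside[OF \<open>i \<le> m\<close>, of 0] by simp
      then show False using a(2) q(2) by simp
    qed
    then have "q \<in> {1..N}" using q by simp
    then show "x \<in> lv i ` {1..N} - {0}" using a(2) q(2) by (intro DiffI image_eqI[of _ _ q]) simp_all
  qed
qed

definition pos :: "nat \<Rightarrow> nat \<Rightarrow> nat" where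
  "pos i x = (THE p. lv i p = x)"

lemma pos_eq: "\<lbrakk>i \<le> m; lv i p = x; x \<noteq> 0\<rbrakk> \<Longrightarrow> pos i x = p"
  unfolding pos_def by (rule the_equality, assumption, rule line_inj)

lemma pos_label:
  assumes "i \<le> m" "1 \<le> k" "k \<le> i"
  shows "lv i (pos i (w k)) = w k"
proof -
  have "w k \<in> lv i ` {1..N} - {0}" unfolding line_labels[OF assms(1)] using assms by auto
  then obtain p where p: "lv i p = w k" "w k \<noteq> 0" by auto
  then show ?thesis using pos_eq[OF assms(1) p] by simp
qed

lemma label_row:
  assumes "i \<le> m" "lv i p \<noteq> 0"
  shows "\<exists>k. 1 \<le> k \<and> k \<le> i \<and> lv i p = w k"
proof -
  have "lv i p \<in> lv i ` {1..N} - {0}" using in_columns[OF assms(2,1)] assms by auto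
  then show ?thesis unfolding line_labels[OF assms(1)] by auto
qed

text \<open>By \<open>inverted_row\<close> the larger label is still on the line when the smaller one exits.\<close>

lemma inverted_rows:
  assumes "i \<le> m" "lv i p = w k" "lv i q = w l" "p < q" "w l < w k"
    and "1 \<le> k" "k \<le> i" "1 \<le> l" "l \<le> i"
  shows "k < l"
  using assms
proof (induction i arbitrary: p q)
  case 0 then show ?case by simp
next
  case (Suc i)
  have i: "1 \<le> Suc i" "Suc i \<le> m" using Suc by auto
  have wl: "w l \<noteq> 0" using exit_nonzero[of l] Suc.prems by auto
  have wk: "w k \<noteq> 0" using exit_nonzero[of k] Suc.prems by auto
  obtain p' where p': "lv i p' = w k" "lh (Suc i) N = w l \<or> (\<exists>q'. p' < q' \<and> lv i q' = w l)"
    using inverted_row[OF i Suc.prems(2,3) wl Suc.prems(4,5)] by auto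
  have "k \<noteq> Suc i"
  proof
    assume "k = Suc i"
    moreover obtain j where j: "1 \<le> j" "j \<le> i" "lv i p' = w j"
      using label_row[of i p'] p'(1) wk i by auto
    have "k = j" by (rule exit_inj) (use p'(1) j Suc.prems in auto)
    ultimately show False using j by simp
  qed
  then have k: "k \<le> i" using Suc.prems by auto
  show ?case
  proof (cases "l = Suc i")
    case True then show ?thesis using k by simp
  next
    case False
    then have l: "l \<le> i" using Suc.prems by auto
    have "w (Suc i) \<noteq> w l" using exit_inj[of "Suc i" l] False i Suc.prems by auto
    then obtain q' where q': "p' < q'" "lv i q' = w l" using p'(2) exits[OF i] by auto
    have "i \<le> m" using i by simp
    from Suc.IH[OF this p'(1) q'(2,1) Suc.prems(5,6) k Suc.prems(8) l] show ?thesis .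
  qed
qed

lemma pos_less:
  assumes "i \<le> m" "1 \<le> k" "k < l" "l \<le> i" "w k < w l"
  shows "pos i (w k) < pos i (w l)"
proof -
  have a: "lv i (pos i (w k)) = w k" "lv i (pos i (w l)) = w l" using pos_label assms by auto
  have "pos i (w k) \<noteq> pos i (w l)" using a assms(5) by (metis less_irrefl)
  moreover have "\<not> pos i (w l) < pos i (w k)"
    using inverted_rows[OF assms(1) a(2,1) _ assms(5)] assms by auto
  ultimately show ?thesis by simp
qed

end

section \<open>Bumpless pipe dreams as labellings\<close>

definition cell_tile :: "nat \<Rightarrow> nat \<Rightarrow> nat \<Rightarrow> nat \<Rightarrow> tile" where
  "cell_tile a b r t =
     (if a = 0 then (if b = 0 then Blank else if r \<noteq> 0 then Are else Vert)
      else if b = 0 then (if r \<noteq> 0 then Horiz else Jay) else Cross)"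

definition tiling_of :: "nat \<Rightarrow> (nat \<Rightarrow> nat \<Rightarrow> nat) \<Rightarrow> (nat \<Rightarrow> nat \<Rightarrow> nat) \<Rightarrow> tiling" where
  "tiling_of n lv lh = (\<lambda>i j. if i \<in> {1..n} \<and> j \<in> {1..n}
     then cell_tile (lh i (j - 1)) (lv i j) (lh i j) (lv (i - 1) j) else Blank)"

text \<open>A crossing tile is turned into a pair of turns when the larger label comes from the left; by
\<open>crossed_before_iff\<close> this is the condition in \<open>resolves\<close>.\<close>

definition resolution :: "tiling \<Rightarrow> (nat \<Rightarrow> nat \<Rightarrow> nat) \<Rightarrow> (nat \<Rightarrow> nat \<Rightarrow> nat) \<Rightarrow> tiling" where
  "resolution B lv lh = (\<lambda>i j. if B i j = Cross \<and> lv i j < lh i (j - 1) then Touch else B i j)"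

definition bears :: "nat \<Rightarrow> (nat \<Rightarrow> nat \<Rightarrow> nat) \<Rightarrow> (nat \<Rightarrow> nat \<Rightarrow> nat) \<Rightarrow> nat \<Rightarrow> nat \<Rightarrow> nat \<Rightarrow> edge \<Rightarrow> bool" where
  "bears n lv lh p i j e \<longleftrightarrow> i \<in> {1..n} \<and> j \<in> {1..n} \<and> p \<noteq> 0 \<and>
     (e = Bottom \<and> lv i j = p \<or> e = Left \<and> lh i (j - 1) = p)"

lemma cell_strands:
  assumes "cell a b r t" "a = 0 \<or> a \<noteq> b"
    and T: "T = (if cell_tile a b r t = Cross \<and> b < a then Touch else cell_tile a b r t)"
  shows "{Bottom, Top} \<in> strands T \<longleftrightarrow> b \<noteq> 0 \<and> t = b"
    and "{Left, Top} \<in> strands T \<longleftrightarrow> a \<noteq> 0 \<and> t = a"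
    and "{Bottom, Right} \<in> strands T \<longleftrightarrow> b \<noteq> 0 \<and> r = b"
    and "{Left, Right} \<in> strands T \<longleftrightarrow> a \<noteq> 0 \<and> r = a"
    and "{Bottom} \<notin> strands T" and "{Left, Bottom} \<notin> strands T"
  using assms
  by (auto simp: cell_def cell_tile_def doubleton_eq_iff singleton_insert_inj_eq singleton_insert_inj_eq'
      min_def max_def split: if_splits)

lemma cell_edges:
  assumes "cell a b r t"
  shows "Left \<in> edges (cell_tile a b r t) \<longleftrightarrow> a \<noteq> 0"
    and "Bottom \<in> edges (cell_tile a b r t) \<longleftrightarrow> b \<noteq> 0"
    and "Right \<in> edges (cell_tile a b r t) \<longleftrightarrow> r \<noteq> 0"
    and "Top \<in> edges (cell_tile a b r t) \<longleftrightarrow> t \<noteq> 0"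
  using assms by (auto simp: cell_def cell_tile_def edges_def min_def max_def split: if_splits)

lemma cell_tile_cases: "cell_tile a b r t \<in> {Blank, Vert, Horiz, Are, Jay, Cross}"
  by (auto simp: cell_tile_def)

lemma cell_tile_Cross: "cell_tile a b r t = Cross \<longleftrightarrow> a \<noteq> 0 \<and> b \<noteq> 0"
  by (auto simp: cell_tile_def)

lemma enters_bottom_left:
  assumes "enters n T Bottom p i j e"
    and "\<And>i j. i \<in> {1..n} \<Longrightarrow> j \<in> {1..n} \<Longrightarrow> {Bottom} \<notin> strands (T i j) \<and> {Left, Bottom} \<notin> strands (T i j)"
  shows "i \<in> {1..n} \<and> j \<in> {1..n} \<and> (e = Bottom \<or> e = Left)"
  using assms(1)
proof (induction rule: enters.induct)
  case (down p i j e)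
  then have "{Bottom} \<notin> strands (T i j)" "{Left, Bottom} \<notin> strands (T i j)" using assms(2) by auto
  then show ?case using down by auto
qed auto

text \<open>The diagram of a bumpless pipe dream of size \<open>n\<close>, apart from any condition on its
exits.\<close>

locale full = tableau n n "{1..n}" lv lh for n lv lh
begin

lemma bottom_label: "j \<in> {1..n} \<Longrightarrow> lv n j = j"
  using bottom[of j] by simp

abbreviation "B \<equiv> tiling_of n lv lh"
abbreviation "T0 \<equiv> resolution B lv lh"

lemma tile: "i \<in> {1..n} \<Longrightarrow> j \<in> {1..n} \<Longrightarrow> B i j = cell_tile (lh i (j - 1)) (lv i j) (lh i j) (lv (i - 1) j)"
  by (simp add: tiling_of_def)

lemma T0_strands:
  assumes ij: "i \<in> {1..n}" "j \<in> {1..n}"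
  shows "{Bottom, Top} \<in> strands (T0 i j) \<longleftrightarrow> lv i j \<noteq> 0 \<and> lv (i - 1) j = lv i j"
    and "{Left, Top} \<in> strands (T0 i j) \<longleftrightarrow> lh i (j - 1) \<noteq> 0 \<and> lv (i - 1) j = lh i (j - 1)"
    and "{Bottom, Right} \<in> strands (T0 i j) \<longleftrightarrow> lv i j \<noteq> 0 \<and> lh i j = lv i j"
    and "{Left, Right} \<in> strands (T0 i j) \<longleftrightarrow> lh i (j - 1) \<noteq> 0 \<and> lh i j = lh i (j - 1)"
    and "{Bottom} \<notin> strands (T0 i j)" and "{Left, Bottom} \<notin> strands (T0 i j)"
proof -
  have c: "cell (lh i (j - 1)) (lv i j) (lh i j) (lv (i - 1) j)" using cells[of i j] ij by simp
  have d: "lh i (j - 1) = 0 \<or> lh i (j - 1) \<noteq> lv i j" using cell_labels_distinct[of i j] ij by auto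
  have T: "T0 i j = (if cell_tile (lh i (j - 1)) (lv i j) (lh i j) (lv (i - 1) j) = Cross \<and> lv i j < lh i (j - 1)
     then Touch else cell_tile (lh i (j - 1)) (lv i j) (lh i j) (lv (i - 1) j))"
    unfolding resolution_def tile[OF ij] ..
  show "{Bottom, Top} \<in> strands (T0 i j) \<longleftrightarrow> lv i j \<noteq> 0 \<and> lv (i - 1) j = lv i j"
    "{Left, Top} \<in> strands (T0 i j) \<longleftrightarrow> lh i (j - 1) \<noteq> 0 \<and> lv (i - 1) j = lh i (j - 1)"
    "{Bottom, Right} \<in> strands (T0 i j) \<longleftrightarrow> lv i j \<noteq> 0 \<and> lh i j = lv i j"
    "{Left, Right} \<in> strands (T0 i j) \<longleftrightarrow> lh i (j - 1) \<noteq> 0 \<and> lh i j = lh i (j - 1)"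
    "{Bottom} \<notin> strands (T0 i j)" "{Left, Bottom} \<notin> strands (T0 i j)"
    using cell_strands[OF c d T] by blast+
qed

text \<open>Pipes reach a cell from below and from the left, so it is enough that \<open>T\<close> agrees with
the resolution there. In this form the lemma can be used inside the inductive proof of
\<open>resolves_unique\<close>.\<close>

lemma enters_iff_bears_local:
  assumes ij: "i \<in> {1..n}" "j \<in> {1..n}"
    and eq: "\<And>i' j'. \<lbrakk>i \<le> i'; i' \<le> n; 1 \<le> j'; j' \<le> j; (i', j') \<noteq> (i, j)\<rbrakk> \<Longrightarrow> T i' j' = T0 i' j'"
    and T: "\<And>i j. i \<in> {1..n} \<Longrightarrow> j \<in> {1..n} \<Longrightarrow> {Bottom} \<notin> strands (T i j) \<and> {Left, Bottom} \<notin> strands (T i j)"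
  shows "enters n T Bottom p i j e \<longleftrightarrow> bears n lv lh p i j e"
  using ij eq
proof (induction "n - i + j" arbitrary: i j p e rule: less_induct)
  case less
  note ij = less.prems(1,2)
  have below: "enters n T Bottom p (Suc i) j e \<longleftrightarrow> bears n lv lh p (Suc i) j e" if "i < n" for e
    by (rule less.hyps) (use that ij in \<open>auto intro!: less.prems(3)\<close>)
  have lefto: "enters n T Bottom p i (j - 1) e \<longleftrightarrow> bears n lv lh p i (j - 1) e" if "1 < j" for e
    by (rule less.hyps) (use that ij in \<open>auto intro!: less.prems(3)\<close>)
  show ?case
  proof
    assume "enters n T Bottom p i j e"
    then show "bears n lv lh p i j e"
    proof cases
      case from_bottom then show ?thesis using ij bottom_label by (simp add: bears_def)
    next
      case from_top then show ?thesis by simp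
    next
      case (up e')
      have i: "i < n" "Suc i \<in> {1..n}" using enters_bottom_left[OF up(2) T] by auto
      have eqT: "T (Suc i) j = T0 (Suc i) j" by (rule less.prems(3)) (use i ij in auto)
      have be: "bears n lv lh p (Suc i) j e'" using below[OF i(1)] up(2) by blast
      have "lv i j = p \<and> p \<noteq> 0"
        using be up(3) T0_strands(1,2)[OF i(2) ij(2)] unfolding eqT bears_def by auto
      then show ?thesis using up(1) ij by (simp add: bears_def)
    next
      case (down i' e')
      then show ?thesis using enters_bottom_left[OF \<open>enters n T Bottom p i j e\<close> T] by simp
    next
      case (right j' e')
      have "1 \<le> j'" using enters_bottom_left[OF right(3) T] by simp
      then have j: "1 < j" "j' = j - 1" using right(1) by linarith+
      have R: "enters n T Bottom p i (j - 1) e'" "{e', Right} \<in> strands (T i (j - 1))"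
        using right(3,4) unfolding j(2) by blast+
      have ij': "j - 1 \<in> {1..n}" using j(1) ij by auto
      have eqT: "T i (j - 1) = T0 i (j - 1)" by (rule less.prems(3)) (use ij j(1) in auto)
      have be: "bears n lv lh p i (j - 1) e'" using lefto[OF j(1)] R(1) by blast
      have "lh i (j - 1) = p \<and> p \<noteq> 0"
        using be R(2) T0_strands(3,4)[OF ij(1) ij'] unfolding eqT bears_def by auto
      then show ?thesis using right(2) ij by (simp add: bears_def)
    qed
  next
    assume b: "bears n lv lh p i j e"
    then have p0: "p \<noteq> 0" by (simp add: bears_def)
    from b have "e = Bottom \<and> lv i j = p \<or> e = Left \<and> lh i (j - 1) = p" by (simp add: bears_def)
    then show "enters n T Bottom p i j e"
    proof
      assume e: "e = Bottom \<and> lv i j = p"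
      show ?thesis
      proof (cases "i = n")
        case True then show ?thesis using e ij bottom_label by (auto intro: enters.from_bottom)
      next
        case False
        then have i: "i < n" "Suc i \<in> {1..n}" using ij by auto
        have eqT: "T (Suc i) j = T0 (Suc i) j" using less.prems(3)[of "Suc i" j] i ij by simp
        have "lv (Suc i) j = p \<or> lh (Suc i) (j - 1) = p" using came_up[of "Suc i" j p] e p0 i by auto
        then have "\<exists>e'. bears n lv lh p (Suc i) j e' \<and> {e', Top} \<in> strands (T0 (Suc i) j)"
        proof
          assume "lv (Suc i) j = p"
          then show ?thesis using T0_strands(1)[OF i(2) ij(2)] e p0 i ij by (intro exI[of _ Bottom]) (auto simp: bears_def)
        next
          assume "lh (Suc i) (j - 1) = p"
          then show ?thesis using T0_strands(2)[OF i(2) ij(2)] e p0 i ij by (intro exI[of _ Left]) (auto simp: bears_def)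
        qed
        then obtain e' where "enters n T Bottom p (Suc i) j e'" "{e', Top} \<in> strands (T (Suc i) j)"
          using below[OF i(1)] eqT by auto
        then show ?thesis using e ij by (auto intro: enters.up)
      qed
    next
      assume e: "e = Left \<and> lh i (j - 1) = p"
      then have j: "1 < j" "j - 1 \<in> {1..n}" using left_empty[of i] p0 ij by (cases "j = 1"; auto)+
      have eqT: "T i (j - 1) = T0 i (j - 1)" using less.prems(3)[of i "j - 1"] j ij by simp
      have "lv i (j - 1) = p \<or> lh i (j - 1 - 1) = p"
        using came_right[of i "j - 1" p] e p0 ij by auto
      then have "\<exists>e'. bears n lv lh p i (j - 1) e' \<and> {e', Right} \<in> strands (T0 i (j - 1))"
      proof
        assume "lv i (j - 1) = p"
        then show ?thesis using T0_strands(3)[OF ij(1) j(2)] e p0 j ij by (intro exI[of _ Bottom]) (auto simp: bears_def)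
      next
        assume "lh i (j - 1 - 1) = p"
        then show ?thesis using T0_strands(4)[OF ij(1) j(2)] e p0 j ij by (intro exI[of _ Left]) (auto simp: bears_def)
      qed
      then obtain e' where "enters n T Bottom p i (j - 1) e'" "{e', Right} \<in> strands (T i (j - 1))"
        using lefto[OF j(1)] eqT by auto
      then have "enters n T Bottom p i (Suc (j - 1)) Left" using j ij by (intro enters.right) auto
      then show ?thesis using e j by simp
    qed
  qed
qed

lemma outside_blank: "i \<notin> {1..n} \<or> j \<notin> {1..n} \<Longrightarrow> B i j = Blank"
  by (auto simp: tiling_of_def)

lemma tiling_cases: "B i j \<in> {Blank, Vert, Horiz, Are, Jay, Cross}"
  using cell_tile_cases[of "lh i (j - 1)" "lv i j" "lh i j" "lv (i - 1) j"]
  by (simp add: tiling_of_def)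

lemma enters_T0: "enters n T0 Bottom p i j e \<longleftrightarrow> bears n lv lh p i j e"
proof (cases "i \<in> {1..n} \<and> j \<in> {1..n}")
  case True
  then show ?thesis using enters_iff_bears_local[of i j T0] T0_strands(5,6) by blast
next
  case False
  have "\<not> enters n T0 Bottom p i j e"
    using enters_bottom_left[of n T0 p i j e] T0_strands(5,6) False by blast
  then show ?thesis using False by (auto simp: bears_def)
qed

lemma passes_iff: 
  assumes "\<And>e. enters n T Bottom p i j e \<longleftrightarrow> bears n lv lh p i j e"
  shows "passes n T Bottom p i j \<longleftrightarrow> i \<in> {1..n} \<and> j \<in> {1..n} \<and> p \<noteq> 0 \<and> (lv i j = p \<or> lh i (j - 1) = p)"
  unfolding passes_def assms by (auto simp: bears_def)

lemma cross_at_iff: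
  assumes "\<And>p e. enters n T Bottom p i j e \<longleftrightarrow> bears n lv lh p i j e" "T i j = T0 i j"
    and pq: "p \<noteq> q" "{p, q} = {x, z}" "x < z" "x \<noteq> 0"
  shows "cross_at n T Bottom p q i j \<longleftrightarrow>
    i \<in> {1..n} \<and> j \<in> {1..n} \<and> lh i (j - 1) = x \<and> lv i j = z"
proof -
  have "cross_at n T Bottom p q i j \<longleftrightarrow> i \<in> {1..n} \<and> j \<in> {1..n} \<and>
     (lv i j = p \<or> lh i (j - 1) = p) \<and> (lv i j = q \<or> lh i (j - 1) = q) \<and> p \<noteq> 0 \<and> q \<noteq> 0 \<and> T0 i j = Cross"
    unfolding cross_at_def passes_iff[OF assms(1)] assms(2) using pq by auto
  also have "\<dots> \<longleftrightarrow> i \<in> {1..n} \<and> j \<in> {1..n} \<and>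
     (lv i j = p \<and> lh i (j - 1) = q \<or> lv i j = q \<and> lh i (j - 1) = p) \<and> p \<noteq> 0 \<and> q \<noteq> 0 \<and> T0 i j = Cross"
    using pq(1) by auto
  also have "\<dots> \<longleftrightarrow> i \<in> {1..n} \<and> j \<in> {1..n} \<and> lh i (j - 1) = x \<and> lv i j = z"
    using pq(2-4) by (auto simp: doubleton_eq_iff resolution_def tile cell_tile_Cross split: if_splits)
  finally show ?thesis .
qed

lemma resolution_resolves: "resolves n B T0"
  unfolding resolves_def
proof (intro conjI allI impI)
  fix i j assume "B i j \<noteq> Cross" then show "T0 i j = B i j" by (simp add: resolution_def)
next
  fix i j assume "B i j = Cross" then show "T0 i j \<in> {Cross, Touch}" by (simp add: resolution_def)
next
  fix i j p q
  assume A: "B i j = Cross \<and> p \<noteq> q \<and> passes n T0 Bottom p i j \<and> passes n T0 Bottom q i j"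
  then have ij: "i \<in> {1..n}" "j \<in> {1..n}" using outside_blank[of i j] by auto
  have pq: "p \<noteq> 0" "q \<noteq> 0" "p \<noteq> q" "{lh i (j - 1), lv i j} = {p, q}"
    using A unfolding passes_iff[OF enters_T0] by auto
  define x z where "x = min p q" and "z = max p q"
  have xz: "{p, q} = {x, z}" "x < z" "x \<noteq> 0" using pq by (auto simp: x_def z_def min_def max_def)
  have "T0 i j = Touch \<longleftrightarrow> lv i j < lh i (j - 1)" using A by (simp add: resolution_def)
  also have "\<dots> \<longleftrightarrow> (\<exists>i' j'. i \<le> i' \<and> i' \<le> n \<and> 1 \<le> j' \<and> j' \<le> j \<and> (i', j') \<noteq> (i, j) \<and> lh i' (j' - 1) = x \<and> lv i' j' = z)"
    by (rule crossed_before_iff) (use ij pq xz in auto)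
  also have "\<dots> \<longleftrightarrow> (\<exists>i' j'. i \<le> i' \<and> j' \<le> j \<and> (i', j') \<noteq> (i, j) \<and> cross_at n T0 Bottom p q i' j')"
    unfolding cross_at_iff[OF enters_T0 refl pq(3) xz] using ij by (intro iff_exI) auto
  finally show "T0 i j = Touch \<longleftrightarrow> (\<exists>i' j'. i \<le> i' \<and> j' \<le> j \<and> (i', j') \<noteq> (i, j) \<and> cross_at n T0 Bottom p q i' j')" .
qed

text \<open>Whether a tile has to be resolved depends on the pipes that reach it, hence on tiles that are
already known to agree, in the order from the lower left corner.\<close>

lemma resolves_unique:
  assumes "resolves n B T" and ij: "i \<in> {1..n}" "j \<in> {1..n}"
  shows "T i j = T0 i j"
proof -
  have strandsT: "{Bottom} \<notin> strands (T i j) \<and> {Left, Bottom} \<notin> strands (T i j)" for i j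
  proof -
    have "T i j \<in> {Blank, Vert, Horiz, Are, Jay, Cross, Touch}"
      using assms(1) tiling_cases[of i j] unfolding resolves_def by fastforce
    then show ?thesis by (auto simp: doubleton_eq_iff singleton_insert_inj_eq singleton_insert_inj_eq')
  qed
  show ?thesis using ij
  proof (induction "n - i + j" arbitrary: i j rule: less_induct)
    case less
    note ij = less.prems
    have eq: "T i' j' = T0 i' j'" if "i \<le> i'" "i' \<le> n" "1 \<le> j'" "j' \<le> j" "(i', j') \<noteq> (i, j)" for i' j'
      by (rule less.hyps) (use that ij in auto)
    have ent: "enters n T Bottom p i' j' e \<longleftrightarrow> bears n lv lh p i' j' e"
      if "i \<le> i'" "i' \<le> n" "1 \<le> j'" "j' \<le> j" for i' j' p e
      by (rule enters_iff_bears_local) (use that ij eq strandsT in auto)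
    show ?case
    proof (cases "B i j = Cross")
      case False then show ?thesis using assms(1) by (simp add: resolves_def resolution_def)
    next
      case True
      define p q where "p = lh i (j - 1)" and "q = lv i j"
      have pq: "p \<noteq> 0" "q \<noteq> 0" using True tile[OF ij] by (auto simp: p_def q_def cell_tile_Cross)
      have "p \<noteq> q" unfolding p_def q_def by (rule cell_labels_distinct) (use ij pq in \<open>auto simp: q_def\<close>)
      define x z where "x = min p q" and "z = max p q"
      have xz: "{p, q} = {x, z}" "x < z" "x \<noteq> 0"
        using pq \<open>p \<noteq> q\<close> by (auto simp: x_def z_def min_def max_def)
      have pas: "passes n T Bottom p i j" "passes n T Bottom q i j"
        using passes_iff[OF ent[of i j]] ij pq by (auto simp: p_def q_def)
      then have "T i j = Touch \<longleftrightarrow> (\<exists>i' j'. i \<le> i' \<and> j' \<le> j \<and> (i', j') \<noteq> (i, j) \<and> cross_at n T Bottom p q i' j')"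
        using assms(1) True \<open>p \<noteq> q\<close> unfolding resolves_def by blast
      also have "\<dots> \<longleftrightarrow> (\<exists>i' j'. i \<le> i' \<and> i' \<le> n \<and> 1 \<le> j' \<and> j' \<le> j \<and> (i', j') \<noteq> (i, j) \<and> lh i' (j' - 1) = x \<and> lv i' j' = z)"
      proof (intro iff_exI)
        fix i' j'
        have "cross_at n T Bottom p q i' j' \<longleftrightarrow> lh i' (j' - 1) = x \<and> lv i' j' = z"
          if c: "i \<le> i'" "i' \<le> n" "1 \<le> j'" "j' \<le> j" "(i', j') \<noteq> (i, j)"
          using cross_at_iff[OF ent[OF c(1-4)] eq[OF c] \<open>p \<noteq> q\<close> xz] c ij by auto
        moreover have "i' \<in> {1..n} \<and> j' \<in> {1..n}" if "cross_at n T Bottom p q i' j'"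
          using that enters_bottom_left[of n T p i' j'] strandsT unfolding cross_at_def passes_def by blast
        ultimately show "(i \<le> i' \<and> j' \<le> j \<and> (i', j') \<noteq> (i, j) \<and> cross_at n T Bottom p q i' j') \<longleftrightarrow>
          (i \<le> i' \<and> i' \<le> n \<and> 1 \<le> j' \<and> j' \<le> j \<and> (i', j') \<noteq> (i, j) \<and> lh i' (j' - 1) = x \<and> lv i' j' = z)"
          by auto
      qed
      also have "\<dots> \<longleftrightarrow> lv i j < lh i (j - 1)"
        by (rule crossed_before_iff[symmetric]) (use ij xz in \<open>auto simp: p_def q_def\<close>)
      finally have "T i j = Touch \<longleftrightarrow> lv i j < lh i (j - 1)" .
      moreover have "T i j \<in> {Cross, Touch}" using assms(1) True by (simp add: resolves_def)
      ultimately show ?thesis using True by (auto simp: resolution_def)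
    qed
  qed
qed

lemma exits_at_row_iff:
  assumes "resolves n B T" "i \<in> {1..n}" "p \<noteq> 0"
  shows "exits_at_row n T Bottom p i \<longleftrightarrow> lh i n = p"
proof -
  have n: "n \<in> {1..n}" using assms(2) by auto
  have strandsT: "{Bottom} \<notin> strands (T i j) \<and> {Left, Bottom} \<notin> strands (T i j)"
    if "i \<in> {1..n}" "j \<in> {1..n}" for i j
    using resolves_unique[OF assms(1) that] T0_strands(5,6)[OF that] by simp
  have ent: "enters n T Bottom p i n e \<longleftrightarrow> bears n lv lh p i n e" for e
    by (rule enters_iff_bears_local) (use assms n resolves_unique[OF assms(1)] strandsT in auto)
  have "exits_at_row n T Bottom p i \<longleftrightarrow> (\<exists>e. bears n lv lh p i n e \<and> {e, Right} \<in> strands (T0 i n))"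
    unfolding exits_at_row_def ent resolves_unique[OF assms(1,2) n] ..
  also have "\<dots> \<longleftrightarrow> (lv i n = p \<and> lh i n = p) \<or> (lh i (n - 1) = p \<and> lh i n = p)"
  proof -
    have "(\<exists>e. bears n lv lh p i n e \<and> {e, Right} \<in> strands (T0 i n)) \<longleftrightarrow>
      lv i n = p \<and> {Bottom, Right} \<in> strands (T0 i n) \<or> lh i (n - 1) = p \<and> {Left, Right} \<in> strands (T0 i n)"
      using assms(2,3) n unfolding bears_def by blast
    also have "\<dots> \<longleftrightarrow> (lv i n = p \<and> lh i n = p) \<or> (lh i (n - 1) = p \<and> lh i n = p)"
      unfolding T0_strands(3,4)[OF assms(2) n] using assms(3) by metis
    finally show ?thesis .
  qed
  also have "\<dots> \<longleftrightarrow> lh i n = p"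
  proof
    assume "lh i n = p"
    moreover have "1 \<le> i" "i \<le> n" using assms(2) by auto
    ultimately show "(lv i n = p \<and> lh i n = p) \<or> (lh i (n - 1) = p \<and> lh i n = p)"
      using came_right[OF _ _ \<open>lh i n = p\<close> assms(3) order_refl] by blast
  qed blast
  finally show ?thesis .
qed

lemma tiling_is_bpd:
  assumes "\<And>i. i \<in> {1..n} \<Longrightarrow> lh i n \<noteq> 0"
  shows "is_bpd n B"
  unfolding is_bpd_def
proof (intro conjI ballI allI impI)
  have ce: "cell (lh i (j - 1)) (lv i j) (lh i j) (lv (i - 1) j)" if "i \<in> {1..n}" "j \<in> {1..n}" for i j
    using cells[of i j] that by simp
  note ed = cell_edges[OF ce]
  fix i j
  show "B i j \<in> {Blank, Vert, Horiz, Are, Jay, Cross}" by (rule tiling_cases)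
  show "i \<notin> {1..n} \<or> j \<notin> {1..n} \<Longrightarrow> B i j = Blank" by (rule outside_blank)
  show "Right \<in> edges (B i j) \<longleftrightarrow> Left \<in> edges (B i (Suc j))" if "i \<in> {1..n}" "j \<in> {1..<n}"
    using ed[of i j] ed[of i "Suc j"] that by (simp add: tile)
  show "Bottom \<in> edges (B i j) \<longleftrightarrow> Top \<in> edges (B (Suc i) j)" if "i \<in> {1..<n}" "j \<in> {1..n}"
    using ed[of i j] ed[of "Suc i" j] that by (simp add: tile)
  show "Bottom \<in> edges (B n j)" if "j \<in> {1..n}"
    using ed[of n j] that bottom_label[of j] by (simp add: tile)
  show "Right \<in> edges (B i n)" if "i \<in> {1..n}"
    using ed[of i n] that assms[of i] by (simp add: tile)
  show "Top \<notin> edges (B 1 j)" if "j \<in> {1..n}"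
    using ed[of 1 j] that top_empty[of j] by (simp add: tile)
  show "Left \<notin> edges (B i 1)" if "i \<in> {1..n}"
    using ed[of i 1] that left_empty[of i] by (simp add: tile)
qed

end

theorem labelling_BPD:
  assumes "labelling n n w lv lh"
  shows "tiling_of n lv lh \<in> BPD n w"
proof -
  interpret L: labelling n n w lv lh by fact
  have "w ` {1..n} = {1..n}"
    using L.inj L.range by (simp add: card_image card_subset_eq)
  then interpret full n lv lh using L.tableau_axioms by (simp add: full_def)
  have w0: "w i \<noteq> 0" "lh i n = w i" if "i \<in> {1..n}" for i
    using L.exit_nonzero[of i] L.exits[of i] that by auto
  have "is_bpd n B" by (rule tiling_is_bpd) (use w0 in auto)
  moreover have "has_permutation n B w"
    unfolding has_permutation_def
    using resolution_resolves exits_at_row_iff[OF resolution_resolves] w0 by blast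
  ultimately show ?thesis by (simp add: BPD_def)
qed

fun right_out :: "tile \<Rightarrow> nat \<Rightarrow> nat \<Rightarrow> nat" where
  "right_out Horiz a b = a"
| "right_out Are a b = b"
| "right_out Cross a b = min a b"
| "right_out _ a b = 0"

fun top_out :: "tile \<Rightarrow> nat \<Rightarrow> nat \<Rightarrow> nat" where
  "top_out Vert a b = b"
| "top_out Jay a b = a"
| "top_out Cross a b = max a b"
| "top_out _ a b = 0"

text \<open>The labels are computed from a tiling by running the rule from the lower left corner;
\<open>line_from_bottom n B d\<close> is line \<open>n - d\<close>.\<close>

primrec row_labels :: "(nat \<Rightarrow> tile) \<Rightarrow> (nat \<Rightarrow> nat) \<Rightarrow> nat \<Rightarrow> nat" where
  "row_labels t v 0 = 0"
| "row_labels t v (Suc j) = right_out (t (Suc j)) (row_labels t v j) (v (Suc j))"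

primrec line_from_bottom :: "nat \<Rightarrow> tiling \<Rightarrow> nat \<Rightarrow> nat \<Rightarrow> nat" where
  "line_from_bottom n B 0 = (\<lambda>j. if j \<in> {1..n} then j else 0)"
| "line_from_bottom n B (Suc d) = (\<lambda>j. if j \<in> {1..n} then
     top_out (B (n - d) j) (row_labels (B (n - d)) (line_from_bottom n B d) (j - 1)) (line_from_bottom n B d j) else 0)"

lemma tile_out:
  assumes "t \<in> {Blank, Vert, Horiz, Are, Jay, Cross}"
    "Left \<in> edges t \<longleftrightarrow> a \<noteq> 0" "Bottom \<in> edges t \<longleftrightarrow> b \<noteq> 0"
  shows "cell a b (right_out t a b) (top_out t a b)"
    and "Right \<in> edges t \<longleftrightarrow> right_out t a b \<noteq> 0"
    and "Top \<in> edges t \<longleftrightarrow> top_out t a b \<noteq> 0"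
    and "cell_tile a b (right_out t a b) (top_out t a b) = t"
proof -
  have "cell a b (right_out t a b) (top_out t a b) \<and>
    (Right \<in> edges t \<longleftrightarrow> right_out t a b \<noteq> 0) \<and> (Top \<in> edges t \<longleftrightarrow> top_out t a b \<noteq> 0) \<and>
    cell_tile a b (right_out t a b) (top_out t a b) = t"
    using assms by (cases t) (simp_all add: cell_def cell_tile_def edges_def)
  then show "cell a b (right_out t a b) (top_out t a b)"
    "Right \<in> edges t \<longleftrightarrow> right_out t a b \<noteq> 0" "Top \<in> edges t \<longleftrightarrow> top_out t a b \<noteq> 0"
    "cell_tile a b (right_out t a b) (top_out t a b) = t" by blast+
qed

text \<open>The computed labels reproduce the tiling, and since the resolution is unique, row \<open>i\<close>
exits with the label that any resolution of the tiling prescribes.\<close>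

theorem BPD_labelling:
  assumes B: "B \<in> BPD n w" and w: "w permutes {1..n}"
  shows "\<exists>lv lh. labelling n n w lv lh \<and> B = tiling_of n lv lh"
proof -
  define lv where "lv i = line_from_bottom n B (n - i)" for i
  define lh where "lh i = row_labels (B i) (lv i)" for i
  have bpd: "is_bpd n B" using B by (simp add: BPD_def)
  have tcases: "B i j \<in> {Blank, Vert, Horiz, Are, Jay, Cross}" for i j
    using bpd unfolding is_bpd_def by blast
  have up: "lv (i - 1) j = top_out (B i j) (lh i (j - 1)) (lv i j)" if "i \<in> {1..n}" "j \<in> {1..n}" for i j
  proof -
    have "n - (i - 1) = Suc (n - i)" "n - (n - i) = i" using that by auto
    then show ?thesis using that by (simp add: lv_def lh_def)
  qed
  have rt: "lh i j = right_out (B i j) (lh i (j - 1)) (lv i j)" if "j \<in> {1..n}" for i j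
    using that by (cases j) (auto simp: lh_def)
  have lab: "(Bottom \<in> edges (B i j) \<longleftrightarrow> lv i j \<noteq> 0) \<and> (Left \<in> edges (B i j) \<longleftrightarrow> lh i (j - 1) \<noteq> 0)"
    if "i \<in> {1..n}" "j \<in> {1..n}" for i j
    using that
  proof (induction "n - i + j" arbitrary: i j rule: less_induct)
    case less
    note ij = less.prems
    have b: "Bottom \<in> edges (B i j) \<longleftrightarrow> lv i j \<noteq> 0"
    proof (cases "i = n")
      case True
      then show ?thesis using bpd ij by (simp add: is_bpd_def lv_def)
    next
      case False
      then have i: "Suc i \<in> {1..n}" "i \<in> {1..<n}" using ij by auto
      have "Bottom \<in> edges (B i j) \<longleftrightarrow> Top \<in> edges (B (Suc i) j)"
        using bpd i ij unfolding is_bpd_def by blast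
      also have "\<dots> \<longleftrightarrow> top_out (B (Suc i) j) (lh (Suc i) (j - 1)) (lv (Suc i) j) \<noteq> 0"
        by (rule tile_out(3)[OF tcases]) (use less.hyps[of "Suc i" j] i ij in auto)
      also have "\<dots> \<longleftrightarrow> lv i j \<noteq> 0" using up[OF i(1) ij(2)] by simp
      finally show ?thesis .
    qed
    have l: "Left \<in> edges (B i j) \<longleftrightarrow> lh i (j - 1) \<noteq> 0"
    proof (cases "j = 1")
      case True
      then show ?thesis using bpd ij by (simp add: is_bpd_def lh_def)
    next
      case False
      then have j: "j - 1 \<in> {1..n}" "j - 1 \<in> {1..<n}" "Suc (j - 1) = j" using ij by auto
      have "Left \<in> edges (B i j) \<longleftrightarrow> Right \<in> edges (B i (j - 1))"
        using bpd j ij unfolding is_bpd_def by metis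
      also have "\<dots> \<longleftrightarrow> right_out (B i (j - 1)) (lh i (j - 1 - 1)) (lv i (j - 1)) \<noteq> 0"
        by (rule tile_out(2)[OF tcases]) (use less.hyps[of i "j - 1"] j ij in auto)
      also have "\<dots> \<longleftrightarrow> lh i (j - 1) \<noteq> 0" using rt[OF j(1)] by simp
      finally show ?thesis .
    qed
    show ?case using b l by blast
  qed
  have cel: "cell (lh i (j - 1)) (lv i j) (lh i j) (lv (i - 1) j)"
    and til: "cell_tile (lh i (j - 1)) (lv i j) (lh i j) (lv (i - 1) j) = B i j"
    if ij: "i \<in> {1..n}" "j \<in> {1..n}" for i j
    unfolding up[OF ij] rt[OF ij(2), of i]
    using tile_out(1,4)[OF tcases conjunct2[OF lab[OF ij]] conjunct1[OF lab[OF ij]]] by this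
  have wim: "w ` {1..n} = {1..n}" using permutes_image[OF w] .
  have tab: "tableau n n {1..n} lv lh"
  proof
    show "cell (lh i (j - 1)) (lv i j) (lh i j) (lv (i - 1) j)" if "1 \<le> i" "i \<le> n" "1 \<le> j" "j \<le> n" for i j
      using cel[of i j] that by simp
    show "lh i 0 = 0" for i by (simp add: lh_def)
    show "lv 0 j = 0" for j
    proof (cases "j \<in> {1..n}")
      case True
      then have "Top \<notin> edges (B 1 j)" using bpd by (simp add: is_bpd_def)
      moreover have "1 \<in> {1..n}" using True by auto
      ultimately show ?thesis
        using tile_out(3)[OF tcases conjunct2[OF lab[of 1 j]] conjunct1[OF lab[of 1 j]]] up[of 1 j] True
        by simp
    next
      case False then show ?thesis by (cases n) (auto simp: lv_def)
    qed
    show "lv i j = 0" if "i \<le> n" "j = 0 \<or> n < j" for i j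
      using that by (cases "n - i") (auto simp: lv_def)
    show "lv n j = (if j \<in> {1..n} then j else 0)" for j by (simp add: lv_def)
  qed
  interpret full n lv lh using tab by (simp add: full_def)
  have BB: "B = tiling_of n lv lh"
  proof (intro ext)
    fix i j show "B i j = tiling_of n lv lh i j"
    proof (cases "i \<in> {1..n} \<and> j \<in> {1..n}")
      case True then show ?thesis using til[of i j] unfolding tiling_of_def by presburger
    next
      case False
      then have "B i j = Blank" using bpd unfolding is_bpd_def by blast
      then show ?thesis using False unfolding tiling_of_def by presburger
    qed
  qed
  obtain T where T: "resolves n B T" "\<forall>i\<in>{1..n}. exits_at_row n T Bottom (w i) i"
    using B by (auto simp: BPD_def has_permutation_def)
  have wr: "w i \<in> {1..n}" if "i \<in> {1..n}" for i using wim that by blast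
  have ex: "lh i n = w i" if "i \<in> {1..n}" for i
  proof -
    have "w i \<noteq> 0" using wr[OF that] by auto
    moreover have "exits_at_row n T Bottom (w i) i" using T(2) that by blast
    ultimately show ?thesis
      using exits_at_row_iff[OF T(1)[unfolded BB] that] by blast
  qed
  have "labelling n n w lv lh"
    unfolding labelling_def labelling_axioms_def wim
    by (intro conjI allI impI tab permutes_inj_on[OF w] order_refl) (use ex in simp)
  then show ?thesis using BB by blast
qed

section \<open>Labels and the rows where they exit\<close>

locale square = labelling n n w lv lh for n w lv lh
begin

lemma image_w: "w ` {1..n} = {1..n}"
  using inj range by (simp add: card_image card_subset_eq)

definition row_of :: "nat \<Rightarrow> nat" where "row_of x = inv_into {1..n} w x"

lemma row_of_in: "x \<in> {1..n} \<Longrightarrow> row_of x \<in> {1..n}"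
  unfolding row_of_def by (rule inv_into_into) (simp only: image_w)

lemma w_row_of: "x \<in> {1..n} \<Longrightarrow> w (row_of x) = x"
  unfolding row_of_def by (rule f_inv_into_f) (simp only: image_w)

lemma row_of_w: "i \<in> {1..n} \<Longrightarrow> row_of (w i) = i"
  unfolding row_of_def by (rule inv_into_f_f[OF inj])

lemma w_label: "i \<in> {1..n} \<Longrightarrow> w i \<in> {1..n}"
  using image_w by blast

lemma row_of_inj: "\<lbrakk>row_of x = row_of y; x \<in> {1..n}; y \<in> {1..n}\<rbrakk> \<Longrightarrow> x = y"
  using w_row_of by metis

lemma at_pos:
  assumes "x \<in> {1..n}" "row_of x \<le> i" "i \<le> n"
  shows "lv i (pos i x) = x"
  using pos_label[OF assms(3), of "row_of x"] row_of_in[OF assms(1)] assms(2) w_row_of[OF assms(1)] by simp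

lemma label_at:
  assumes "lv i b = x" "x \<noteq> 0" "i \<le> n"
  shows "x \<in> {1..n}" "row_of x \<le> i" "pos i x = b" "x \<le> b" "b \<in> {1..n}"
proof -
  obtain k where k: "1 \<le> k" "k \<le> i" "x = w k" using label_row[of i b] assms by auto
  then have kn: "k \<in> {1..n}" using assms by simp
  show "x \<in> {1..n}" using w_label[OF kn] k(3) by simp
  show "row_of x \<le> i" using row_of_w[OF kn] k by simp
  show "pos i x = b" by (rule pos_eq) (use assms in auto)
  show "x \<le> b" by (rule line_label_le[OF assms(3,1,2)])
  show "b \<in> {1..n}" using in_columns[of i b] assms by auto
qed

lemma pos_ge:
  assumes "x \<in> {1..n}" "row_of x \<le> i" "i \<le> n"
  shows "x \<le> pos i x" "pos i x \<in> {1..n}"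
  using label_at(4,5)[OF at_pos[OF assms] _ assms(3)] assms(1) by auto

lemma pos_step:
  assumes "x \<in> {1..n}" "row_of x \<le> i" "Suc i \<le> n"
  shows "pos (Suc i) x \<le> pos i x"
proof -
  have x0: "x \<noteq> 0" "lv (Suc i - 1) (pos i x) = x" using at_pos[of x i] assms by auto
  from up_back[OF _ assms(3) x0(2,1)] obtain p where p: "p \<le> pos i x" "lv (Suc i) p = x" by auto
  then show ?thesis using pos_eq[OF assms(3) p(2) x0(1)] by simp
qed

lemma pos_mono:
  assumes "x \<in> {1..n}" "row_of x \<le> i" "i \<le> i'" "i' \<le> n"
  shows "pos i' x \<le> pos i x"
  using assms(3,4)
proof (induction i' rule: dec_induct)
  case (step i')
  then show ?case using pos_step[of x i'] assms(1,2) by auto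
qed simp

lemma noncrossing:
  assumes "x \<in> {1..n}" "z \<in> {1..n}" "x < z" "row_of x < row_of z" "row_of z \<le> i" "i \<le> n"
  shows "pos i x < pos i z"
  using pos_less[OF assms(6) _ assms(4,5)] w_row_of[OF assms(1)] w_row_of[OF assms(2)] assms(3) row_of_in[OF assms(1)]
  by simp

lemma exit_carried:
  assumes i: "i \<in> {1..n}"
  shows "lv i (pos i (w i)) = w i" "\<And>k. \<lbrakk>pos i (w i) \<le> k; k \<le> n\<rbrakk> \<Longrightarrow> lh i k = w i"
proof -
  have i': "1 \<le> i" "i \<le> n" and w0: "w i \<noteq> 0" using i w_label[OF i] by auto
  obtain p where p: "lv i p = w i" "\<forall>k. p \<le> k \<and> k \<le> n \<longrightarrow> lh i k = w i"
    using carry_back[OF i' exits[OF i'] w0 order_refl] by blast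
  have "pos i (w i) = p" by (rule pos_eq[OF i'(2) p(1) w0])
  then show "lv i (pos i (w i)) = w i" "\<And>k. \<lbrakk>pos i (w i) \<le> k; k \<le> n\<rbrakk> \<Longrightarrow> lh i k = w i"
    using p by auto
qed

lemma exit_right_of_gap:
  assumes "i \<in> {1..n}" "lh i j = 0" "j \<le> n"
  shows "j < pos i (w i)"
  using exit_carried(2)[OF assms(1), of j] assms w_label[OF assms(1)] by (cases "j < pos i (w i)") auto

text \<open>From its position on the line to the right end, the exiting label is carried through every cell, and
in a cell only the smaller label is carried on.\<close>

lemma exit_least:
  assumes i: "i \<in> {1..n}" and "pos i (w i) < j" "j \<le> n" "lv i j \<noteq> 0"
  shows "w i < lv i j"
proof -
  have lh: "lh i (j - 1) = w i" "lh i j = w i" using exit_carried(2)[OF i] assms by auto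
  have w0: "w i \<noteq> 0" using w_label[OF i] by auto
  have ij: "1 \<le> i" "i \<le> n" "1 \<le> j" using assms by auto
  have "lh i (j - 1) \<noteq> 0" using lh w0 by simp
  then have "lh i j = min (lh i (j - 1)) (lv i j)"
    using cell_cross[OF cells[OF ij assms(3)] _ assms(4)] by blast
  then have "lh i j \<le> lv i j" by simp
  then have "w i \<le> lv i j" unfolding lh .
  moreover have "w i \<noteq> lv i j"
  proof
    assume "w i = lv i j"
    then have "pos i (w i) = j" by (intro pos_eq) (use assms w0 in auto)
    then show False using assms by simp
  qed
  ultimately show ?thesis by simp
qed

lemma carry_decreasing:
  assumes "1 \<le> i" "i \<le> n" "j \<le> j'" "j' \<le> n" "\<And>k. \<lbrakk>j \<le> k; k \<le> j'\<rbrakk> \<Longrightarrow> lh i k \<noteq> 0"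
  shows "lh i j' \<le> lh i j"
  using assms(3-5)
proof (induction j' rule: dec_induct)
  case (step j')
  have "cell (lh i j') (lv i (Suc j')) (lh i (Suc j')) (lv (i - 1) (Suc j'))"
    using cells[of i "Suc j'"] assms step by auto
  then have "lh i (Suc j') \<le> lh i j'" using step.prems(2)[of j'] step.prems(2)[of "Suc j'"] step
    by (auto simp: cell_def split: if_splits)
  moreover have "lh i j' \<le> lh i j" using step by auto
  ultimately show ?case by simp
qed simp

section \<open>Clean columns and the counting identity\<close>

definition jay :: "nat \<Rightarrow> nat \<Rightarrow> bool" where
  "jay i j \<longleftrightarrow> i \<in> {1..n} \<and> j \<in> {1..n} \<and> lh i (j - 1) \<noteq> 0 \<and> lh i j = 0"

lemma jayD:
  assumes "jay i j"
  shows "lv i j = 0" "lv (i - 1) j = lh i (j - 1)"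
proof -
  have "cell (lh i (j - 1)) (lv i j) (lh i j) (lv (i - 1) j)"
    using cells[of i j] assms by (simp add: jay_def)
  then show "lv i j = 0" "lv (i - 1) j = lh i (j - 1)"
    using assms by (auto simp: jay_def cell_def split: if_splits)
qed

text \<open>This closes off the columns up to \<open>l\<close> for counting: all labels that count there also
stand there.\<close>

definition clean :: "nat \<Rightarrow> nat \<Rightarrow> bool" where
  "clean i l \<longleftrightarrow> (\<forall>x\<in>{1..n}. row_of x \<le> i \<longrightarrow> x \<le> l \<longrightarrow> pos i x \<le> l)"

text \<open>Beyond column \<open>l\<close>, a label that goes up was beyond column \<open>l\<close> on the line
below already, or it won over a label there, unless the cell is a jay. So without jays there the
labels only grow from line to line, and on the bottom line they exceed \<open>l\<close>.\<close>

lemma cleanI: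
  assumes nojay: "\<And>k j. \<lbrakk>i < k; l < j\<rbrakk> \<Longrightarrow> \<not> jay k j" and i: "i \<le> i'" "i' \<le> n"
  shows "clean i' l"
proof -
  have "l < x" if "lv i' p = x" "x \<noteq> 0" "l < p" for p x
    using i that
  proof (induction "n - i'" arbitrary: i' p x)
    case 0
    then have "i' = n" by simp
    then show ?case using 0 bottom[of p] by (auto split: if_splits)
  next
    case (Suc d)
    have i': "1 \<le> Suc i'" "Suc i' \<le> n" using Suc.hyps(2) by auto
    have IH: "l < z" if "lv (Suc i') b = z" "z \<noteq> 0" "l < b" for b z
      by (rule Suc.hyps(1)[OF _ _ i'(2) that]) (use Suc.hyps(2) Suc.prems(1) in auto)
    have up: "lv (Suc i' - 1) p = x" using Suc.prems(3) by simp
    obtain a where a: "1 \<le> a" "a \<le> p" "lv (Suc i') a = x" "\<forall>k. a \<le> k \<and> k < p \<longrightarrow> lh (Suc i') k = x"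
      using up_back[OF i' up Suc.prems(4)] by blast
    show ?case
    proof (cases "l < a")
      case True then show ?thesis using IH[OF a(3) Suc.prems(4)] by simp
    next
      case False
      then have ap: "a \<le> p - 1" "p - 1 < p" using Suc.prems(5) a by auto
      have left: "lh (Suc i') (p - 1) = x" using a(4) ap by blast
      have pn: "1 \<le> p" "p \<le> n" using in_columns[of i' p] Suc.prems by auto
      have c: "cell (lh (Suc i') (p - 1)) (lv (Suc i') p) (lh (Suc i') p) (lv (Suc i' - 1) p)"
        by (rule cells[OF i' pn])
      have "lh (Suc i') p \<noteq> 0"
        using nojay[of "Suc i'" p] Suc.prems i' pn left by (auto simp: jay_def)
      then have b: "lv (Suc i') p \<noteq> 0"
        using c up left Suc.prems(4) by (auto simp: cell_def split: if_splits)
      have "lh (Suc i') (p - 1) \<noteq> 0" using left Suc.prems(4) by simp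
      then have "lv (Suc i' - 1) p = max (lh (Suc i') (p - 1)) (lv (Suc i') p)"
        using cell_cross[OF c _ b] by blast
      then have "lv (Suc i') p \<le> x" unfolding up by simp
      moreover have "l < lv (Suc i') p" by (rule IH[OF refl b Suc.prems(5)])
      ultimately show ?thesis by simp
    qed
  qed
  then show ?thesis unfolding clean_def using at_pos[OF _ _ i(2)] by (metis atLeastAtMost_iff not_le not_one_le_zero)
qed

text \<open>Labels that exit below line \<open>i\<close>, labels up to \<open>j\<close> that stand beyond column
\<open>j\<close>, and columns without a label: the three sets that \<open>count\<close> compares.\<close>

definition late :: "nat \<Rightarrow> nat \<Rightarrow> nat \<Rightarrow> nat set" where
  "late i j l = {x \<in> {j<..l}. i < row_of x}"
definition intruders :: "nat \<Rightarrow> nat \<Rightarrow> nat set" where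
  "intruders i j = {x \<in> {1..j}. row_of x \<le> i \<and> j < pos i x}"
definition holes :: "nat \<Rightarrow> nat \<Rightarrow> nat \<Rightarrow> nat set" where
  "holes i j l = {b \<in> {j<..l}. lv i b = 0}"

lemma finite_late: "finite (late i j l)" and finite_intruders: "finite (intruders i j)"
  and finite_holes: "finite (holes i j l)"
  by (simp_all add: late_def intruders_def holes_def)

text \<open>On a clean line the occupied columns in \<open>{j<..l}\<close> carry the labels of
\<open>{j<..l}\<close> that are on the line and the intruders. Taking complements in
\<open>{j<..l}\<close>, once of columns and once of labels, gives the identity.\<close>

lemma count:
  assumes "clean i l" "i \<le> n" "j \<le> l" "l \<le> n"
  shows "card (late i j l) = card (intruders i j) + card (holes i j l)"
proof -
  define O' where "O' = {b \<in> {j<..l}. lv i b \<noteq> 0}"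
  define A where "A = {x \<in> {j<..l}. row_of x \<le> i}"
  have lab: "x \<in> {1..n}" if "x \<in> {j<..l}" for x using that assms by auto
  have im: "lv i ` O' = A \<union> intruders i j"
  proof (intro set_eqI iffI)
    fix x assume "x \<in> lv i ` O'"
    then obtain b where b: "lv i b = x" "x \<noteq> 0" "j < b" "b \<le> l" unfolding O'_def by auto
    note la = label_at[OF b(1,2) assms(2)]
    show "x \<in> A \<union> intruders i j"
      using la b unfolding A_def intruders_def by (cases "x \<le> j") auto
  next
    fix x assume x: "x \<in> A \<union> intruders i j"
    then have xn: "x \<in> {1..n}" "row_of x \<le> i" "x \<le> l" "j < pos i x"
      using lab pos_ge(1)[of x i] assms unfolding A_def intruders_def by fastforce+
    have "pos i x \<le> l" using assms(1) xn unfolding clean_def by blast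
    moreover have "lv i (pos i x) = x" by (rule at_pos[OF xn(1,2) assms(2)])
    ultimately show "x \<in> lv i ` O'" unfolding O'_def
      using xn by (intro image_eqI[of _ _ "pos i x"]) auto
  qed
  have "inj_on (lv i) O'"
    by (rule inj_onI) (use line_inj[OF assms(2) _ refl] in \<open>auto simp: O'_def\<close>)
  then have "card O' = card (A \<union> intruders i j)" using im card_image by metis
  moreover have "A \<inter> intruders i j = {}" by (auto simp: A_def intruders_def)
  ultimately have O: "card O' = card A + card (intruders i j)"
    by (simp add: card_Un_disjoint finite_intruders A_def)
  have "O' \<union> holes i j l = {j<..l}" "O' \<inter> holes i j l = {}" by (auto simp: O'_def holes_def)
  then have 1: "card O' + card (holes i j l) = card {j<..l}"
    by (metis card_Un_disjoint finite_Un finite_greaterThanAtMost)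
  have "A \<union> late i j l = {j<..l}" "A \<inter> late i j l = {}" by (auto simp: A_def late_def)
  then have 2: "card A + card (late i j l) = card {j<..l}"
    by (metis card_Un_disjoint finite_Un finite_greaterThanAtMost)
  show ?thesis using O 1 2 by simp
qed

text \<open>This form is used to refute configurations: known holes and intruders against a bound on the late
labels.\<close>

lemma count_le:
  assumes "clean i l" "i \<le> n" "j \<le> l" "l \<le> n" "H \<subseteq> holes i j l" "E \<subseteq> intruders i j" "late i j l \<subseteq> W" "finite W"
  shows "card H + card E \<le> card W"
  using count[OF assms(1-4)] card_mono[OF finite_holes assms(5)] card_mono[OF finite_intruders assms(6)]
    card_mono[OF assms(8,7)] by linarith

section \<open>Barriers\<close>

text \<open>Behind the last unused edge of row \<open>i\<close> the row carries decreasing labels that end with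
\<open>w i\<close>. The cell right after this edge starts the run, so no label leaves it upwards;
every label that goes up further right has been larger than one that is carried on, hence larger
than \<open>w i\<close>.\<close>

lemma last_turn:
  assumes i: "i \<in> {1..n}"
  shows "\<exists>g \<le> pos i (w i). 1 \<le> g \<and> lv (i - 1) g = 0 \<and> (\<forall>b\<ge>g. lv (i - 1) b \<noteq> 0 \<longrightarrow> w i < lv (i - 1) b)"
proof -
  have i': "1 \<le> i" "i \<le> n" and w0: "w i \<noteq> 0" using i w_label[OF i] by auto
  define J where "J = {j \<in> {0..n}. lh i j = 0}"
  have J: "finite J" "0 \<in> J" using left_empty[OF i'] by (auto simp: J_def)
  \<comment> \<open>column \<open>0\<close> is in \<open>J\<close>, so the maximum exists\<close>
  define j where "j = Max J"
  have jJ: "j \<in> J" unfolding j_def using J by (intro Max_in) auto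
  then have j: "j \<le> n" "lh i j = 0" by (auto simp: J_def)
  have after: "lh i k \<noteq> 0" if "j < k" "k \<le> n" for k
    using Max_ge[OF J(1), of k] that unfolding j_def[symmetric] by (auto simp: J_def)
  have jp: "j < pos i (w i)" by (rule exit_right_of_gap[OF i j(2,1)])
  have pn: "pos i (w i) \<le> n" using label_at(5)[OF exit_carried(1)[OF i] w0 i'(2)] by simp
  have c: "cell (lh i (b - 1)) (lv i b) (lh i b) (lv (i - 1) b)" if "1 \<le> b" "b \<le> n" for b
    using cells[OF i'] that by simp
  have small: "w i \<le> lh i b" if "j < b" "b \<le> n" for b
  proof -
    have "lh i n \<le> lh i b" by (rule carry_decreasing[OF i' that(2) order_refl]) (use after that in auto)
    then show ?thesis using exits[OF i'] by simp
  qed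
  have g: "lv (i - 1) (Suc j) = 0"
    using c[of "Suc j"] j after[of "Suc j"] jp pn by (auto simp: cell_def split: if_splits)
  have "w i < lv (i - 1) b" if b: "Suc j \<le> b" "lv (i - 1) b \<noteq> 0" for b
  proof -
    have bn: "1 \<le> b" "b \<le> n" using in_columns[of "i - 1" b] b i' by auto
    have "lh i b \<le> lv (i - 1) b" using c[OF bn] after[of b] b bn by (auto simp: cell_def split: if_splits)
    then have "w i \<le> lv (i - 1) b" using small[of b] b bn by simp
    moreover have "w i \<noteq> lv (i - 1) b"
    proof
      assume e: "w i = lv (i - 1) b"
      have "i - 1 \<le> n" using i' by simp
      then obtain k where k: "1 \<le> k" "k \<le> i - 1" "lv (i - 1) b = w k" using label_row[OF _ b(2)] by blast
      have "w i = w k" using e k(3) by (rule trans)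
      then have "i = k" by (rule exit_inj) (use k(1,2) i' in auto)
      then show False using k i' by simp
    qed
    ultimately show ?thesis by simp
  qed
  then show ?thesis using g jp by (intro exI[of _ "Suc j"]) auto
qed

definition turn :: "nat \<Rightarrow> nat" where
  "turn i = (SOME g. g \<le> pos i (w i) \<and> 1 \<le> g \<and> lv (i - 1) g = 0 \<and>
     (\<forall>b\<ge>g. lv (i - 1) b \<noteq> 0 \<longrightarrow> w i < lv (i - 1) b))"

lemma turn:
  assumes "i \<in> {1..n}"
  shows "turn i \<le> pos i (w i)" "1 \<le> turn i" "lv (i - 1) (turn i) = 0"
    "\<And>b. \<lbrakk>turn i \<le> b; lv (i - 1) b \<noteq> 0\<rbrakk> \<Longrightarrow> w i < lv (i - 1) b"
  using someI_ex[OF last_turn[OF assms]] unfolding turn_def[symmetric] by blast+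

text \<open>From column \<open>turn i1\<close> on, line \<open>i1 - 1\<close> carries only labels above \<open>w
i1\<close>. Exits of the rows above that are smaller than \<open>w i1\<close> therefore start to the
left of \<open>turn i1\<close> and run through all these columns as the smaller label, which changes
nothing there.\<close>

lemma barrier:
  assumes i1: "i1 \<in> {1..n}" and "i < i1" and "\<And>i'. \<lbrakk>i < i'; i' < i1\<rbrakk> \<Longrightarrow> w i' < w i1"
  shows "\<forall>b\<ge>turn i1. lv i b = lv (i1 - 1) b"
  using assms(2,3)
proof (induction "i1 - 1 - i" arbitrary: i)
  case 0
  then have "i = i1 - 1" by simp
  then show ?case by simp
next
  case (Suc d)
  have i: "Suc i \<in> {1..n}" "Suc i < i1" using Suc.hyps(2) i1 by auto
  have IH: "\<forall>b\<ge>turn i1. lv (Suc i) b = lv (i1 - 1) b"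
    by (rule Suc.hyps(1)) (use Suc.hyps(2) Suc.prems i in auto)
  have lt: "w (Suc i) < w i1" using Suc.prems i by simp
  have w0: "w (Suc i) \<noteq> 0" using w_label[OF i(1)] by simp
  have out: "pos (Suc i) (w (Suc i)) < turn i1"
  proof (rule ccontr)
    assume "\<not> ?thesis"
    then have ge: "turn i1 \<le> pos (Suc i) (w (Suc i))" by simp
    then have "lv (i1 - 1) (pos (Suc i) (w (Suc i))) = w (Suc i)" using IH exit_carried(1)[OF i(1)] by simp
    then show False using turn(4)[OF i1 ge] w0 lt by simp
  qed
  show ?case
  proof (intro allI impI)
    fix b assume b: "turn i1 \<le> b"
    have e: "lv (Suc i) b = lv (i1 - 1) b" using IH b by simp
    show "lv i b = lv (i1 - 1) b"
    proof (cases "b \<le> n")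
      case False then show ?thesis using outside[of i b] outside[of "i1 - 1" b] i i1 by auto
    next
      case True
      have lh: "lh (Suc i) (b - 1) = w (Suc i)" "lh (Suc i) b = w (Suc i)"
        using exit_carried(2)[OF i(1)] out b True by auto
      have c: "cell (w (Suc i)) (lv (Suc i) b) (w (Suc i)) (lv i b)"
        using cells[of "Suc i" b] lh i True turn(2)[OF i1] b by simp
      show ?thesis
      proof (cases "lv (i1 - 1) b = 0")
        case True then show ?thesis using c e w0 by (auto simp: cell_def split: if_splits)
      next
        case False
        then have "w (Suc i) < lv (Suc i) b" using turn(4)[OF i1 b] lt e by simp
        then show ?thesis using cell_cross[OF c w0] e by simp
      qed
    qed
  qed
qed

lemma barrier_exit:
  assumes i1: "i1 \<in> {1..n}" and i: "i \<in> {1..n}" "i < i1" and "\<And>i'. \<lbrakk>i \<le> i'; i' < i1\<rbrakk> \<Longrightarrow> w i' < w i1"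
  shows "pos i (w i) < turn i1"
proof (rule ccontr)
  assume "\<not> ?thesis"
  then have ge: "turn i1 \<le> pos i (w i)" by simp
  have "\<forall>b\<ge>turn i1. lv i b = lv (i1 - 1) b" by (rule barrier[OF i1 i(2)]) (use assms in auto)
  then have "lv (i1 - 1) (pos i (w i)) = w i" using ge exit_carried(1)[OF i(1)] by simp
  moreover have "w i \<noteq> 0" using w_label[OF i(1)] by simp
  ultimately show False using turn(4)[OF i1 ge] assms(4)[of i] i by simp
qed

end

section \<open>Double crossings of co-pipes and the rightmost jay\<close>

text \<open>In \<open>av2156x\<close> the third and the fourth value may come in either order, so it stands for
both 215643 and 216543.\<close>

locale avoiding = square +
  assumes av1423: "\<And>a b c d. \<lbrakk>1 \<le> a; a < b; b < c; c < d; d \<le> n; w a < w c; w c < w d; w d < w b\<rbrakk> \<Longrightarrow> False"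
    and av12543: "\<And>a b c d e. \<lbrakk>1 \<le> a; a < b; b < c; c < d; d < e; e \<le> n;
      w a < w b; w b < w e; w e < w d; w d < w c\<rbrakk> \<Longrightarrow> False"
    and av13254: "\<And>a b c d e. \<lbrakk>1 \<le> a; a < b; b < c; c < d; d < e; e \<le> n;
      w a < w c; w c < w b; w b < w e; w e < w d\<rbrakk> \<Longrightarrow> False"
    and av25143: "\<And>a b c d e. \<lbrakk>1 \<le> a; a < b; b < c; c < d; d < e; e \<le> n;
      w c < w a; w a < w e; w e < w d; w d < w b\<rbrakk> \<Longrightarrow> False"
    and av2156x: "\<And>a b c d e f. \<lbrakk>1 \<le> a; a < b; b < c; c < d; d < e; e < f; f \<le> n;
      w b < w a; w a < w f; w f < w e; w e < w c; w e < w d\<rbrakk> \<Longrightarrow> False"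
    and av241653: "\<And>a b c d e f. \<lbrakk>1 \<le> a; a < b; b < c; c < d; d < e; e < f; f \<le> n;
      w c < w a; w a < w f; w f < w b; w b < w e; w e < w d\<rbrakk> \<Longrightarrow> False"

text \<open>What two co-pipes that cross twice leave behind. The upper one turns down at the jay \<open>(r,
c)\<close> and follows column \<open>c\<close>; \<open>y\<close> is the first row below
\<open>r\<close> where a label passes column \<open>c\<close>; the lower one has gone through the
empty column \<open>q\<close> on line \<open>r\<close>; and \<open>w a\<close> is a small label that
exits above.\<close>

locale certificate = avoiding +
  fixes a r y q c :: nat
  assumes rows: "1 \<le> a" "a < r" "r < y" "y \<le> n"
    and cols: "w a < q" "q < c" "c \<le> n"
    and q_hole: "lv r q = 0"
    and jay_c: "lh r c = 0" "lh r (c - 1) \<noteq> 0"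
    and c_hole: "\<And>i. \<lbrakk>r \<le> i; i \<le> y\<rbrakk> \<Longrightarrow> lv i c = 0"
    and pass: "lh y c \<noteq> 0"
    and no_pass: "\<And>i. \<lbrakk>r < i; i < y\<rbrakk> \<Longrightarrow> lh i c = 0"
begin

lemma row_in: "a \<in> {1..n}" "r \<in> {1..n}" "y \<in> {1..n}"
  using rows by auto

lemma c_in: "c \<in> {1..n}" using cols by auto

lemma wr_right: "c < pos r (w r)"
  by (rule exit_right_of_gap[OF row_in(2) jay_c(1) cols(3)])

text \<open>The label that passes column \<open>c\<close>; it is the first of two labels below \<open>c\<close>
that the contradictions use.\<close>

definition x0 where "x0 = lh y c"

lemma x0: "x0 \<noteq> 0" "x0 < c" "lv y (pos y x0) = x0" "pos y x0 < c" "x0 \<in> {1..n}" "row_of x0 \<le> y"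
proof -
  show n0: "x0 \<noteq> 0" using pass by (simp add: x0_def)
  have y': "1 \<le> y" "y \<le> n" using row_in by auto
  obtain p where p: "p \<le> c" "lv y p = x0" using carry_back[OF y' x0_def[symmetric] n0 cols(3)] by blast
  have "p \<noteq> c" using p c_hole[of y] rows n0 by auto
  note la = label_at[OF p(2) n0 y'(2)]
  show "lv y (pos y x0) = x0" "pos y x0 < c" "x0 \<in> {1..n}" "row_of x0 \<le> y" using la p \<open>p \<noteq> c\<close> by auto
  show "x0 < c" using la p \<open>p \<noteq> c\<close> by simp
qed

lemma x0_lands:
  assumes "row_of x0 < y"
  shows "c < pos (y - 1) x0"
proof -
  have y': "1 \<le> y" "y \<le> n" using row_in by auto
  have "w y \<noteq> x0" using assms row_of_w[OF row_in(3)] by auto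
  then have "lh y n \<noteq> x0" using exits[OF y'] by simp
  then obtain p where p: "c < p" "lv (y - 1) p = x0"
    using carry_forward[OF y' x0_def[symmetric] x0(1) cols(3)] cols(3) by blast
  have "pos (y - 1) x0 = p" by (rule pos_eq) (use p x0(1) y' in auto)
  then show ?thesis using p by simp
qed

text \<open>The label that the jay \<open>(r, c)\<close> sends up.\<close>

definition s0 where "s0 = lh r (c - 1)"

lemma s0: "s0 \<in> {1..n}" "row_of s0 \<le> r" "pos r s0 < c" "s0 < c"
proof -
  have n0: "s0 \<noteq> 0" using jay_c by (simp add: s0_def)
  have r': "1 \<le> r" "r \<le> n" using row_in by auto
  have c': "c - 1 \<le> n" using cols by simp
  obtain p where p: "p \<le> c - 1" "lv r p = s0" using carry_back[OF r' s0_def[symmetric] n0 c'] by blast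
  note la = label_at[OF p(2) n0 r'(2)]
  have "c - 1 < c" using cols by simp
  then show "s0 \<in> {1..n}" "row_of s0 \<le> r" "pos r s0 < c" "s0 < c" using la p by auto
qed

lemma exit_pass:
  assumes "\<And>j. \<lbrakk>c < j; j \<le> n\<rbrakk> \<Longrightarrow> lh y j \<noteq> 0"
  shows "w y \<le> x0"
proof -
  have y': "1 \<le> y" "y \<le> n" using row_in by auto
  have "lh y n \<le> lh y c"
    by (rule carry_decreasing[OF y' cols(3) order_refl]) (use assms pass in \<open>auto simp: le_less\<close>)
  then show ?thesis using exits[OF y'] by (simp add: x0_def)
qed

text \<open>Columns beyond \<open>c\<close> are then clean, so \<open>c < w r\<close>, and row \<open>y\<close>
exits with a label below \<open>c\<close>, while \<open>c\<close> itself exits below row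
\<open>y\<close>. If \<open>w a < w y\<close>, this is 1423. Otherwise the holes \<open>q\<close>
and \<open>c\<close> force a second late label \<open>z\<close> between \<open>w a\<close> and
\<open>c\<close>, and \<open>c\<close> and \<open>z\<close> complete 1423 or 25143, depending on
their order.\<close>

lemma not_all_jays_left:
  assumes nojay: "\<And>i j. \<lbrakk>r < i; c < j\<rbrakk> \<Longrightarrow> \<not> jay i j"
  shows False
proof -
  have y': "1 \<le> y" "y \<le> n" and r': "r \<le> n" using row_in by auto
  have clr: "clean r c" by (rule cleanI[OF nojay order_refl r'])
  have cly: "clean y c" by (rule cleanI[OF nojay _ y'(2)]) (use rows in auto)
  have rho: "c < w r"
    using clr wr_right row_of_w[OF row_in(2)] w_label[OF row_in(2)] unfolding clean_def by (metis not_le order_refl)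
  have "lh y j \<noteq> 0" if "c \<le> j" "j \<le> n" for j
    using that
  proof (induction j rule: dec_induct)
    case base show ?case by (rule pass)
  next
    case (step j)
    then show ?case using nojay[of y "Suc j"] row_in rows unfolding jay_def by auto
  qed
  then have wy: "w y < c" using exit_pass x0(2) by fastforce
  have rwc: "y < row_of c"
  proof (rule ccontr)
    assume "\<not> y < row_of c"
    then have h: "row_of c \<le> y" by simp
    have "pos y c \<le> c" using cly c_in h unfolding clean_def by blast
    moreover have "c \<le> pos y c" by (rule pos_ge[OF c_in h y'(2)])
    ultimately have "lv y c = c" using at_pos[OF c_in h y'(2)] by simp
    then show False using c_hole[of y] rows c_in by simp
  qed
  have rwcn: "row_of c \<in> {1..n}" "w (row_of c) = c" using row_of_in[OF c_in] w_row_of[OF c_in] by auto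
  have yr: "row_of (w y) = y" by (rule row_of_w[OF row_in(3)])
  show False
  proof (cases "w a < w y")
    case True
    show False by (rule av1423[of a r y "row_of c"]) (use rows rwc rwcn True wy rho in auto)
  next
    case False
    have "w y \<noteq> w a" using row_of_w[OF row_in(1)] yr rows by auto
    then have wya: "w y < w a" using False by simp
    \<comment> \<open>two holes on line \<open>r\<close>, hence two late labels, and only one of
      them can be \<open>c\<close>\<close>
    have "card {q, c} + card ({} :: nat set) \<le> card (late r (w a) c)"
      by (rule count_le[OF clr r' _ cols(3) _ _ subset_refl finite_late])
        (use cols q_hole c_hole[of r] rows in \<open>auto simp: holes_def\<close>)
    then have c2: "2 \<le> card (late r (w a) c)" using cols by simp
    have "\<not> late r (w a) c \<subseteq> {c}" using card_mono[of "{c}" "late r (w a) c"] c2 by auto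
    then obtain z where z: "w a < z" "z < c" "r < row_of z" unfolding late_def by fastforce
    have zn: "z \<in> {1..n}" using z cols by auto
    have rz: "row_of z \<in> {1..n}" "w (row_of z) = z" using row_of_in[OF zn] w_row_of[OF zn] by auto
    have "row_of z \<noteq> row_of c" using row_of_inj[OF _ zn c_in] z by auto
    then consider "row_of z < row_of c" | "row_of c < row_of z" by linarith
    then show False
    proof cases
      case 1
      show False by (rule av1423[of a r "row_of z" "row_of c"]) (use rows z rz rwcn rho 1 in auto)
    next
      case 2
      show False by (rule av25143[of a r y "row_of c" "row_of z"]) (use rows z rz rwcn rho 2 rwc wya in auto)
    qed
  qed
qed

end

text \<open>The jay \<open>(k, l)\<close> lies in the rightmost column that has a jay below row
\<open>r\<close>, so from line \<open>r\<close> on columns beyond \<open>l\<close> are clean.\<close>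

locale big_jay = certificate +
  fixes k l :: nat
  assumes jay_kl: "jay k l" and kl: "r < k" "c < l"
    and rightmost: "\<And>i j. \<lbrakk>r < i; l < j\<rbrakk> \<Longrightarrow> \<not> jay i j"
begin

lemma kl_in: "k \<in> {1..n}" "l \<in> {1..n}" using jay_kl by (auto simp: jay_def)

lemma clean_l: "\<lbrakk>r \<le> i; i \<le> n\<rbrakk> \<Longrightarrow> clean i l"
  by (rule cleanI[OF rightmost])

lemma l_hole: "lv k l = 0" using jayD(1)[OF jay_kl] .

lemma wk: "l < w k"
proof -
  have "lh k l = 0" using jay_kl by (simp add: jay_def)
  then have "l < pos k (w k)" using exit_right_of_gap[OF kl_in(1)] kl_in(2) by simp
  then show ?thesis
    using clean_l[of k] kl kl_in(1) w_label[OF kl_in(1)] row_of_w[OF kl_in(1)] unfolding clean_def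
    by (metis atLeastAtMost_iff less_imp_le not_le order_refl)
qed

definition h where "h = row_of l"

lemma h: "k < h" "h \<in> {1..n}" "w h = l"
proof -
  show "h \<in> {1..n}" "w h = l" unfolding h_def using row_of_in w_row_of kl_in by auto
  show "k < h"
  proof (rule ccontr)
    assume "\<not> k < h"
    then have hk: "row_of l \<le> k" by (simp add: h_def)
    have kn: "k \<le> n" using kl_in by simp
    have "pos k l \<le> l" using clean_l[of k] kl kn kl_in hk unfolding clean_def by auto
    moreover have "l \<le> pos k l" by (rule pos_ge[OF kl_in(2) hk kn])
    ultimately have "lv k l = l" using at_pos[OF kl_in(2) hk kn] by simp
    then show False using l_hole kl_in by simp
  qed
qed

lemma wa_less_l: "w a < l" using cols kl by simp

lemma wr_ne: "w r \<noteq> l" "w r \<noteq> w a"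
  using h row_of_w[of r] row_of_w[of h] row_of_w[of a] row_in rows kl by auto

text \<open>The labels between \<open>w a\<close> and \<open>l\<close> that are late on line \<open>r\<close>
exit either between the rows \<open>r\<close> and \<open>k\<close>, in the rows
\<open>middle\<close>, or after the label \<open>l\<close>; the latter form the set
\<open>tail\<close>. Nothing else is possible because of 1423 (\<open>late_cases\<close>).\<close>

definition tail where "tail = {x \<in> {w a<..<l}. h < row_of x}"
definition middle where "middle = {i. r < i \<and> i < k \<and> w a < w i \<and> w i < l}"

lemma finite_tail_middle: "finite tail" "finite middle"
  unfolding tail_def middle_def by auto

lemma tail_props:
  assumes "x \<in> tail"
  shows "x \<in> {1..n}" "row_of x \<in> {1..n}" "w (row_of x) = x" "h < row_of x" "w a < x" "x < l"
proof -
  show xn: "x \<in> {1..n}" using assms kl_in unfolding tail_def by auto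
  show "row_of x \<in> {1..n}" "w (row_of x) = x" using row_of_in[OF xn] w_row_of[OF xn] by auto
  show "h < row_of x" "w a < x" "x < l" using assms unfolding tail_def by auto
qed

lemma tail_decreasing:
  assumes "x \<in> tail" "x' \<in> tail" "row_of x < row_of x'" shows "x' < x"
proof (rule ccontr)
  assume "\<not> x' < x"
  moreover have "x \<noteq> x'" using assms by auto
  ultimately have "x < x'" by simp
  note d = tail_props[OF assms(1)] and d' = tail_props[OF assms(2)]
  show False by (rule av1423[of a k "row_of x" "row_of x'"]) (use rows kl d d' h wk \<open>x < x'\<close> assms(3) in auto)
qed

lemma tail_rows:
  assumes "x \<in> tail" "x' \<in> tail" "x' < x" shows "row_of x < row_of x'"
  using tail_decreasing[OF assms(2,1)] row_of_inj[OF _ tail_props(1)[OF assms(1)] tail_props(1)[OF assms(2)]] assms(3)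
  by (metis less_asym' linorder_neqE_nat less_irrefl)

lemma late_cases:
  assumes x: "w a < x" "x \<le> l" "k < row_of x" "x \<noteq> l" shows "x \<in> tail"
proof -
  have xn: "x \<in> {1..n}" using x kl_in by auto
  have rx: "row_of x \<in> {1..n}" "w (row_of x) = x" using row_of_in[OF xn] w_row_of[OF xn] by auto
  have "\<not> row_of x < h"
  proof
    assume "row_of x < h"
    show False by (rule av1423[of a k "row_of x" h]) (use rows kl x rx h wk \<open>row_of x < h\<close> in auto)
  qed
  moreover have "row_of x \<noteq> h" using rx h x by auto
  ultimately show ?thesis using x unfolding tail_def by auto
qed

lemma late_r: "late r (w a) l \<subseteq> w ` middle \<union> {l} \<union> tail"
proof
  fix x assume "x \<in> late r (w a) l"
  then have x: "w a < x" "x \<le> l" "r < row_of x" by (auto simp: late_def)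
  have xn: "x \<in> {1..n}" using x kl_in by auto
  have rx: "row_of x \<in> {1..n}" "w (row_of x) = x" using row_of_in[OF xn] w_row_of[OF xn] by auto
  have "row_of x \<noteq> k" using rx wk x by auto
  then consider "row_of x < k" | "k < row_of x" by linarith
  then show "x \<in> w ` middle \<union> {l} \<union> tail"
  proof cases
    case 1
    then have "x < l" using x h rx by (cases "x = l") (auto simp: h_def)
    then have "row_of x \<in> middle" using 1 x rx unfolding middle_def by auto
    then show ?thesis using rx by force
  next
    case 2 then show ?thesis using late_cases[OF x(1,2)] by auto
  qed
qed

text \<open>A larger exit above would give 1423 if it exceeds \<open>l\<close>, and 13254 with \<open>w
k\<close> and \<open>l\<close> otherwise.\<close>

lemma middle_dominates:
  assumes "i \<in> middle" "r \<le> i'" "i' < i" shows "w i' < w i"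
proof (rule ccontr)
  assume "\<not> w i' < w i"
  have i: "r < i" "i < k" "w a < w i" "w i < l" using assms(1) by (auto simp: middle_def)
  have in': "i \<in> {1..n}" "i' \<in> {1..n}" using i assms rows kl_in by auto
  have "w i' \<noteq> w i" using exit_inj[of i' i] in' assms(3) by auto
  then have gt: "w i < w i'" using \<open>\<not> w i' < w i\<close> by simp
  have "w i' \<noteq> l" using exit_inj[of i' h] in' h i assms by auto
  then consider "l < w i'" | "w i' < l" by linarith
  then show False
  proof cases
    case 1
    show False by (rule av1423[of a i' i h]) (use rows i assms h 1 in auto)
  next
    case 2
    show False by (rule av13254[of a i' i k h]) (use rows i assms h gt 2 wk in auto)
  qed
qed

definition gaps where "gaps = turn ` middle"

lemma middle_in: "i \<in> middle \<Longrightarrow> i \<in> {1..n} \<and> r < i \<and> i < k \<and> w a < w i \<and> w i < l"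
  using rows kl_in unfolding middle_def by auto

text \<open>Since each row of \<open>middle\<close> exits with a larger label than the rows above it, down from
\<open>r\<close>, the hole \<open>turn i\<close> on line \<open>i - 1\<close> is also one on line
\<open>r\<close>, and the exit of every earlier row stays to its left. So the holes are distinct.\<close>

lemma gaps_props: "card gaps = card middle" "\<And>g. g \<in> gaps \<Longrightarrow> pos r (w r) < g \<and> g \<le> l \<and> lv r g = 0"
proof -
  have inj: "turn i < turn i'" if "i \<in> middle" "i' \<in> middle" "i < i'" for i i'
  proof -
    have "pos i (w i) < turn i'"
      by (rule barrier_exit) (use that middle_in[of i] middle_in[of i'] middle_dominates[OF that(2)] in auto)
    then show ?thesis using turn(1)[of i] middle_in[OF that(1)] by simp
  qed
  have "inj_on turn middle"
  proof (rule inj_onI)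
    fix i i' assume "i \<in> middle" "i' \<in> middle" "turn i = turn i'"
    then show "i = i'" using inj[of i i'] inj[of i' i] by (cases i i' rule: linorder_cases) auto
  qed
  then show "card gaps = card middle" unfolding gaps_def by (rule card_image)
  fix g assume "g \<in> gaps"
  then obtain i where i: "i \<in> middle" "g = turn i" unfolding gaps_def by auto
  note ii = middle_in[OF i(1)]
  have "pos r (w r) < g" unfolding i(2)
    by (rule barrier_exit) (use ii row_in middle_dominates[OF i(1)] in auto)
  moreover have "lv r g = lv (i - 1) g"
    using barrier[of i r] ii middle_dominates[OF i(1)] unfolding i(2) by auto
  then have "lv r g = 0" using turn(3)[of i] ii i(2) by simp
  moreover have "pos i (w i) \<le> l"
    using clean_l[of i] ii w_label[of i] row_of_w[of i] unfolding clean_def by auto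
  then have "g \<le> l" using turn(1)[of i] ii i(2) by simp
  ultimately show "pos r (w r) < g \<and> g \<le> l \<and> lv r g = 0" by simp
qed

lemma finite_gaps: "finite gaps" unfolding gaps_def using finite_tail_middle by simp

lemma rows_le: "r \<le> n" "k \<le> n" "l \<le> n" using row_in kl_in by auto

lemma gaps_right: "g \<in> gaps \<Longrightarrow> c < g" using gaps_props(2) wr_right by fastforce

lemma card_gaps: "card (gaps \<union> {q, c}) = card middle + 2"
proof -
  have "gaps \<inter> {q, c} = {}" using gaps_right cols by fastforce
  then have "card (gaps \<union> {q, c}) = card gaps + card {q, c}" by (intro card_Un_disjoint) (use finite_gaps in auto)
  then show ?thesis using gaps_props(1) cols by simp
qed

lemma holes_alpha: "gaps \<union> {q, c} \<subseteq> holes r (w a) l"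
proof
  fix g assume "g \<in> gaps \<union> {q, c}"
  then consider "g \<in> gaps" | "g = q" | "g = c" by auto
  then show "g \<in> holes r (w a) l"
  proof cases
    case 1 then show ?thesis using gaps_props(2)[OF 1] gaps_right[OF 1] cols by (auto simp: holes_def)
  next
    case 2 then show ?thesis using q_hole cols kl by (auto simp: holes_def)
  next
    case 3 then show ?thesis using c_hole[of r] rows cols kl by (auto simp: holes_def)
  qed
qed

lemma card_late: "card (w ` middle \<union> {l} \<union> tail) \<le> card middle + 1 + card tail"
proof -
  have "card (w ` middle \<union> {l} \<union> tail) \<le> card (w ` middle \<union> {l}) + card tail" by (rule card_Un_le)
  also have "card (w ` middle \<union> {l}) \<le> card (w ` middle) + card {l}" by (rule card_Un_le)
  also have "card (w ` middle) \<le> card middle" by (rule card_image_le[OF finite_tail_middle(2)])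
  finally show ?thesis by simp
qed

text \<open>Otherwise \<open>w r\<close> is an intruder on line \<open>r\<close>, and the count asks for two
labels in \<open>tail\<close>, which together with \<open>w a\<close>, \<open>w r\<close>, \<open>w
k\<close> and \<open>l\<close> form 216543.\<close>

lemma wa_less_wr: "w a < w r"
proof (rule ccontr)
  assume "\<not> w a < w r"
  then have ra: "w r < w a" using wr_ne by simp
  have D1: "card tail \<le> 1"
  proof -
    have "x = x'" if "x \<in> tail" "x' \<in> tail" for x x'
    proof -
      have *: False if x: "x \<in> tail" and x': "x' \<in> tail" and lt: "row_of x < row_of x'" for x x'
        by (rule av2156x[of a r k h "row_of x" "row_of x'"])
          (use tail_props[OF x] tail_props[OF x'] tail_decreasing[OF x x' lt] lt rows kl h wk ra in auto)
      then show ?thesis using that row_of_inj[of x x'] tail_props(1) by (metis linorder_neqE_nat)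
    qed
    then show ?thesis by (simp add: card_le_Suc0_iff_eq finite_tail_middle)
  qed
  have "w r \<in> intruders r (w a)"
    using ra wr_right cols row_of_w[OF row_in(2)] w_label[OF row_in(2)] by (auto simp: intruders_def)
  then have "card (gaps \<union> {q, c}) + card {w r} \<le> card (w ` middle \<union> {l} \<union> tail)"
    by (intro count_le[OF clean_l[OF order_refl rows_le(1)] rows_le(1) _ rows_le(3) holes_alpha _ late_r])
      (use wa_less_l finite_tail_middle in auto)
  then show False using card_gaps card_late D1 by simp
qed

lemma tail_less_wr:
  assumes "x \<in> tail" shows "x < w r"
proof (cases "w r < l")
  case True
  have "x \<noteq> w r" using tail_props[OF assms] h kl row_of_w[OF row_in(2)] by auto
  moreover have "\<not> w r < x"
  proof
    assume "w r < x"
    show False by (rule av12543[of a r k h "row_of x"])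
      (use tail_props[OF assms] rows kl h wk wa_less_wr \<open>w r < x\<close> in auto)
  qed
  ultimately show ?thesis by simp
next
  case False then show ?thesis using tail_props(6)[OF assms] by simp
qed

text \<open>Otherwise \<open>w r\<close> has been pushed beyond its own column, and beyond \<open>w r\<close>
there are no labels of \<open>tail\<close> to account for that.\<close>

lemma c_le_wr: "c \<le> w r"
proof (rule ccontr)
  assume "\<not> c \<le> w r"
  then have lt: "w r < c" by simp
  have sub: "late r (w r) l \<subseteq> w ` middle \<union> {l}"
  proof
    fix x assume "x \<in> late r (w r) l"
    then have x: "w r < x" "x \<in> late r (w a) l" using wa_less_wr by (auto simp: late_def)
    then show "x \<in> w ` middle \<union> {l}" using late_r tail_less_wr[of x] by auto
  qed
  have "w r \<in> intruders r (w r)"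
    using lt wr_right row_of_w[OF row_in(2)] w_label[OF row_in(2)] by (auto simp: intruders_def)
  moreover have "gaps \<union> {c} \<subseteq> holes r (w r) l" using holes_alpha lt gaps_right by (fastforce simp: holes_def)
  ultimately have "card (gaps \<union> {c}) + card {w r} \<le> card (w ` middle \<union> {l})"
    by (intro count_le[OF clean_l[OF order_refl rows_le(1)] rows_le(1) _ rows_le(3) _ _ sub]) (use lt kl finite_tail_middle in auto)
  moreover have "card (gaps \<union> {c}) = card middle + 1"
    using gaps_right finite_gaps gaps_props(1) by (subst card_Un_disjoint) auto
  moreover have "card (w ` middle \<union> {l}) \<le> card middle + 1"
    using card_Un_le[of "w ` middle" "{l}"] card_image_le[OF finite_tail_middle(2), of w] by simp
  ultimately show False by simp
qed

lemma tail_ne: "tail \<noteq> {}"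
proof
  assume "tail = {}"
  have "card (gaps \<union> {q, c}) + card ({} :: nat set) \<le> card (w ` middle \<union> {l} \<union> tail)"
    by (intro count_le[OF clean_l[OF order_refl rows_le(1)] rows_le(1) _ rows_le(3) holes_alpha _ late_r])
      (use wa_less_l finite_tail_middle in auto)
  then show False using card_gaps card_late \<open>tail = {}\<close> by simp
qed

definition d1 where "d1 = Max tail"

lemma d1: "d1 \<in> tail" "\<And>x. x \<in> tail \<Longrightarrow> x \<le> d1"
  unfolding d1_def using Max_in[OF finite_tail_middle(1) tail_ne] Max_ge[OF finite_tail_middle(1)] by auto

text \<open>An exit below \<open>w a\<close> in these rows would give 241653 or 25143 together with
\<open>d1\<close>.\<close>

lemma middle_exits:
  assumes "r < i" "i < k"
  shows "i \<in> middle \<or> l < w i" "c < w i" "w r < l \<Longrightarrow> w r < w i"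
proof -
  have i: "i \<in> {1..n}" using assms rows kl_in by auto
  note d = tail_props[OF d1(1)]
  have "w i \<noteq> w a" using exit_inj[of i a] i row_in assms rows by auto
  moreover have "\<not> w i < w a"
  proof
    assume lt: "w i < w a"
    show False
    proof (cases "w r < l")
      case True
      show False by (rule av241653[of a r i k h "row_of d1"])
        (use assms rows kl h wk d lt True tail_less_wr[OF d1(1)] in auto)
    next
      case False
      show False by (rule av25143[of a r i h "row_of d1"])
        (use assms rows kl h d lt False wr_ne in auto)
    qed
  qed
  moreover have "w i \<noteq> l" using exit_inj[of i h] i h assms by auto
  ultimately show "i \<in> middle \<or> l < w i" using assms unfolding middle_def by auto
  then have or: "w r < w i \<or> l < w i" using middle_dominates[of i r] assms by auto
  then show "c < w i" using c_le_wr kl by auto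
  show "w r < w i" if "w r < l" using or that by auto
qed

end

section \<open>The two positions of the rightmost jay\<close>

context big_jay begin

lemma row_of_ne: "\<lbrakk>x \<in> {1..n}; w i \<noteq> x\<rbrakk> \<Longrightarrow> row_of x \<noteq> i"
  using w_row_of[of x] by blast

lemma small_row:
  assumes "x \<in> {1..n}" "x < c" "row_of x \<le> k" shows "row_of x < r"
proof -
  have x: "row_of x \<in> {1..n}" "w (row_of x) = x" using row_of_in w_row_of assms(1) by auto
  have "row_of x \<noteq> k" by (rule row_of_ne) (use wk assms kl in auto)
  moreover have "\<not> (r < row_of x \<and> row_of x < k)"
  proof
    assume "r < row_of x \<and> row_of x < k"
    then have "c < w (row_of x)" using middle_exits(2) by blast
    then show False using x assms by simp
  qed
  moreover have "row_of x \<noteq> r" by (rule row_of_ne) (use c_le_wr assms in auto)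
  ultimately show ?thesis using assms(3) by linarith
qed

lemma rows_order: "row_of x < row_of x' \<or> row_of x' < row_of x" if "x \<noteq> x'" "x \<in> {1..n}" "x' \<in> {1..n}"
  using row_of_inj[of x x'] that by (metis linorder_neqE_nat)

lemma y_neq_1: "y - 1 \<le> n" "r \<le> y - 1"
  using rows by auto

text \<open>Here \<open>x0\<close> and \<open>s0\<close> both exit above row \<open>r\<close>, and
\<open>x0\<close> stands beyond column \<open>c\<close> on line \<open>r\<close>. If all of
\<open>tail\<close> is below \<open>c\<close>, the count at column \<open>c - 1\<close> fails.
Otherwise \<open>x0\<close> and \<open>s0\<close> exit in decreasing order (12543), so no row from
\<open>r\<close> to \<open>k - 1\<close> exits a label above \<open>l\<close> and \<open>d1\<close>
is the only label of \<open>tail\<close> from \<open>c\<close> on (215643 and 216543). This is so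
rigid that \<open>w r\<close> and the labels above it, up to the next exit, stand in their own
columns. The run that passes column \<open>c\<close> in row \<open>y\<close> ends in a jay in some
column \<open>c2\<close> and sends up a label below \<open>c\<close>. If \<open>w r < c2\<close>,
this label gets to the right of \<open>w r\<close>, although it exits above row \<open>r\<close>; if
\<open>c2 < w r\<close>, the holes \<open>c\<close> and \<open>c2\<close> on line \<open>y\<close>
ask for two late labels between \<open>c\<close> and \<open>w r\<close>.\<close>

lemma shallow:
  assumes yk: "y \<le> k" shows False
proof -
  have rx: "row_of x0 < r" by (rule small_row) (use x0 yk in auto)
  then have land: "c < pos (y - 1) x0" by (intro x0_lands) (use rows in auto)
  have land_r: "c < pos r x0"
    using pos_mono[OF x0(5) _ y_neq_1(2,1)] rx land by fastforce
  have hk: "\<And>x. \<lbrakk>w a < x; x \<le> l; k < row_of x; x \<noteq> l\<rbrakk> \<Longrightarrow> x \<in> tail" by (rule late_cases)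
  have cw: "w a < c" using cols by simp
  note d = tail_props[OF d1(1)]
  show False
  proof (cases "c \<le> d1")
    case False
    then have dc: "d1 < c" by simp
    have sub: "late r (c - 1) l \<subseteq> w ` middle \<union> {l}"
    proof
      fix x assume "x \<in> late r (c - 1) l"
      then have x: "c \<le> x" "x \<in> late r (w a) l" using cw by (auto simp: late_def)
      then show "x \<in> w ` middle \<union> {l}" using late_r d1(2)[of x] dc by auto
    qed
    have E: "{x0} \<subseteq> intruders r (c - 1)" using x0 rx land_r by (auto simp: intruders_def)
    have H: "gaps \<union> {c} \<subseteq> holes r (c - 1) l" using holes_alpha cw gaps_right by (fastforce simp: holes_def)
    have "card (gaps \<union> {c}) + card {x0} \<le> card (w ` middle \<union> {l})"
      by (rule count_le[OF clean_l[OF order_refl rows_le(1)] rows_le(1) _ rows_le(3) H E sub]) (use kl finite_tail_middle in auto)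
    moreover have "card (gaps \<union> {c}) = card middle + 1"
      using gaps_right finite_gaps gaps_props(1) by (subst card_Un_disjoint) auto
    moreover have "card (w ` middle \<union> {l}) \<le> card middle + 1"
      using card_Un_le[of "w ` middle" "{l}"] card_image_le[OF finite_tail_middle(2), of w] by simp
    ultimately show False by simp
  next
    case True
    have rs: "row_of s0 < r" by (rule small_row) (use s0 kl in auto)
    have "x0 \<noteq> s0" using land_r s0 by auto
    define s1 where "s1 = max x0 s0"
    define s2 where "s2 = min x0 s0"
    have s12: "s1 \<in> {1..n}" "s2 \<in> {1..n}" "s2 < s1" "s1 < c" "row_of s1 < r" "row_of s2 < r"
      using \<open>x0 \<noteq> s0\<close> x0 s0 rx rs by (auto simp: s1_def s2_def max_def min_def)
    have v: "row_of s1 \<in> {1..n}" "w (row_of s1) = s1" "row_of s2 \<in> {1..n}" "w (row_of s2) = s2"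
      using s12 row_of_in w_row_of by auto
    have ord: "row_of s1 < row_of s2"
    proof (rule ccontr)
      assume "\<not> row_of s1 < row_of s2"
      then have "row_of s2 < row_of s1" using rows_order[of s1 s2] s12 by auto
      then show False
        by (intro av12543[of "row_of s2" "row_of s1" k h "row_of d1"]) (use s12 v d h wk kl True in auto)
    qed
    have nobig: False if "r \<le> i" "i < k" "l < w i" for i
      by (rule av2156x[of "row_of s1" "row_of s2" i k h "row_of d1"]) (use s12 v d h wk kl True ord that in auto)
    have rl: "w r < l" using nobig[of r] kl wr_ne by fastforce
    have inI: "w r < w i" "w i < l" if "r < i" "i < k" for i
    proof -
      have "i \<in> middle" using middle_exits(1)[OF that] nobig[of i] that by auto
      then show "w r < w i" "w i < l" using middle_dominates[of i r] that by (auto simp: middle_def)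
    qed
    have one: "x = d1" if "x \<in> tail" "c \<le> x" for x
    proof (rule ccontr)
      assume "x \<noteq> d1"
      then have "x < d1" using d1(2)[OF that(1)] by simp
      then have "row_of d1 < row_of x" by (rule tail_rows[OF d1(1) that(1)])
      then show False
        by (intro av2156x[of "row_of s1" "row_of s2" k h "row_of d1" "row_of x"])
          (use s12 v d h wk kl ord that tail_props[OF that(1)] \<open>x < d1\<close> in auto)
    qed
    define tau where "tau i = (if i = k then l else w i)" for i
    \<comment> \<open>by induction from line \<open>k\<close> upwards; on line \<open>i\<close> this
      concerns the labels from \<open>w r\<close> up to the exit of row \<open>i\<close>\<close>
    have home: "\<forall>x. w r \<le> x \<and> x < tau i \<longrightarrow> lv i x = x" if "r < i" "i \<le> k" for i
      using that
    proof (induction "k - i" arbitrary: i)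
      case 0
      then have ik: "i = k" by simp
      have sub: "late k j l \<subseteq> {l}" if "w r - 1 \<le> j" for j
      proof
        fix x assume "x \<in> late k j l"
        then have x: "j < x" "x \<le> l" "k < row_of x" by (auto simp: late_def)
        have wx: "w a < x" "w r \<le> x" using x that wa_less_wr by auto
        show "x \<in> {l}" using hk[of x] tail_less_wr[of x] x wx by auto
      qed
      show ?case
      proof (intro allI impI)
        fix x assume "w r \<le> x \<and> x < tau i"
        then have x: "w r \<le> x" "x < l" by (auto simp: tau_def ik)
        have xp: "0 < x" using x(1) wa_less_wr by simp
        have occ: "lv k x \<noteq> 0"
        proof
          assume "lv k x = 0"
          then have "{x, l} \<subseteq> holes k (w r - 1) l" using x l_hole xp by (auto simp: holes_def)
          then have "card {x, l} + card ({} :: nat set) \<le> card {l}"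
            by (intro count_le[OF clean_l[OF _ rows_le(2)] rows_le(2) _ rows_le(3) _ _ sub[OF order_refl]]) (use kl rl in auto)
          then show False using x by simp
        qed
        note la = label_at[OF refl occ rows_le(2)]
        have "lv k x = x"
        proof (rule ccontr)
          assume "lv k x \<noteq> x"
          then have lt: "lv k x < x" using la(4) by simp
          have E: "{lv k x} \<subseteq> intruders k (x - 1)" using la lt by (auto simp: intruders_def)
          have H: "{l} \<subseteq> holes k (x - 1) l" using l_hole x by (auto simp: holes_def)
          have "card {l} + card {lv k x} \<le> card {l}"
            by (rule count_le[OF clean_l[OF _ rows_le(2)] rows_le(2) _ rows_le(3) H E sub]) (use kl x in auto)
          then show False by simp
        qed
        then show "lv i x = x" using ik by simp
      qed
    next
      case (Suc e)
      have i: "r < Suc i" "Suc i \<le> k" "i < k" using Suc.hyps(2) Suc.prems by auto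
      have IH: "lv (Suc i) x = x" if "w r \<le> x" "x < tau (Suc i)" for x
        using Suc.hyps(1)[of "Suc i"] Suc.hyps(2) i that by auto
      have wi: "tau i = w i" "w r < w i" "w i < l" using inI[of i] i Suc.prems by (auto simp: tau_def)
      have tt: "w i < tau (Suc i)"
      proof (cases "Suc i = k")
        case True then show ?thesis using wi by (simp add: tau_def)
      next
        case False
        then have "Suc i \<in> middle" using middle_exits(1)[of "Suc i"] nobig[of "Suc i"] i by auto
        then show ?thesis using middle_dominates[of "Suc i" i] Suc.prems False by (simp add: tau_def)
      qed
      have sn: "1 \<le> Suc i" "Suc i \<le> n" and il: "i \<in> {1..n}" using i kl_in Suc.prems by auto
      have ce: "cell (lh (Suc i) (j - 1)) (lv (Suc i) j) (lh (Suc i) j) (lv i j)" if "1 \<le> j" "j \<le> n" for j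
        using cells[OF sn that] by simp
      \<comment> \<open>a run here would carry a label below \<open>w i\<close> to the right of
        \<open>w i\<close> on line \<open>i\<close>, against \<open>exit_least\<close>\<close>
      have quiet: "lh (Suc i) j = 0" if j: "w r \<le> j" "j < w i" for j
      proof (rule ccontr)
        assume A: "lh (Suc i) j \<noteq> 0"
        have wn: "w i \<le> n" using wi rows_le by simp
        have on: "lh (Suc i) j' \<noteq> 0" if "j \<le> j'" "j' \<le> w i" for j'
          using that
        proof (induction j' rule: dec_induct)
          case base show ?case by (rule A)
        next
          case (step j')
          have "lv (Suc i) (Suc j') = Suc j'" by (rule IH) (use step j tt in auto)
          then show ?case using ce[of "Suc j'"] step wn by (auto simp: cell_def split: if_splits)
        qed
        define u where "u = lh (Suc i) (w i)"
        have u0: "u \<noteq> 0" unfolding u_def by (rule on) (use j in auto)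
        have jj: "lh (Suc i) (w i) \<le> lh (Suc i) j"
          by (rule carry_decreasing[OF sn _ wn]) (use j on in auto)
        have "lh (Suc i) j \<le> j" by (rule carried_label_le[OF sn refl A]) (use j wn in auto)
        then have uw: "u < w i" using jj j by (simp add: u_def)
        have wsi: "w (Suc i) \<noteq> u"
        proof (cases "Suc i = k")
          case True then show ?thesis using wk wi uw by simp
        next
          case False then show ?thesis using tt uw by (simp add: tau_def)
        qed
        then have "lh (Suc i) n \<noteq> u" using exits[OF sn] by simp
        then obtain p where p: "w i < p" "lv i p = u"
          using carry_forward[OF sn u_def[symmetric] u0 wn] wn by auto
        have wiw: "w i \<noteq> 0" using uw by simp
        have "lv (Suc i) (w i) = w i" by (rule IH) (use wi tt in auto)
        moreover have "lh (Suc i) (w i - 1) \<noteq> 0" by (rule on) (use j in auto)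
        moreover have "lh (Suc i) (w i - 1) \<le> w i - 1"
          by (rule carried_label_le[OF sn refl \<open>lh (Suc i) (w i - 1) \<noteq> 0\<close>]) (use wn in auto)
        ultimately have "lv i (w i) = max (lh (Suc i) (w i - 1)) (w i)"
          using cell_cross[OF ce[of "w i"]] wiw wn by auto
        then have "lv i (w i) = w i" using \<open>lh (Suc i) (w i - 1) \<le> w i - 1\<close> by simp
        then have "pos i (w i) = w i" by (intro pos_eq) (use il wiw in auto)
        then have "w i < u" using exit_least[OF il, of p] p u0 in_columns[of i p] il by auto
        then show False using uw by simp
      qed
      show ?case
      proof (intro allI impI)
        fix x assume "w r \<le> x \<and> x < tau i"
        then have x: "w r \<le> x" "x < w i" using wi by auto
        have l1: "lv (Suc i) x = x" by (rule IH) (use x tt in auto)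
        have "0 < x" using x(1) wa_less_wr by simp
        then show "lv i x = x" using ce[of x] l1 quiet[OF x] x wi rows_le by (auto simp: cell_def split: if_splits)
      qed
    qed
    have ry: "r < y" "w r < tau y" using rows yk inI[of y] rl by (auto simp: tau_def)
    have rho_home: "lv y (w r) = w r" using home[of y] ry yk by auto
    have wr0: "w r \<noteq> 0" using wa_less_wr by simp
    have "w r \<noteq> c" using rho_home c_hole[of y] rows wr0 by auto
    then have cr: "c < w r" using c_le_wr by simp
    have wy: "c < w y"
    proof (cases "y = k")
      case True then show ?thesis using wk kl by simp
    next
      case False then show ?thesis using middle_exits(2)[of y] rows yk by simp
    qed
    have "\<exists>j. c < j \<and> j \<le> n \<and> lh y j = 0" using exit_pass wy x0(2) by fastforce
    then have ex: "\<exists>j. c < j \<and> lh y j = 0" by blast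
    define c2 where "c2 = (LEAST j. c < j \<and> lh y j = 0)"
    have c2: "c < c2" "lh y c2 = 0" using LeastI_ex[OF ex] unfolding c2_def by auto
    have before: "lh y j \<noteq> 0" if "c \<le> j" "j < c2" for j
      using not_less_Least[of j "\<lambda>j. c < j \<and> lh y j = 0"] that pass unfolding c2_def by (cases "j = c") auto
    have c2n: "c2 \<le> n"
    proof -
      obtain j where "c < j" "j \<le> n" "lh y j = 0" using \<open>\<exists>j. c < j \<and> j \<le> n \<and> lh y j = 0\<close> by blast
      then have "c2 \<le> j" unfolding c2_def by (intro Least_le) auto
      then show ?thesis using \<open>j \<le> n\<close> by simp
    qed
    have jy: "jay y c2" using before[of "c2 - 1"] c2 c2n cols row_in by (auto simp: jay_def)
    have c2l: "c2 \<le> l" using rightmost[of y c2] jy rows by fastforce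
    define x' where "x' = lh y (c2 - 1)"
    have x'0: "x' \<noteq> 0" unfolding x'_def using before[of "c2 - 1"] c2 by auto
    have y': "1 \<le> y" "y \<le> n" using row_in by auto
    have "lh y (c2 - 1) \<le> lh y c" by (rule carry_decreasing[OF y']) (use c2 c2n before in auto)
    then have x'c: "x' < c" using x0(2) by (simp add: x'_def x0_def)
    have lv2: "lv (y - 1) c2 = x'" "lv y c2 = 0" using jayD[OF jy] by (simp_all add: x'_def)
    note la' = label_at[OF lv2(1) x'0 y_neq_1(1)]
    have rx': "row_of x' < r" by (rule small_row) (use la' x'c yk in auto)
    have rrho: "row_of (w r) = r" "w r \<in> {1..n}" using row_of_w[OF row_in(2)] w_label[OF row_in(2)] by auto
    have "c2 \<noteq> w r" using lv2(2) rho_home wr0 by auto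
    then consider "w r < c2" | "c2 < w r" by linarith
    then show False
    proof cases
      case 1
      have wn: "1 \<le> w r" "w r \<le> n" using rrho by auto
      have a1: "lh y (w r - 1) \<noteq> 0" by (rule before) (use cr 1 in auto)
      have "lh y (w r - 1) \<le> w r - 1" by (rule carried_label_le[OF y' refl a1]) (use wn in auto)
      then have "lv (y - 1) (w r) = w r"
        using cell_cross[OF cells[OF y' wn] a1] rho_home wr0 by simp
      then have "pos (y - 1) (w r) = w r" by (intro pos_eq) (use y' wr0 in auto)
      moreover have "pos (y - 1) x' < pos (y - 1) (w r)"
        by (rule noncrossing) (use la' rrho x'c cr rx' y_neq_1 in auto)
      ultimately show False using la'(3) 1 by simp
    next
      case 2
      have cl: "clean y l" by (rule clean_l) (use rows in auto)
      have i0: "intruders y (w r - 1) = {}"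
      proof (rule ccontr)
        assume "intruders y (w r - 1) \<noteq> {}"
        then obtain v where "v \<in> intruders y (w r - 1)" by blast
        then have v': "v \<in> {1..n}" "v < w r" "row_of v \<le> y" "w r \<le> pos y v"
          using rrho unfolding intruders_def by auto
        have vv: "row_of v \<in> {1..n}" "w (row_of v) = v" using row_of_in w_row_of v' by auto
        have "row_of v \<noteq> k" by (rule row_of_ne) (use wk v' rl in auto)
        moreover have "\<not> (r < row_of v \<and> row_of v < k)"
        proof
          assume "r < row_of v \<and> row_of v < k"
          then have "w r < w (row_of v)" using inI(1) by blast
          then show False using vv v' by simp
        qed
        moreover have "row_of v \<noteq> r" by (rule row_of_ne) (use v' in auto)
        ultimately have "row_of v < r" using v' yk by linarith
        then have "pos y v < pos y (w r)"
          by (intro noncrossing) (use v' rrho rows in auto)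
        moreover have "pos y (w r) = w r" by (rule pos_eq[OF y'(2) rho_home wr0])
        ultimately show False using v'(4) by simp
      qed
      have "card (late y (w r - 1) l) = card (intruders y (w r - 1)) + card (holes y (w r - 1) l)"
        by (rule count[OF cl y'(2) _ rows_le(3)]) (use rl in auto)
      then have e1: "card (late y (w r - 1) l) = card (holes y (w r - 1) l)" using i0 by simp
      have e2: "card (late y (c - 1) l) = card (intruders y (c - 1)) + card (holes y (c - 1) l)"
        by (rule count[OF cl y'(2) _ rows_le(3)]) (use kl in auto)
      have hsub: "{c, c2} \<union> holes y (w r - 1) l \<subseteq> holes y (c - 1) l"
        using c_hole[of y] rows lv2 c2 cr c2l kl cols by (auto simp: holes_def)
      have "{c, c2} \<inter> holes y (w r - 1) l = {}" using cr 2 by (auto simp: holes_def)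
      then have "card ({c, c2} \<union> holes y (w r - 1) l) = card {c, c2} + card (holes y (w r - 1) l)"
        by (intro card_Un_disjoint) (auto simp: finite_holes)
      then have e3: "2 + card (late y (w r - 1) l) \<le> card (late y (c - 1) l)"
        using card_mono[OF finite_holes hsub] e1 e2 c2 by simp
      have "late y (c - 1) l \<subseteq> late y (w r - 1) l \<union> {d1}"
      proof
        fix x assume "x \<in> late y (c - 1) l"
        then have x: "c \<le> x" "x \<le> l" "y < row_of x" using cols by (auto simp: late_def)
        show "x \<in> late y (w r - 1) l \<union> {d1}"
        proof (cases "w r \<le> x")
          case True then show ?thesis using x wr0 by (auto simp: late_def)
        next
          case False
          have xn: "x \<in> {1..n}" using x cols rows_le by auto
          have xx: "row_of x \<in> {1..n}" "w (row_of x) = x" using row_of_in w_row_of xn by auto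
          have "row_of x \<noteq> k" by (rule row_of_ne) (use wk x xn in auto)
          moreover have "\<not> (r < row_of x \<and> row_of x < k)"
          proof
            assume "r < row_of x \<and> row_of x < k"
            then have "w r < w (row_of x)" using inI(1) by blast
            then show False using xx False by simp
          qed
          ultimately have "k < row_of x" using x rows by linarith
          then have "x \<in> tail" using hk[of x] x cw False rl by auto
          then show ?thesis using one x by auto
        qed
      qed
      then have "card (late y (c - 1) l) \<le> card (late y (w r - 1) l \<union> {d1})"
        by (intro card_mono) (auto simp: finite_late)
      also have "\<dots> \<le> card (late y (w r - 1) l) + 1" using card_Un_le[of _ "{d1}"] by simp
      finally show False using e3 by simp
    qed
  qed
qed

text \<open>Now column \<open>c\<close> is still a hole on line \<open>k\<close>, and so is some column
\<open>q'\<close> between \<open>q\<close> and \<open>c\<close>. Hence \<open>tail\<close> has at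
least two labels \<open>d2 < d1\<close>, and \<open>w a\<close> is the only label below
\<open>d2\<close> that exits in the rows up to \<open>k\<close> (12543, 215643 and 216543). If
\<open>c \<le> d2\<close>, then \<open>c\<close> is in \<open>tail\<close> and exits below row
\<open>y\<close>, and the hole \<open>q'\<close> yields a smaller label of \<open>tail\<close> that
exits still later; \<open>x0\<close> or \<open>s0\<close> is a label below \<open>c\<close> that
exits between \<open>k\<close> and \<open>y\<close>, which contradicts the order of
\<open>tail\<close> or gives 25143. If \<open>d2 < c\<close>, the count on line \<open>k\<close> is
tight, so that \<open>x0\<close> exits below row \<open>k\<close>, hence \<open>d1\<close> and
\<open>c\<close> have exited by row \<open>y\<close>; then \<open>c\<close> stands beyond its column
on line \<open>y\<close> and no late label accounts for it.\<close>

lemma deep: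
  assumes yk: "k < y" shows False
proof -
  have y': "1 \<le> y" "y \<le> n" using row_in by auto
  have kc: "lv k c = 0" using c_hole[of k] kl yk by simp
  have ck: "clean k l" by (rule clean_l) (use kl rows_le in auto)
  have cly: "clean y l" by (rule clean_l) (use rows in auto)
  have cw: "w a < c" "c \<in> {1..n}" "0 < c" using cols by auto
  have ra: "row_of (w a) = a" "w a \<in> {1..n}" using row_of_w[OF row_in(1)] w_label[OF row_in(1)] by auto
  have "\<exists>q'. q \<le> q' \<and> q' < c \<and> lv k q' = 0"
  proof (rule ccontr)
    assume none: "\<not> (\<exists>q'. q \<le> q' \<and> q' < c \<and> lv k q' = 0)"
    \<comment> \<open>if all columns from \<open>q\<close> to \<open>c - 1\<close> are occupied on
      line \<open>k\<close>, then also on the lines above it, up to line \<open>r\<close>: an empty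
      one would start a run that has to pass column \<open>c\<close>\<close>
    have full: "\<forall>b. q \<le> b \<and> b < c \<longrightarrow> lv k b \<noteq> 0"
    proof (intro allI impI notI)
      fix b assume "q \<le> b \<and> b < c" "lv k b = 0"
      then have "\<exists>q'. q \<le> q' \<and> q' < c \<and> lv k q' = 0" by (intro exI[of _ b]) simp
      then show False using none by simp
    qed
    have "\<forall>b. q \<le> b \<and> b < c \<longrightarrow> lv i b \<noteq> 0" if "r \<le> i" "i \<le> k" for i
      using that(2,1)
    proof (induction rule: inc_induct)
      case base show ?case by (rule full)
    next
      case (step i)
      have s: "1 \<le> Suc i" "Suc i \<le> n" using step rows_le by auto
      have ce: "cell (lh (Suc i) (j - 1)) (lv (Suc i) j) (lh (Suc i) j) (lv i j)" if "1 \<le> j" "j \<le> n" for j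
        using cells[OF s that] by simp
      have occ: "lv (Suc i) b \<noteq> 0" if "q \<le> b" "b < c" for b using step.IH[OF le_SucI[OF step.prems]] that by blast
      show ?case
      proof (intro allI impI notI)
        fix b assume b: "q \<le> b \<and> b < c" and z: "lv i b = 0"
        have "lh (Suc i) j \<noteq> 0" if "b \<le> j" "j < c" for j
          using that
        proof (induction j rule: dec_induct)
          case base
          show ?case using ce[of b] occ[of b] b z cols by (auto simp: cell_def split: if_splits)
        next
          case (step j)
          then show ?case using ce[of "Suc j"] occ[of "Suc j"] b cols by (auto simp: cell_def split: if_splits)
        qed
        then have "lh (Suc i) (c - 1) \<noteq> 0" using b by auto
        moreover have "lh (Suc i) c = 0" by (rule no_pass) (use step yk in auto)
        moreover have "lv i c = 0" by (rule c_hole) (use step yk in auto)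
        ultimately show False using ce[of c] cols by (auto simp: cell_def split: if_splits)
      qed
    qed
    from this[of r] have "lv r q \<noteq> 0" using kl cols by auto
    then show False using q_hole by simp
  qed
  then obtain q' where q': "q \<le> q'" "q' < c" "lv k q' = 0" by blast
  have late_k: "late k (w a) l \<subseteq> insert l tail"
    using late_cases unfolding late_def by auto
  have Hk: "{q', c, l} \<subseteq> holes k (w a) l" using q' kc l_hole cols kl by (auto simp: holes_def)
  have "card {q', c, l} + card ({} :: nat set) \<le> card (insert l tail)"
    by (rule count_le[OF ck rows_le(2) _ rows_le(3) Hk _ late_k]) (use wa_less_l finite_tail_middle in auto)
  then have "3 \<le> card (insert l tail)" using q' kl by simp
  then have cD: "2 \<le> card tail" using card_insert_le_m1[of 3 tail l] finite_tail_middle by (simp add: card_insert_if split: if_splits)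
  define d2 where "d2 = Max (tail - {d1})"
  have "tail - {d1} \<noteq> {}"
  proof
    assume "tail - {d1} = {}"
    then have "tail \<subseteq> {d1}" by blast
    then show False using card_mono[of "{d1}" tail] cD by simp
  qed
  then have "d2 \<in> tail - {d1}" unfolding d2_def using finite_tail_middle by (intro Max_in) auto
  then have d2: "d2 \<in> tail" "d2 < d1" using d1(2)[of d2] by auto
  have d2max: "x \<le> d2" if "x \<in> tail" "x \<noteq> d1" for x
    unfolding d2_def using that finite_tail_middle by (intro Max_ge) auto
  have rd: "row_of d1 < row_of d2" by (rule tail_rows[OF d1(1) d2])
  note p1 = tail_props[OF d1(1)] and p2 = tail_props[OF d2(1)]
  have Sfact: "x = w a" if x: "x \<in> {1..n}" "row_of x \<le> k" "x < d2" for x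
  proof (rule ccontr)
    assume ne: "x \<noteq> w a"
    have xx: "row_of x \<in> {1..n}" "w (row_of x) = x" using row_of_in w_row_of x by auto
    have "row_of x \<noteq> k" by (rule row_of_ne) (use wk x p2 in auto)
    then have xk: "row_of x < k" using x by simp
    have ne2: "row_of x \<noteq> a" by (rule row_of_ne) (use x ne in auto)
    consider "x < w a" "row_of x < a" | "w a < x" "a < row_of x" | "x < w a" "a < row_of x" | "w a < x" "row_of x < a"
      using ne ne2 by linarith
    then show False
    proof cases
      case 1 show False
        by (rule av12543[of "row_of x" a k h "row_of d2"]) (use 1 xx xk rows kl h wk p2 x in auto)
    next
      case 2 show False
        by (rule av12543[of a "row_of x" k h "row_of d2"]) (use 2 xx xk rows kl h wk p2 x in auto)
    next
      case 3 show False
        by (rule av2156x[of a "row_of x" k h "row_of d1" "row_of d2"]) (use 3 xx xk rows kl h wk p2 x p1 d2 rd in auto)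
    next
      case 4 show False
        by (rule av2156x[of "row_of x" a k h "row_of d1" "row_of d2"]) (use 4 xx xk rows kl h wk p2 x p1 d2 rd in auto)
    qed
  qed
  \<comment> \<open>an exit below \<open>w a\<close> before two labels of \<open>tail\<close> gives
    25143\<close>
  have tfact: False if t: "r < i" "w i < w a" "i < row_of e" and e: "e \<in> tail" "e' \<in> tail" "row_of e < row_of e'" for i e e'
    by (rule av25143[of a r i "row_of e" "row_of e'"])
      (use t e tail_props[OF e(1)] tail_props[OF e(2)] tail_decreasing[OF e] tail_less_wr[OF e(1)] rows in auto)
  have cd1: "c \<le> d1"
  proof (rule ccontr)
    assume "\<not> c \<le> d1"
    then have dc: "d1 < c" by simp
    have sub: "late k (c - 1) l \<subseteq> {l}"
    proof
      fix x assume "x \<in> late k (c - 1) l"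
      then have x: "c \<le> x" "x \<le> l" "k < row_of x" using cw by (auto simp: late_def)
      show "x \<in> {l}"
      proof (cases "x = l")
        case False
        have "w a < x" using x cw by simp
        then have "x \<in> tail" by (rule late_cases[OF _ x(2,3) False])
        then show ?thesis using d1(2) x dc by fastforce
      qed simp
    qed
    have "{c, l} \<subseteq> holes k (c - 1) l" using kc l_hole kl cw by (auto simp: holes_def)
    then have "card {c, l} + card ({} :: nat set) \<le> card {l}"
      by (intro count_le[OF ck rows_le(2) _ rows_le(3) _ _ sub]) (use kl in auto)
    then show False using kl by simp
  qed
  \<comment> \<open>if \<open>c\<close> has exited by row \<open>y\<close>, it stands beyond its own
    column on line \<open>y\<close>\<close>
  have Z: "\<exists>z. c < z \<and> (z = l \<and> y < h \<or> z \<in> tail \<and> y < row_of z)" if "row_of c \<le> y"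
  proof -
    have pc: "lv y (pos y c) = c" "c \<le> pos y c"
      using at_pos[OF cw(2) that y'(2)] pos_ge(1)[OF cw(2) that y'(2)] by auto
    then have "pos y c \<noteq> c" using c_hole[of y] rows cw by auto
    then have E: "{c} \<subseteq> intruders y c" using pc that cw by (auto simp: intruders_def)
    have "card ({} :: nat set) + card {c} \<le> card (late y c l)"
      by (rule count_le[OF cly y'(2) _ rows_le(3) _ E subset_refl finite_late]) (use kl in auto)
    then have "late y c l \<noteq> {}" by auto
    then obtain z where "z \<in> late y c l" by blast
    then have z: "c < z" "z \<le> l" "y < row_of z" by (auto simp: late_def)
    then show ?thesis using late_cases[of z] cw yk by (intro exI[of _ z]) (auto simp: h_def)
  qed
  show False
  proof (cases "c \<le> d2")
    case True
    have "c \<noteq> w a" using cw by simp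
    have "k < row_of c"
    proof (rule ccontr)
      assume A: "\<not> k < row_of c"
      then have "c \<noteq> d2" using p2 h by auto
      then show False using Sfact[OF cw(2)] A True \<open>c \<noteq> w a\<close> by auto
    qed
    then have cD: "c \<in> tail" using late_cases[of c] cw kl by auto
    note pc = tail_props[OF cD]
    have cy: "y < row_of c"
    proof (rule ccontr)
      assume "\<not> y < row_of c"
      then have le: "row_of c \<le> y" by simp
      from Z[OF le] obtain z where "c < z" "z = l \<and> y < h \<or> z \<in> tail \<and> y < row_of z" by blast
      then show False using le pc tail_decreasing[OF cD, of z] by auto
    qed
    have sub: "intruders k (c - 1) \<subseteq> intruders k (w a)"
    proof
      fix v assume "v \<in> intruders k (c - 1)"
      then have v: "v \<in> {1..n}" "v < c" "row_of v \<le> k" "c \<le> pos k v" using cw by (auto simp: intruders_def)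
      then have "v = w a" using Sfact[of v] True by auto
      then show "v \<in> intruders k (w a)" using v cw ra by (auto simp: intruders_def)
    qed
    have e1: "card (late k (w a) l) = card (intruders k (w a)) + card (holes k (w a) l)"
      by (rule count[OF ck rows_le(2) _ rows_le(3)]) (use wa_less_l in auto)
    have e2: "card (late k (c - 1) l) = card (intruders k (c - 1)) + card (holes k (c - 1) l)"
      by (rule count[OF ck rows_le(2) _ rows_le(3)]) (use kl in auto)
    have "insert q' (holes k (c - 1) l) \<subseteq> holes k (w a) l" using q' cols kl by (auto simp: holes_def)
    moreover have "q' \<notin> holes k (c - 1) l" using q' by (auto simp: holes_def)
    ultimately have "card (holes k (c - 1) l) + 1 \<le> card (holes k (w a) l)"
      using card_mono[OF finite_holes, of "insert q' (holes k (c - 1) l)" k "w a" l] by (simp add: finite_holes)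
    moreover have "card (intruders k (c - 1)) \<le> card (intruders k (w a))" by (rule card_mono[OF finite_intruders sub])
    ultimately have "card (late k (c - 1) l) < card (late k (w a) l)" using e1 e2 by simp
    then have "\<not> late k (w a) l \<subseteq> late k (c - 1) l" using card_mono[OF finite_late] by (metis not_less)
    then obtain e where e: "e \<in> late k (w a) l" "e \<notin> late k (c - 1) l" by blast
    then have e': "w a < e" "e < c" "k < row_of e" using cw by (auto simp: late_def)
    then have eD: "e \<in> tail" using late_cases[of e] kl by auto
    have re: "row_of c < row_of e" by (rule tail_rows[OF cD eD e'(2)])
    have sx: "s0 \<noteq> x0"
    proof
      assume eq: "s0 = x0"
      then have "row_of x0 \<le> y - 1" "c < pos (y - 1) x0" using s0 rows x0_lands by auto
      moreover have "pos (y - 1) s0 \<le> pos r s0" by (rule pos_mono[OF s0(1,2) y_neq_1(2,1)])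
      ultimately show False using s0 eq by simp
    qed
    obtain z where z: "z \<noteq> w a" "z < c" "z \<in> {1..n}" "row_of z \<le> y"
    proof (cases "s0 = w a")
      case True then show ?thesis using that[of x0] sx x0 by auto
    next
      case False then show ?thesis using that[of s0] s0 rows by auto
    qed
    have zk: "k < row_of z" using Sfact[of z] z True by fastforce
    have zz: "row_of z \<in> {1..n}" "w (row_of z) = z" using row_of_in w_row_of z by auto
    show False
    proof (cases "w a < z")
      case True
      then have zD: "z \<in> tail" using late_cases[of z] zk z kl by auto
      have "row_of z < row_of c" using z cy by simp
      then show False using tail_decreasing[OF zD cD] z by simp
    next
      case False
      then show False using tfact[of "row_of z" c e] zz zk z kl cy cD eD re by auto
    qed
  next
    case False
    then have dc: "d2 < c" by simp
    have sub: "late k (c - 1) l \<subseteq> {d1, l}"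
    proof
      fix x assume "x \<in> late k (c - 1) l"
      then have x: "c \<le> x" "x \<le> l" "k < row_of x" using cw by (auto simp: late_def)
      show "x \<in> {d1, l}"
      proof (cases "x = l")
        case False
        have "w a < x" using x cw by simp
        then have "x \<in> tail" by (rule late_cases[OF _ x(2,3) False])
        then show ?thesis using d2max[of x] x dc by fastforce
      qed simp
    qed
    have Hc: "{c, l} \<subseteq> holes k (c - 1) l" using kc l_hole kl cw by (auto simp: holes_def)
    have i0: "v \<notin> intruders k (c - 1)" for v
    proof
      assume "v \<in> intruders k (c - 1)"
      then have "card {c, l} + card {v} \<le> card {d1, l}"
        by (intro count_le[OF ck rows_le(2) _ rows_le(3) Hc _ sub]) (use kl in auto)
      then show False using kl by (auto simp: card_insert_if split: if_splits)
    qed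
    have xk: "k < row_of x0"
    proof (rule ccontr)
      assume "\<not> k < row_of x0"
      then have x: "row_of x0 \<le> k" by simp
      then have "c < pos (y - 1) x0" by (intro x0_lands) (use yk in auto)
      moreover have "pos (y - 1) x0 \<le> pos k x0" by (rule pos_mono[OF x0(5) x]) (use yk y' in auto)
      ultimately have "x0 \<in> intruders k (c - 1)" using x x0 by (auto simp: intruders_def)
      then show False using i0 by simp
    qed
    have xx: "row_of x0 \<in> {1..n}" "w (row_of x0) = x0" using row_of_in w_row_of x0 by auto
    have "x0 \<noteq> w a" using xk ra rows kl by auto
    then have "row_of d1 \<le> row_of x0"
    proof (cases "w a < x0")
      case True
      then have xD: "x0 \<in> tail" using late_cases[of x0] xk x0 kl by auto
      then show ?thesis using tail_rows[OF d1(1) xD] x0(2) cd1 by simp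
    next
      case False
      then have "x0 < w a" using \<open>x0 \<noteq> w a\<close> by simp
      then show ?thesis using tfact[of "row_of x0" d1 d2] xx xk kl d1(1) d2(1) rd by fastforce
    qed
    then have dy: "row_of d1 \<le> y" using x0(6) by simp
    have cy: "row_of c \<le> y"
    proof (cases "k < row_of c")
      case True
      then have "c \<in> tail" using late_cases[of c] cw kl by auto
      then have "c = d1" using d2max[of c] dc by fastforce
      then show ?thesis using dy by simp
    next
      case False then show ?thesis using yk by simp
    qed
    from Z[OF cy] obtain z where z: "c < z" "z = l \<and> y < h \<or> z \<in> tail \<and> y < row_of z" by blast
    then have "z \<in> tail" "y < row_of z" using dy p1 by auto
    moreover have "z = d1" using d2max[of z] z dc \<open>z \<in> tail\<close> by fastforce
    ultimately show False using dy by simp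
  qed
qed

lemma contradiction: False
  using shallow deep by (cases "y \<le> k") auto

end

context certificate begin

theorem no_certificate: False
proof (cases "\<exists>i j. r < i \<and> c < j \<and> jay i j")
  case False then show False using not_all_jays_left by blast
next
  case True
  define L where "L = {j. \<exists>i>r. jay i j}"
  have fL: "finite L" by (rule finite_subset[of _ "{1..n}"]) (auto simp: L_def jay_def)
  obtain j0 where j0: "j0 \<in> L" "c < j0" using True by (auto simp: L_def)
  define l where "l = Max L"
  have "l \<in> L" unfolding l_def using fL j0 by (intro Max_in) auto
  then obtain k where k: "r < k" "jay k l" by (auto simp: L_def)
  have max: "j \<le> l" if "r < i" "jay i j" for i j
    unfolding l_def by (rule Max_ge[OF fL]) (use that in \<open>auto simp: L_def\<close>)
  have "c < l" using Max_ge[OF fL j0(1)] j0(2) by (simp add: l_def)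
  interpret big_jay n w lv lh a r y q c k l
    by unfold_locales (use k \<open>c < l\<close> max in \<open>auto simp: not_le[symmetric]\<close>)
  show False by (rule contradiction)
qed

end

section \<open>Co-pipes\<close>

lemma co_strands:
  assumes "cell a b r t"
  shows "{Top, Bottom} \<in> strands (co_tile (cell_tile a b r t)) \<longleftrightarrow> t = 0 \<and> b = 0"
    and "{Left, Right} \<in> strands (co_tile (cell_tile a b r t)) \<longleftrightarrow> a \<noteq> 0 \<and> r \<noteq> 0"
    and "{Top, Right} \<in> strands (co_tile (cell_tile a b r t)) \<longleftrightarrow> t = 0 \<and> b \<noteq> 0"
    and "{Left, Bottom} \<in> strands (co_tile (cell_tile a b r t)) \<longleftrightarrow> a \<noteq> 0 \<and> r = 0"
    and "{Left, Top} \<notin> strands (co_tile (cell_tile a b r t))"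
    and "{Top} \<notin> strands (co_tile (cell_tile a b r t))"
  using assms by (auto simp: cell_def cell_tile_def doubleton_eq_iff singleton_insert_inj_eq
      singleton_insert_inj_eq' min_def max_def split: if_splits)

text \<open>A co-pipe uses the vertical edges without a label and the horizontal edges with a label. These are
its steps from a cell that it enters through the edge \<open>e\<close>.\<close>

definition co_down :: "(nat \<Rightarrow> nat \<Rightarrow> nat) \<Rightarrow> (nat \<Rightarrow> nat \<Rightarrow> nat) \<Rightarrow> nat \<Rightarrow> nat \<Rightarrow> edge \<Rightarrow> bool" where
  "co_down lv lh i j e \<longleftrightarrow> (e = Top \<and> lv (i - 1) j = 0 \<and> lv i j = 0) \<or>
     (e = Left \<and> lh i (j - 1) \<noteq> 0 \<and> lh i j = 0)"

definition co_right :: "(nat \<Rightarrow> nat \<Rightarrow> nat) \<Rightarrow> (nat \<Rightarrow> nat \<Rightarrow> nat) \<Rightarrow> nat \<Rightarrow> nat \<Rightarrow> edge \<Rightarrow> bool" where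
  "co_right lv lh i j e \<longleftrightarrow> (e = Top \<and> lv (i - 1) j = 0 \<and> lv i j \<noteq> 0) \<or>
     (e = Left \<and> lh i (j - 1) \<noteq> 0 \<and> lh i j \<noteq> 0)"

definition cocrossing :: "(nat \<Rightarrow> nat \<Rightarrow> nat) \<Rightarrow> (nat \<Rightarrow> nat \<Rightarrow> nat) \<Rightarrow> nat \<Rightarrow> nat \<Rightarrow> bool" where
  "cocrossing lv lh i j \<longleftrightarrow> lh i (j - 1) \<noteq> 0 \<and> lh i j \<noteq> 0 \<and> lv (i - 1) j = 0 \<and> lv i j = 0"

context full
begin

abbreviation "goes_down \<equiv> co_down lv lh"
abbreviation "goes_right \<equiv> co_right lv lh"

abbreviation "centers \<equiv> enters n (co B) Top"

lemma grid_cell: "i \<in> {1..n} \<Longrightarrow> j \<in> {1..n} \<Longrightarrow> cell (lh i (j - 1)) (lv i j) (lh i j) (lv (i - 1) j)"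
  using cells[of i j] by simp

lemma co_grid: "i \<in> {1..n} \<Longrightarrow> j \<in> {1..n} \<Longrightarrow>
    co B i j = co_tile (cell_tile (lh i (j - 1)) (lv i j) (lh i j) (lv (i - 1) j))"
  by (simp add: co_def tiling_of_def)

lemma goes_strand:
  assumes "i \<in> {1..n}" "j \<in> {1..n}" "e = Top \<or> e = Left"
  shows "{e, Bottom} \<in> strands (co B i j) \<longleftrightarrow> goes_down i j e"
    and "{e, Right} \<in> strands (co B i j) \<longleftrightarrow> goes_right i j e"
    and "{e, Top} \<notin> strands (co B i j)"
  using assms(3) co_strands[OF grid_cell[OF assms(1,2)]]
  unfolding co_grid[OF assms(1,2)] co_down_def co_right_def by auto

lemma goes_cell:
  assumes "i \<in> {1..n}" "j \<in> {1..n}"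
  shows "goes_down i j e \<Longrightarrow> lv i j = 0" and "goes_right i j e \<Longrightarrow> lh i j \<noteq> 0"
    and "\<lbrakk>goes_down i j e; goes_down i j e'\<rbrakk> \<Longrightarrow> e = e'"
    and "\<lbrakk>goes_right i j e; goes_right i j e'\<rbrakk> \<Longrightarrow> e = e'"
    and "\<lbrakk>goes_right i j e; goes_down i j e\<rbrakk> \<Longrightarrow> False"
  using grid_cell[OF assms] unfolding co_down_def co_right_def
  by (auto simp: cell_def split: if_splits)

lemma centers_grid:
  assumes "centers p i j e"
  shows "i \<in> {1..n} \<and> j \<in> {1..n} \<and> p + 1 \<le> i + j \<and> (e = Top \<or> e = Left)"
  using assms
proof (induction rule: enters.induct)
  case (up p i j e)
  then show ?case using goes_strand(3)[of "Suc i" j e] by auto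
qed auto

lemma centers_step:
  assumes "centers p i j e"
  shows "goes_down i j e \<Longrightarrow> i < n \<Longrightarrow> centers p (Suc i) j Top"
    and "goes_right i j e \<Longrightarrow> j < n \<Longrightarrow> centers p i (Suc j) Left"
  using centers_grid[OF assms] goes_strand(1,2)[of i j e] assms
  by (auto intro: enters.down enters.right)

lemma centers_induct [consumes 1, case_names start down right]:
  assumes "centers p i j e"
    and "\<And>p. p \<in> {1..n} \<Longrightarrow> Q p 1 p Top"
    and "\<And>p i j e. \<lbrakk>centers p i j e; Q p i j e; goes_down i j e; i < n\<rbrakk> \<Longrightarrow> Q p (Suc i) j Top"
    and "\<And>p i j e. \<lbrakk>centers p i j e; Q p i j e; goes_right i j e; j < n\<rbrakk> \<Longrightarrow> Q p i (Suc j) Left"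
  shows "Q p i j e"
  using assms(1)
proof (induction rule: enters.induct)
  case (from_bottom p) then show ?case by simp
next
  case (from_top p) then show ?case using assms(2) by simp
next
  case (up p i j e)
  then show ?case using centers_grid[OF up(1)] goes_strand(3)[of "Suc i" j e] by auto
next
  case (down p i j e)
  then have "goes_down i j e" using centers_grid[OF down(1)] goes_strand(1)[of i j e] by auto
  then show ?case using assms(3) down by blast
next
  case (right p i j e)
  then have "goes_right i j e" using centers_grid[OF right(1)] goes_strand(2)[of i j e] by auto
  then show ?case using assms(4) right by blast
qed

lemma centers_cases:
  assumes "centers p i j e"
  shows "(i = 1 \<and> j = p \<and> e = Top) \<or>
    (\<exists>i' e'. i = Suc i' \<and> e = Top \<and> centers p i' j e' \<and> goes_down i' j e' \<and> i' < n) \<or>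
    (\<exists>j' e'. j = Suc j' \<and> e = Left \<and> centers p i j' e' \<and> goes_right i j' e' \<and> j' < n)"
  using assms by (induction rule: centers_induct) blast+

text \<open>Each step goes down or to the right by one, so a co-pipe meets an antidiagonal at most once.\<close>

lemma centers_unique:
  assumes "centers p i j e" "centers p i' j' e'" "i + j = i' + j'"
  shows "i = i' \<and> j = j' \<and> e = e'"
  using assms
proof (induction arbitrary: i' j' e' rule: centers_induct)
  case (start p)
  from centers_cases[OF start(2)] show ?case
    using start centers_grid by fastforce
next
  case (down p i j e)
  from centers_cases[OF down.prems(1)] consider
    "i' = 1" "j' = p" |
    i2 e2 where "i' = Suc i2" "e' = Top" "centers p i2 j' e2" "goes_down i2 j' e2" |
    j2 e2 where "j' = Suc j2" "e' = Left" "centers p i' j2 e2" "goes_right i' j2 e2"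
    by blast
  then show ?case
  proof cases
    case 1 then show ?thesis using centers_grid[OF down(1)] down.prems by auto
  next
    case 2
    then have "i = i2 \<and> j = j' \<and> e = e2" using down.IH[of i2 j' e2] down.prems by auto
    then show ?thesis using 2 by auto
  next
    case 3
    then have "i = i' \<and> j = j2 \<and> e = e2" using down.IH[of i' j2 e2] down.prems by auto
    then show ?thesis using 3 down goes_cell(5)[of i j e] centers_grid[OF down(1)] by auto
  qed
next
  case (right p i j e)
  from centers_cases[OF right.prems(1)] consider
    "i' = 1" "j' = p" |
    i2 e2 where "i' = Suc i2" "e' = Top" "centers p i2 j' e2" "goes_down i2 j' e2" |
    j2 e2 where "j' = Suc j2" "e' = Left" "centers p i' j2 e2" "goes_right i' j2 e2"
    by blast
  then show ?case
  proof cases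
    case 1 then show ?thesis using centers_grid[OF right(1)] right.prems by auto
  next
    case 2
    then have "i = i2 \<and> j = j' \<and> e = e2" using right.IH[of i2 j' e2] right.prems by auto
    then show ?thesis using 2 right goes_cell(5)[of i j e] centers_grid[OF right(1)] by auto
  next
    case 3
    then have "i = i' \<and> j = j2 \<and> e = e2" using right.IH[of i' j2 e2] right.prems by auto
    then show ?thesis using 3 by auto
  qed
qed

lemma centers_same_pipe:
  assumes "centers p i j e" "centers q i j e"
  shows "p = q"
  using assms
proof (induction rule: centers_induct)
  case (start p)
  from centers_cases[OF start(2)] show ?case using centers_grid by fastforce
next
  case (down p i j e)
  have g: "i \<in> {1..n}" "j \<in> {1..n}" using centers_grid[OF down(1)] by auto
  from centers_cases[OF down.prems] g obtain e2 where "centers q i j e2" "goes_down i j e2" by auto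
  then show ?case using goes_cell(3)[OF g, of e e2] down by auto
next
  case (right p i j e)
  have g: "i \<in> {1..n}" "j \<in> {1..n}" using centers_grid[OF right(1)] by auto
  from centers_cases[OF right.prems] g obtain e2 where "centers q i j e2" "goes_right i j e2" by auto
  then show ?case using goes_cell(4)[OF g, of e e2] right by auto
qed

definition cocross :: "nat \<Rightarrow> nat \<Rightarrow> bool" where
  "cocross i j \<longleftrightarrow> i \<in> {1..n} \<and> j \<in> {1..n} \<and> cocrossing lv lh i j"

lemma cocrossI:
  assumes "centers p i j Left" "centers q i j Top"
  shows "cocross i j"
proof -
  have g: "i \<in> {1..n}" "j \<in> {1..n}" using centers_grid[OF assms(1)] by auto
  have "lh i (j - 1) \<noteq> 0"
    using centers_cases[OF assms(1)] goes_cell(2)[of i "j - 1"] g centers_grid by fastforce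
  moreover have "lv (i - 1) j = 0"
    using centers_cases[OF assms(2)] goes_cell(1)[of "i - 1" j] g top_empty centers_grid by fastforce
  ultimately show ?thesis using grid_cell[OF g] g unfolding cocross_def cocrossing_def by (auto simp: cell_def split: if_splits)
qed

lemma cocross_tile: "cocross i j \<Longrightarrow> co B i j = Cross"
  using co_grid[of i j] by (auto simp: cocross_def cocrossing_def cell_tile_def)

text \<open>The co-pipe \<open>h\<close> leaves the crossing \<open>(x0, x)\<close> to the right and
\<open>v\<close> leaves it downwards. Until they meet again \<open>h\<close> is above
\<open>v\<close>, so at the next meeting \<open>h\<close> comes from above and \<open>v\<close> from
the left.\<close>

lemma not_above:
  assumes h: "centers h x0 x Left" and v: "centers v x0 x Top"
    and s: "x0 + x < i + j" "i + j = i' + j'" "centers h i j e" "centers v i' j' e'"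
    and apart: "\<And>i j. \<lbrakk>x0 + x < i + j; i + j < i' + j'\<rbrakk> \<Longrightarrow> \<not> (passes n (co B) Top h i j \<and> passes n (co B) Top v i j)"
  shows "i < i' \<or> (i = i' \<and> e = Top \<and> e' = Left)"
  using s apart
proof (induction "i + j" arbitrary: i j e i' j' e' rule: less_induct)
  case less
  have cx: "cocross x0 x" by (rule cocrossI[OF h v])
  have gx: "x0 \<in> {1..n}" "x \<in> {1..n}" using cx by (auto simp: cocross_def cocrossing_def)
  have hstart: "\<not> (i = 1 \<and> j = h \<and> e = Top)" using centers_grid[OF h] less.prems(1) by auto
  have vstart: "\<not> (i' = 1 \<and> j' = v \<and> e' = Top)" using centers_grid[OF v] less.prems(1,2) by auto
  obtain a b f where H: "centers h a b f"
    "(i = Suc a \<and> j = b \<and> e = Top \<and> goes_down a b f) \<or> (i = a \<and> j = Suc b \<and> e = Left \<and> goes_right a b f)"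
    using centers_cases[OF less.prems(3)] hstart by blast
  obtain a' b' f' where V: "centers v a' b' f'"
    "(i' = Suc a' \<and> j' = b' \<and> e' = Top \<and> goes_down a' b' f') \<or> (i' = a' \<and> j' = Suc b' \<and> e' = Left \<and> goes_right a' b' f')"
    using centers_cases[OF less.prems(4)] vstart by blast
  have sum: "Suc (a + b) = i + j" "Suc (a' + b') = i' + j'" using H V by auto
  show ?case
  proof (cases "a + b = x0 + x")
    case True
    have "a = x0 \<and> b = x \<and> f = Left" using centers_unique[OF H(1) h] True by auto
    moreover have "a' = x0 \<and> b' = x \<and> f' = Top" using centers_unique[OF V(1) v] True sum less.prems(2) by auto
    ultimately show ?thesis using H(2) V(2) cx by (auto simp: co_down_def co_right_def cocross_def cocrossing_def)
  next
    case False
    then have gt: "x0 + x < a + b" using sum less.prems(1) by simp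
    have lt: "a + b < i + j" "a + b = a' + b'" using sum less.prems(2) by simp_all
    have ap: "\<not> (passes n (co B) Top h i2 j2 \<and> passes n (co B) Top v i2 j2)"
      if "x0 + x < i2 + j2" "i2 + j2 < a' + b'" for i2 j2
      by (rule less.prems(5)[OF that(1)]) (use that(2) sum in simp)
    have "a < a' \<or> (a = a' \<and> f = Top \<and> f' = Left)"
      by (rule less.hyps[OF lt(1) gt lt(2) H(1) V(1) ap])
    moreover have "a \<noteq> a'"
    proof
      assume "a = a'"
      then have "b = b'" using sum less.prems(2) by simp
      then have "passes n (co B) Top h a b \<and> passes n (co B) Top v a b"
        using H(1) V(1) \<open>a = a'\<close> unfolding passes_def by blast
      then show False using less.prems(5)[OF gt] sum less.prems(2) by simp
    qed
    ultimately have aa: "a < a'" by blast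
    have ih: "i = a \<or> i = Suc a \<and> e = Top" using H(2) by blast
    have iv: "i' = Suc a' \<or> i' = a' \<and> e' = Left" using V(2) by blast
    show ?thesis using ih iv aa by (elim disjE conjE) auto
  qed
qed

text \<open>When the upper co-pipe comes down a column, it has turned into it at a jay and the column is empty
since then. Unless it is still running to the right in row \<open>x0\<close>, its run there has
ended at a column \<open>c1\<close>.\<close>

lemma upper_trace:
  assumes h: "centers h x0 x Left" and cx: "cocross x0 x"
    and "centers h i j e" "x0 + x < i + j"
  shows "x0 \<le> i \<and> (e = Top \<longrightarrow> (\<exists>r. x0 \<le> r \<and> r < i \<and> lh r (j - 1) \<noteq> 0 \<and> lh r j = 0 \<and>
        (\<forall>i'. r \<le> i' \<and> i' < i \<longrightarrow> lv i' j = 0))) \<and>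
     ((i = x0 \<and> e = Left \<and> (\<forall>b. x \<le> b \<and> b < j \<longrightarrow> lh x0 b \<noteq> 0)) \<or>
      (\<exists>c1. x < c1 \<and> c1 \<le> n \<and> lh x0 c1 = 0 \<and> (\<forall>b. x \<le> b \<and> b < c1 \<longrightarrow> lh x0 b \<noteq> 0)))"
  using assms(3) h assms(4)
proof (induction rule: centers_induct)
  case (start h)
  then show ?case using centers_grid[OF start(2)] by auto
next
  case (down h i j e)
  have g: "i \<in> {1..n}" "j \<in> {1..n}" using centers_grid[OF down.hyps(1)] by auto
  have "i + j \<noteq> x0 + x"
  proof
    assume "i + j = x0 + x"
    then have "i = x0 \<and> j = x \<and> e = Left" using centers_unique[OF down.hyps(1) down.prems(1)] by auto
    then show False using down.hyps(2) cx by (auto simp: co_down_def cocross_def cocrossing_def)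
  qed
  then have gt: "x0 + x < i + j" using down.prems(2) by simp
  note IH = down.IH[OF down.prems(1) gt]
  have lv: "lv i j = 0" by (rule goes_cell(1)[OF g down.hyps(2)])
  show ?case
  proof (cases "e = Left")
    case True
    then have j: "lh i (j - 1) \<noteq> 0" "lh i j = 0" using down.hyps(2) by (auto simp: co_down_def)
    have 1: "\<exists>r. x0 \<le> r \<and> r < Suc i \<and> lh r (j - 1) \<noteq> 0 \<and> lh r j = 0 \<and> (\<forall>i'. r \<le> i' \<and> i' < Suc i \<longrightarrow> lv i' j = 0)"
      using IH j lv by (intro exI[of _ i]) (auto simp: less_Suc_eq)
    have 2: "\<exists>c1. x < c1 \<and> c1 \<le> n \<and> lh x0 c1 = 0 \<and> (\<forall>b. x \<le> b \<and> b < c1 \<longrightarrow> lh x0 b \<noteq> 0)"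
      using IH
    proof (elim conjE disjE)
      assume "i = x0" "\<forall>b. x \<le> b \<and> b < j \<longrightarrow> lh x0 b \<noteq> 0"
      then show ?thesis using j gt g by (intro exI[of _ j]) auto
    qed blast
    show ?thesis using 1 2 IH by simp
  next
    case False
    then have eT: "e = Top" using centers_grid[OF down.hyps(1)] by simp
    then obtain r where r: "x0 \<le> r" "r < i" "lh r (j - 1) \<noteq> 0" "lh r j = 0" "\<forall>i'. r \<le> i' \<and> i' < i \<longrightarrow> lv i' j = 0"
      using IH by blast
    have 1: "\<exists>r. x0 \<le> r \<and> r < Suc i \<and> lh r (j - 1) \<noteq> 0 \<and> lh r j = 0 \<and> (\<forall>i'. r \<le> i' \<and> i' < Suc i \<longrightarrow> lv i' j = 0)"
      using r lv by (intro exI[of _ r]) (auto simp: less_Suc_eq)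
    have 2: "\<exists>c1. x < c1 \<and> c1 \<le> n \<and> lh x0 c1 = 0 \<and> (\<forall>b. x \<le> b \<and> b < c1 \<longrightarrow> lh x0 b \<noteq> 0)"
      using IH False by blast
    show ?thesis using 1 2 IH by simp
  qed
next
  case (right h i j e)
  have g: "i \<in> {1..n}" "j \<in> {1..n}" using centers_grid[OF right.hyps(1)] by auto
  show ?case
  proof (cases "i + j = x0 + x")
    case True
    then have "i = x0 \<and> j = x \<and> e = Left" using centers_unique[OF right.hyps(1) right.prems(1)] by auto
    then show ?thesis using cx by (auto simp: cocross_def cocrossing_def less_Suc_eq_le le_antisym)
  next
    case False
    then have gt: "x0 + x < i + j" using right.prems(2) by simp
    note IH = right.IH[OF right.prems(1) gt]
    have lh: "lh i j \<noteq> 0" by (rule goes_cell(2)[OF g right.hyps(2)])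
    show ?thesis
    proof (cases "i = x0 \<and> e = Left \<and> (\<forall>b. x \<le> b \<and> b < j \<longrightarrow> lh x0 b \<noteq> 0)")
      case True then show ?thesis using lh IH by (auto simp: less_Suc_eq)
    next
      case False then show ?thesis using IH by blast
    qed
  qed
qed

text \<open>The lower co-pipe crosses each line through an empty column, and it never goes left.\<close>

lemma lower_trace:
  assumes v: "centers v x0 x Top" and cx: "cocross x0 x"
    and "centers v i j e" "x0 + x < i + j"
  shows "x \<le> j \<and> (\<forall>r. x0 \<le> r \<and> r < i \<longrightarrow> (\<exists>q. x \<le> q \<and> q \<le> j \<and> lv r q = 0))"
  using assms(3) v assms(4)
proof (induction rule: centers_induct)
  case (start v)
  then show ?case using centers_grid[OF start(2)] by auto
next
  case (down v i j e)
  have g: "i \<in> {1..n}" "j \<in> {1..n}" using centers_grid[OF down.hyps(1)] by auto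
  have lv: "lv i j = 0" by (rule goes_cell(1)[OF g down.hyps(2)])
  show ?case
  proof (cases "i + j = x0 + x")
    case True
    then have "i = x0 \<and> j = x" using centers_unique[OF down.hyps(1) down.prems(1)] by auto
    then show ?thesis using lv by (auto simp: less_Suc_eq_le le_antisym)
  next
    case False
    then have "x0 + x < i + j" using down.prems(2) by simp
    then show ?thesis using down.IH[OF down.prems(1)] lv by (auto simp: less_Suc_eq)
  qed
next
  case (right v i j e)
  have "i + j \<noteq> x0 + x"
  proof
    assume "i + j = x0 + x"
    then have "i = x0 \<and> j = x \<and> e = Top" using centers_unique[OF right.hyps(1) right.prems(1)] by auto
    then show False using right.hyps(2) cx by (auto simp: co_right_def cocross_def cocrossing_def)
  qed
  then have "x0 + x < i + j" using right.prems(2) by simp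
  from right.IH[OF right.prems(1) this] show ?case using le_SucI by blast
qed

end

context avoiding begin

text \<open>The next meeting after the crossing \<open>(x0, x)\<close> yields a certificate. The jay \<open>(r,
c)\<close> comes from \<open>upper_trace\<close> and the column \<open>q\<close> from
\<open>lower_trace\<close>. The small label is the one that the end of the run through \<open>(x0,
x)\<close> sends up: labels decrease along a run, and at \<open>(x0, x)\<close> the carried label is
already smaller than \<open>x\<close>.\<close>

lemma no_double_cocrossing:
  assumes full: "full n lv lh"
    and h: "enters n (co (tiling_of n lv lh)) Top h x0 x Left" and v: "enters n (co (tiling_of n lv lh)) Top v x0 x Top"
    and later: "x0 + x < i1 + j1" "passes n (co (tiling_of n lv lh)) Top h i1 j1" "passes n (co (tiling_of n lv lh)) Top v i1 j1"
  shows False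
proof -
  interpret F: full n lv lh by fact
  have cx: "F.cocross x0 x" by (rule F.cocrossI[OF h v])
  define Q where "Q s \<longleftrightarrow> x0 + x < s \<and> (\<exists>i j. i + j = s \<and> passes n (co F.B) Top h i j \<and> passes n (co F.B) Top v i j)" for s
  define s where "s = (LEAST s. Q s)"
  have "Q (i1 + j1)" using later unfolding Q_def by blast
  then have "Q s" unfolding s_def by (rule LeastI)
  then obtain y1 c where yc: "x0 + x < y1 + c" "y1 + c = s" "passes n (co F.B) Top h y1 c" "passes n (co F.B) Top v y1 c"
    unfolding Q_def by blast
  have first: "\<not> (passes n (co F.B) Top h i j \<and> passes n (co F.B) Top v i j)" if "x0 + x < i + j" "i + j < y1 + c" for i j
  proof
    assume "passes n (co F.B) Top h i j \<and> passes n (co F.B) Top v i j"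
    then have "Q (i + j)" using that(1) unfolding Q_def by blast
    moreover have "i + j < (LEAST s. Q s)" using that(2) yc(2) unfolding s_def by simp
    ultimately show False using not_less_Least by blast
  qed
  obtain e e' where e: "F.centers h y1 c e" "F.centers v y1 c e'" using yc unfolding passes_def by blast
  have ee: "e = Top" "e' = Left" using F.not_above[OF h v yc(1) refl e first] by auto
  have cy: "F.cocross y1 c" using F.cocrossI e ee by blast
  from F.upper_trace[OF h cx e(1) yc(1)] ee obtain r c1 where
    r: "x0 \<le> r" "r < y1" "lh r (c - 1) \<noteq> 0" "lh r c = 0" "\<forall>i'. r \<le> i' \<and> i' < y1 \<longrightarrow> lv i' c = 0"
    and c1: "x < c1" "c1 \<le> n" "lh x0 c1 = 0" "\<forall>b. x \<le> b \<and> b < c1 \<longrightarrow> lh x0 b \<noteq> 0"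
    by auto
  obtain f where f: "F.centers v y1 (c - 1) f" "1 \<le> c"
    using F.centers_cases[OF e(2)] ee by auto
  have "y1 + (c - 1) \<noteq> x0 + x"
  proof
    assume "y1 + (c - 1) = x0 + x"
    then have "y1 = x0" using F.centers_unique[OF f(1) v] by auto
    then show False using r by simp
  qed
  then have "x0 + x < y1 + (c - 1)" using yc(1) by simp
  from F.lower_trace[OF v cx f(1) this] r obtain q where q: "x \<le> q" "q \<le> c - 1" "lv r q = 0" by blast
  have gx: "1 \<le> x0" "x0 \<le> n" "1 \<le> x" "x \<le> n" using cx by (auto simp: F.cocross_def cocrossing_def)
  have gy: "1 \<le> y1" "y1 \<le> n" "1 \<le> c" "c \<le> n" "lh y1 c \<noteq> 0" "lv y1 c = 0" using cy by (auto simp: F.cocross_def cocrossing_def)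
  define e0 where "e0 = lh x0 (c1 - 1)"
  have c1m: "x \<le> c1 - 1" "c1 - 1 < c1" using c1 by auto
  have e00: "e0 \<noteq> 0" unfolding e0_def using c1(4) c1m by blast
  have jx: "jay x0 c1" using c1 gx e00 by (auto simp: jay_def e0_def)
  have "e0 \<le> lh x0 x" unfolding e0_def
    by (rule carry_decreasing[OF gx(1,2) c1m(1)]) (use c1 in auto)
  moreover have "lh x0 x \<le> x" by (rule carried_label_le[OF gx(1,2) refl _ gx(4)]) (use cx in \<open>auto simp: F.cocross_def cocrossing_def\<close>)
  moreover have "lh x0 x \<noteq> x"
  proof
    assume eq: "lh x0 x = x"
    have xz: "x \<noteq> 0" using gx by simp
    from came_right[OF gx(1,2) eq xz gx(4)] have "lv x0 x = x \<or> lh x0 (x - 1) = x" by blast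
    moreover have "lv x0 x = 0" using cx by (auto simp: F.cocross_def cocrossing_def)
    ultimately have "lh x0 (x - 1) = x" using xz by auto
    moreover have "x \<le> x - 1" by (rule carried_label_le[OF gx(1,2) calculation xz]) (use gx in auto)
    ultimately show False using gx by simp
  qed
  ultimately have e0x: "e0 < x" by simp
  have "lv (x0 - 1) c1 = e0" using jayD(2)[OF jx] by (simp add: e0_def)
  moreover have "x0 - 1 \<le> n" using gx by simp
  ultimately have le: "e0 \<in> {1..n}" "row_of e0 \<le> x0 - 1" using label_at(1,2)[OF _ e00] by blast+
  have ra: "row_of e0 \<in> {1..n}" "w (row_of e0) = e0" using row_of_in w_row_of le by auto
  define y where "y = (LEAST i. r < i \<and> lh i c \<noteq> 0)"
  have ex: "r < y1 \<and> lh y1 c \<noteq> 0" using r gy by simp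
  have y: "r < y" "lh y c \<noteq> 0" "y \<le> y1"
    using LeastI[of "\<lambda>i. r < i \<and> lh i c \<noteq> 0", OF ex] Least_le[of "\<lambda>i. r < i \<and> lh i c \<noteq> 0", OF ex]
    unfolding y_def by auto
  have np: "lh i c = 0" if "r < i" "i < y" for i
    using not_less_Least[of i "\<lambda>i. r < i \<and> lh i c \<noteq> 0"] that unfolding y_def by blast
  have ch: "lv i c = 0" if "r \<le> i" "i \<le> y" for i
    using r(5) gy(6) that y(3) by (cases "i = y1") auto
  have "certificate n w lv lh (row_of e0) r y q c"
    by unfold_locales (use ra le r gx gy y np ch q e0x in auto)
  then show False by (rule certificate.no_certificate)
qed

lemma co_reduced:
  assumes full: "full n lv lh"
  shows "co_reduced n (co (tiling_of n lv lh))"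
  unfolding co_reduced_def
proof (intro allI impI)
  interpret F: full n lv lh by fact
  fix p q i j i' j'
  assume A: "cross_at n (co F.B) Top p q i j \<and> cross_at n (co F.B) Top p q i' j'"
  have main: False if pq: "p \<noteq> q" "passes n (co F.B) Top p i j" "passes n (co F.B) Top q i j"
    "passes n (co F.B) Top p i' j'" "passes n (co F.B) Top q i' j'" "i + j < i' + j'" for i j i' j'
  proof -
    obtain e f where e: "F.centers p i j e" "F.centers q i j f" using pq unfolding passes_def by blast
    have "e \<noteq> f" using F.centers_same_pipe[of p i j e q] e pq(1) by blast
    then have "e = Left \<and> f = Top \<or> e = Top \<and> f = Left"
      using F.centers_grid[OF e(1)] F.centers_grid[OF e(2)] by auto
    then show False
      using no_double_cocrossing[OF full, of p i j q i' j'] no_double_cocrossing[OF full, of q i j p i' j'] e pq by auto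
  qed
  have B: "p \<noteq> q" "passes n (co F.B) Top p i j" "passes n (co F.B) Top q i j"
    "passes n (co F.B) Top p i' j'" "passes n (co F.B) Top q i' j'" using A unfolding cross_at_def by auto
  show "(i, j) = (i', j')"
  proof (cases "i + j" "i' + j'" rule: linorder_cases)
    case less then show ?thesis using main[OF B] by simp
  next
    case greater then show ?thesis using main[of i' j' i j] B by simp
  next
    case equal
    obtain e f where "F.centers p i j e" "F.centers p i' j' f" using B unfolding passes_def by blast
    then show ?thesis using F.centers_unique[of p i j e i' j' f] equal by simp
  qed
qed

end

section \<open>Adding a row to a diagram\<close>

text \<open>The rows \<open>1..i\<close> can exit with these labels in a diagram with \<open>N\<close> columns.\<close>

definition admissible :: "nat \<Rightarrow> (nat \<Rightarrow> nat) \<Rightarrow> nat \<Rightarrow> bool" where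
  "admissible N w i \<longleftrightarrow> inj_on w {1..i} \<and> w ` {1..i} \<subseteq> {1..N}"

text \<open>The label \<open>w b\<close> can be carried from its own column to column \<open>d\<close> in row
\<open>i\<close>: column \<open>d\<close> is free, the pipe that exits in row \<open>i\<close> stays
to the right of it, and the last condition lets \<open>w b\<close> replace the label
\<open>d\<close> above without changing the outcome of any comparison.\<close>

definition droop :: "(nat \<Rightarrow> nat) \<Rightarrow> nat \<Rightarrow> nat \<Rightarrow> nat \<Rightarrow> bool" where
  "droop w b i d \<longleftrightarrow> 1 \<le> b \<and> b < i \<and> w b < d \<and> d < w i \<and> d \<notin> w ` {1..i} \<and>
     (\<forall>k. b < k \<and> k < i \<longrightarrow> \<not> (w b < w k \<and> w k < d))"

lemma admissible_ne: "\<lbrakk>admissible N w i; 1 \<le> k; k \<le> i; 1 \<le> l; l \<le> i; k \<noteq> l\<rbrakk> \<Longrightarrow> w k \<noteq> w l"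
  unfolding admissible_def using inj_on_eq_iff[of w "{1..i}" k l] by simp

lemma admissible_label: "\<lbrakk>admissible N w i; 1 \<le> k; k \<le> i\<rbrakk> \<Longrightarrow> 1 \<le> w k \<and> w k \<le> N"
  unfolding admissible_def using image_subset_iff[of w "{1..i}" "{1..N}"] by simp

lemma admissible_mono: "\<lbrakk>admissible N w i; i' \<le> i\<rbrakk> \<Longrightarrow> admissible N w i'"
  unfolding admissible_def using inj_on_subset[of w "{1..i}" "{1..i'}"] image_mono[of "{1..i'}" "{1..i}" w] by auto

lemma admissible_last:
  assumes "admissible N w i" "1 \<le> i" shows "w i \<notin> w ` {1..i - 1}"
proof
  assume "w i \<in> w ` {1..i - 1}"
  then obtain k where k: "w i = w k" "1 \<le> k" "k \<le> i - 1" by auto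
  then have "k \<le> i" "i \<noteq> k" using assms(2) by auto
  then show False using admissible_ne[OF assms(1,2) order_refl k(2)] k(1) by blast
qed

lemma image_last:
  assumes "1 \<le> (i::nat)" shows "w ` {1..i} = insert (w i) (w ` {1..i - 1})"
proof -
  have "{1..i} = insert i {1..i - 1}" using assms by auto
  then show ?thesis by simp
qed

lemma droop_ne: "\<lbrakk>droop w b i d; 1 \<le> k; k \<le> i\<rbrakk> \<Longrightarrow> w k \<noteq> d"
proof -
  assume A: "droop w b i d" "1 \<le> k" "k \<le> i"
  then have "w k \<in> w ` {1..i}" "d \<notin> w ` {1..i}" by (auto simp: droop_def)
  then show "w k \<noteq> d" by blast
qed

lemma droop_notin:
  assumes "x \<notin> w ` {1..i}" "x \<noteq> d"
  shows "x \<notin> (w(b := d)) ` {1..i}"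
  using assms by auto

lemma droop_source_notin:
  assumes "admissible N w i" "droop w b i' d" "b \<le> i"
  shows "w b \<notin> (w(b := d)) ` {1..i}"
proof
  assume "w b \<in> (w(b := d)) ` {1..i}"
  then obtain k where k: "1 \<le> k" "k \<le> i" "w b = (w(b := d)) k" by auto
  show False
  proof (cases "k = b")
    case True then show False using k assms(2) by (simp add: droop_def)
  next
    case False
    have "1 \<le> b" using assms(2) by (simp add: droop_def)
    then have "w k \<noteq> w b" using admissible_ne[OF assms(1)] k False assms(3) by auto
    then show False using k False by simp
  qed
qed

lemma droop_admissible:
  assumes "admissible N w i" "droop w b i d" "i' < i"
  shows "admissible N (w(b := d)) i'"
proof -
  have d: "1 \<le> d \<and> d \<le> N"
    using assms(2) admissible_label[OF assms(1), of i] by (auto simp: droop_def)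
  have "(w(b := d)) k = (w(b := d)) l \<longrightarrow> k = l" if "1 \<le> k" "k \<le> i'" "1 \<le> l" "l \<le> i'" for k l
    using that assms(3) droop_ne[OF assms(2), of k] droop_ne[OF assms(2), of l] admissible_ne[OF assms(1), of k l] by auto
  then have inj: "inj_on (w(b := d)) {1..i'}" unfolding inj_on_def by auto
  have "(w(b := d)) k \<in> {1..N}" if "1 \<le> k" "k \<le> i'" for k
    using that assms(3) d admissible_label[OF assms(1), of k] by auto
  then have "(w(b := d)) ` {1..i'} \<subseteq> {1..N}" unfolding image_subset_iff using atLeastAtMost_iff by blast
  then show ?thesis unfolding admissible_def using inj by blast
qed

lemma empty_labelling: "labelling N 0 w (\<lambda>_ _. 0) (\<lambda>_ _. 0)"
  by unfold_locales auto

definition home :: "(nat \<Rightarrow> nat) \<Rightarrow> nat \<Rightarrow> nat \<Rightarrow> nat" where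
  "home w i j = (if j \<in> w ` {1..i} then j else 0)"

definition add_row :: "nat \<Rightarrow> (nat \<Rightarrow> nat) \<Rightarrow> (nat \<Rightarrow> nat \<Rightarrow> nat) \<Rightarrow> nat \<Rightarrow> nat \<Rightarrow> nat" where
  "add_row i f l = (\<lambda>k. if k = i then f else l k)"

text \<open>The pipe that exits in row \<open>i\<close> comes up its own column and turns right; all other
columns are passed on.\<close>

lemma straight_row:
  assumes L: "labelling N (i - 1) w lv lh" and i: "1 \<le> i" and w: "admissible N w i"
  shows "labelling N i w (add_row i (home w i) lv) (add_row i (\<lambda>j. if w i \<le> j then w i else 0) lh)"
    (is "labelling N i w ?lv ?lh")
proof -
  interpret L: labelling N "i - 1" w lv lh by fact
  note im = image_last[OF i, of w]
  note wi = admissible_last[OF w i]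
  have wN: "1 \<le> w i" "w i \<le> N" using admissible_label[OF w, of i] i by auto
  have inN: "x \<in> {1..N}" if "x \<in> w ` {1..i}" for x using w that unfolding admissible_def by blast
  show ?thesis
  proof
    fix k j assume kj: "1 \<le> k" "k \<le> i" "1 \<le> j" "j \<le> N"
    show "cell (?lh k (j - 1)) (?lv k j) (?lh k j) (?lv (k - 1) j)"
    proof (cases "k = i")
      case False
      then show ?thesis using L.cells[of k j] kj by (auto simp: add_row_def)
    next
      case True
      have "?lv (k - 1) j = home w (i - 1) j"
        using True i L.bottom[of j] by (auto simp: add_row_def home_def)
      moreover have "cell (if w i \<le> j - 1 then w i else 0) (home w i j) (if w i \<le> j then w i else 0) (home w (i - 1) j)"
      proof (cases "j = w i")
        case True then show ?thesis using wi wN im by (auto simp: cell_def home_def)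
      next
        case False
        then have "home w i j = home w (i - 1) j" using im by (auto simp: home_def)
        moreover have "home w (i - 1) j = 0 \<or> home w (i - 1) j = j" by (auto simp: home_def)
        ultimately show ?thesis using False kj wN
          by (cases "w i < j") (auto simp: cell_def)
      qed
      ultimately show ?thesis using True by (simp add: add_row_def)
    qed
  next
    fix k assume "1 \<le> k" "k \<le> i"
    then show "?lh k 0 = 0" using L.left_empty[of k] wN by (auto simp: add_row_def)
  next
    fix j show "?lv 0 j = 0" using i L.top_empty by (simp add: add_row_def)
  next
    fix k j assume "k \<le> i" "j = 0 \<or> N < j"
    then show "?lv k j = 0" using L.outside[of k j] inN[of j] by (auto simp: add_row_def home_def)
  next
    fix j show "?lv i j = (if j \<in> w ` {1..i} then j else 0)" by (simp add: add_row_def home_def)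
  next
    fix k assume "1 \<le> k" "k \<le> i"
    then show "?lh k N = w k" using L.exits[of k] wN by (auto simp: add_row_def)
  next
    show "inj_on w {1..i}" "w ` {1..i} \<subseteq> {1..N}" using w by (auto simp: admissible_def)
  qed
qed

text \<open>The label that exits higher up is smaller here, so by \<open>inverted_rows\<close> the two are never
inverted. A meeting, however, needs them inverted on the line below it, or inverts them on the line
above it unless the smaller one exits right there, which is too low.\<close>

lemma (in labelling) never_meet:
  assumes kj: "1 \<le> k" "k \<le> m" "1 \<le> j" "j \<le> N"
    and x: "1 \<le> r" "r < b" "b \<le> m" "w r < w b"
  shows "{lh k (j - 1), lv k j} \<noteq> {w r, w b}"
proof
  assume A: "{lh k (j - 1), lv k j} = {w r, w b}"
  have n0: "w r \<noteq> 0" "w b \<noteq> 0" using exit_nonzero[of r] exit_nonzero[of b] x by auto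
  have jN: "j - 1 \<le> N" using kj by simp
  from A x(4) consider "lh k (j - 1) = w r" "lv k j = w b" | "lh k (j - 1) = w b" "lv k j = w r"
    by (auto simp: doubleton_eq_iff)
  then show False
  proof cases
    case 1
    have "lh k j = min (w r) (w b) \<and> lv (k - 1) j = max (w r) (w b)"
      using cell_cross[OF cells[OF kj]] n0 unfolding 1 by blast
    then have rt: "lh k j = w r" "lv (k - 1) j = w b" using x(4) by auto
    have km: "k - 1 \<le> m" using kj by simp
    obtain k' where k': "1 \<le> k'" "k' \<le> k - 1" "w b = w k'" using label_row[OF km] rt(2) n0(2) by metis
    have "b = k'" by (rule exit_inj[OF k'(3)]) (use x k' kj in auto)
    then have bk: "b \<le> k - 1" using k' by simp
    from carry_forward[OF kj(1,2) rt(1) n0(1) kj(4)] consider "lh k N = w r" | p where "j < p" "lv (k - 1) p = w r"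
      using kj(4) by blast
    then show False
    proof cases
      case 1
      then have "w k = w r" using exits[OF kj(1,2)] by simp
      then have "k = r" by (rule exit_inj) (use x kj in auto)
      then show False using bk x by simp
    next
      case (2 p)
      have "b < r" by (rule inverted_rows[OF km rt(2) 2(2,1) x(4)]) (use x bk in auto)
      then show False using x by simp
    qed
  next
    case 2
    obtain p where p: "p \<le> j - 1" "lv k p = w b" using carry_back[OF kj(1,2) 2(1) n0(2) jN] by blast
    obtain k' where k': "1 \<le> k'" "k' \<le> k" "w b = w k'" using label_row[OF kj(2), of p] p n0 by auto
    have "b = k'" by (rule exit_inj[OF k'(3)]) (use x k' kj in auto)
    then have bk: "b \<le> k" using k' by simp
    have "p < j" using p kj by simp
    have "b < r" by (rule inverted_rows[OF kj(2) p(2) 2(2) \<open>p < j\<close> x(4)]) (use x bk in auto)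
    then show False using x by simp
  qed
qed

definition relabel :: "nat \<Rightarrow> nat \<Rightarrow> (nat \<Rightarrow> nat \<Rightarrow> nat) \<Rightarrow> nat \<Rightarrow> nat \<Rightarrow> nat" where
  "relabel d e l = (\<lambda>k j. if l k j = d then e else l k j)"

text \<open>Lowering a label from \<open>d\<close> to \<open>e\<close> keeps the local rule unless the label
meets one that lies in between.\<close>

lemma relabel_cell:
  assumes "cell a b r t" "e \<noteq> 0" "d \<noteq> 0" "e < d"
    and "\<And>x. {a, b} = {x, d} \<Longrightarrow> x < d \<Longrightarrow> x < e" "a \<noteq> b \<or> a = 0"
  shows "cell (if a = d then e else a) (if b = d then e else b) (if r = d then e else r) (if t = d then e else t)"
proof (cases "a \<noteq> 0 \<and> b \<noteq> 0")
  case False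
  then consider "a = 0" "r = b" "t = 0" | "a = 0" "r = 0" "t = b" | "b = 0" "r = a" "t = 0" | "b = 0" "r = 0" "t = a"
    using assms(1) unfolding cell_def by (metis add_0 add.right_neutral)
  then show ?thesis using assms(2,3) by cases (simp_all add: cell_def)
next
  case True
  then have rt: "r = min a b" "t = max a b" using cell_cross[OF assms(1)] by auto
  have lift: "cell x y (min x y) (max x y)" if "x \<noteq> 0" "y \<noteq> 0" for x y
    using that by (simp add: cell_def)
  have ab: "a \<noteq> b" using assms(6) True by blast
  consider "a = d" "b \<noteq> d" | "b = d" "a \<noteq> d" | "a \<noteq> d" "b \<noteq> d" using ab by blast
  then show ?thesis
  proof cases
    case 1
    have "b < e \<or> d < b" using assms(5)[of b] 1 by (auto simp: insert_commute)
    then have "(if r = d then e else r) = min e b \<and> (if t = d then e else t) = max e b"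
      unfolding rt using 1 assms(4) by (auto simp: min_def max_def)
    then show ?thesis using lift[of e b] 1 True assms(2) by simp
  next
    case 2
    have "a < e \<or> d < a" using assms(5)[of a] 2 by auto
    then have "(if r = d then e else r) = min a e \<and> (if t = d then e else t) = max a e"
      unfolding rt using 2 assms(4) by (auto simp: min_def max_def)
    then show ?thesis using lift[of a e] 2 True assms(2) by simp
  next
    case 3
    then have "r \<noteq> d" "t \<noteq> d" unfolding rt by (auto simp: min_def max_def)
    then show ?thesis using 3 assms(1) by simp
  qed
qed

lemma droop_cell:
  assumes "1 \<le> e" "e < d" "d < x" "1 \<le> j" and P: "j = e \<Longrightarrow> P" "j = d \<Longrightarrow> \<not> P" "j = x \<Longrightarrow> \<not> P"
  shows "cell (if e \<le> j - 1 \<and> j - 1 < d then e else if x \<le> j - 1 then x else 0)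
    (if j = x \<or> P then j else 0) (if e \<le> j \<and> j < d then e else if x \<le> j then x else 0)
    (if j = d then e else if P \<and> j \<noteq> e then j else 0)"
proof -
  obtain k where k: "j = Suc k" using assms(4) by (cases j) auto
  consider "j < e" | "j = e" | "e < j" "j < d" | "j = d" | "d < j" "j < x" | "j = x" | "x < j" by linarith
  then show ?thesis
  proof cases
    case 2 then show ?thesis using assms(1-3) P(1) k by (simp add: cell_def)
  next
    case 4 then show ?thesis using assms(1-3) P(2) k by (simp add: cell_def)
  next
    case 6
    then have "\<not> x \<le> x - 1" "\<not> x - 1 < d" using assms(3) by auto
    then show ?thesis using 6 assms(1-3) P(3) by (simp add: cell_def)
  qed (use assms(1-3) k in \<open>simp_all add: cell_def\<close>)
qed

text \<open>In the diagram above row \<open>i\<close> the label \<open>d\<close> exits in row \<open>b\<close>.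
It meets no smaller label that exits above row \<open>b\<close> (\<open>never_meet\<close>), and the
smaller labels of the rows between \<open>b\<close> and \<open>i\<close> are below \<open>w
b\<close>, so it can be renamed to \<open>w b\<close>. Row \<open>i\<close> then takes \<open>w
b\<close> from its own column to column \<open>d\<close>, and turns \<open>w i\<close> further
right.\<close>

lemma droop_row:
  assumes L: "labelling N (i - 1) (w(b := d)) lv lh" and w: "admissible N w i" and dr: "droop w b i d"
  shows "labelling N i w (add_row i (home w i) (relabel d (w b) lv))
    (add_row i (\<lambda>j. if w b \<le> j \<and> j < d then w b else if w i \<le> j then w i else 0) (relabel d (w b) lh))"
    (is "labelling N i w ?lv ?lh")
proof -
  let ?w = "w(b := d)" and ?e = "w b"
  interpret L: labelling N "i - 1" ?w lv lh by fact
  have b: "1 \<le> b" "b < i" "?e < d" "d < w i" using dr by (auto simp: droop_def)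
  have i: "1 \<le> i" using b by simp
  note im = image_last[OF i, of w]
  have dn: "d \<notin> w ` {1..i}" using dr by (simp add: droop_def)
  note wi = admissible_last[OF w i]
  have wN: "1 \<le> w i" "w i \<le> N" "1 \<le> ?e" using admissible_label[OF w, of i] admissible_label[OF w, of b] i b by auto
  have inN: "x \<in> {1..N}" if "x \<in> w ` {1..i}" for x using w that unfolding admissible_def by blast
  have eb: "?e \<in> w ` {1..i - 1}" using b by auto
  have im1: "?w ` {1..i - 1} = insert d (w ` {1..i - 1} - {?e})"
  proof (intro set_eqI iffI)
    fix x assume "x \<in> ?w ` {1..i - 1}"
    then obtain k where k: "1 \<le> k" "k \<le> i - 1" "x = ?w k" by auto
    then show "x \<in> insert d (w ` {1..i - 1} - {?e})"
      using admissible_ne[OF w, of k b] b by (cases "k = b") auto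
  next
    fix x assume "x \<in> insert d (w ` {1..i - 1} - {?e})"
    then have "x = d \<or> (\<exists>k. 1 \<le> k \<and> k \<le> i - 1 \<and> x = w k \<and> k \<noteq> b)"
      unfolding insert_iff Diff_iff image_iff Bex_def atLeastAtMost_iff by blast
    then consider "x = d" | k where "1 \<le> k" "k \<le> i - 1" "x = w k" "k \<noteq> b" by blast
    then show "x \<in> ?w ` {1..i - 1}"
    proof cases
      case 1 then show ?thesis using b by (intro image_eqI[of _ _ b]) auto
    next
      case 2 then show ?thesis by (intro image_eqI[of _ _ k]) auto
    qed
  qed
  have between: "x < ?e" if xx: "x < d" "x \<in> ?w ` {1..i - 1}" "\<not> (\<exists>r. 1 \<le> r \<and> r < b \<and> x = ?w r)" for x
  proof -
    obtain k where k: "1 \<le> k" "k \<le> i - 1" "x = ?w k" using xx(2) by auto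
    have kb: "k \<noteq> b" "b \<le> k" using xx k by (auto simp: not_less)
    then have "\<not> (?e < w k \<and> w k < d)" using dr k b by (auto simp: droop_def)
    moreover have "w k \<noteq> ?e" using admissible_ne[OF w, of k b] k b kb by auto
    ultimately show ?thesis using xx(1) k kb by auto
  qed
  show ?thesis
  proof
    fix k j assume kj: "1 \<le> k" "k \<le> i" "1 \<le> j" "j \<le> N"
    show "cell (?lh k (j - 1)) (?lv k j) (?lh k j) (?lv (k - 1) j)"
    proof (cases "k = i")
      case False
      then have ki: "k \<le> i - 1" "k \<noteq> i" "k - 1 \<noteq> i" using kj by auto
      have c: "cell (lh k (j - 1)) (lv k j) (lh k j) (lv (k - 1) j)" by (rule L.cells) (use kj ki in auto)
      have "cell (if lh k (j - 1) = d then ?e else lh k (j - 1)) (if lv k j = d then ?e else lv k j)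
          (if lh k j = d then ?e else lh k j) (if lv (k - 1) j = d then ?e else lv (k - 1) j)"
      proof (rule relabel_cell[OF c])
        show "?e \<noteq> 0" "d \<noteq> 0" "?e < d" using wN b by auto
        show "lh k (j - 1) \<noteq> lv k j \<or> lh k (j - 1) = 0"
          using L.cell_labels_distinct[of k j] kj ki by (cases "lv k j = 0") auto
        fix x assume A: "{lh k (j - 1), lv k j} = {x, d}" and xd: "x < d"
        have no: "\<not> (\<exists>r. 1 \<le> r \<and> r < b \<and> x = ?w r)"
        proof
          assume "\<exists>r. 1 \<le> r \<and> r < b \<and> x = ?w r"
          then obtain r where r: "1 \<le> r" "r < b" "x = ?w r" by blast
          have "{lh k (j - 1), lv k j} \<noteq> {?w r, ?w b}"
            by (rule L.never_meet) (use kj ki r b xd in auto)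
          then show False using A r by simp
        qed
        show "x < ?e"
        proof (cases "x = 0")
          case True then show ?thesis using wN by simp
        next
          case False
          have "x = lv k j \<or> x = lh k (j - 1)" using A by (auto simp: doubleton_eq_iff)
          then have "\<exists>p. lv k p = x"
          proof
            assume x: "x = lh k (j - 1)"
            have "j - 1 \<le> N" using kj by simp
            from L.carry_back[OF kj(1) ki(1) x[symmetric] False this] show ?thesis by blast
          qed blast
          then obtain p where p: "lv k p = x" by blast
          have "lv k p \<noteq> 0" using p False by simp
          from L.label_row[OF ki(1) this] obtain k' where k': "1 \<le> k'" "k' \<le> k" "x = ?w k'"
            unfolding p by blast
          have "k' \<in> {1..i - 1}" using k' ki by simp
          then have "x \<in> ?w ` {1..i - 1}" unfolding k'(3) by (rule imageI)
          then show ?thesis using between xd no by blast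
        qed
      qed
      then show ?thesis
        unfolding add_row_def relabel_def if_not_P[OF ki(2)] if_not_P[OF ki(3)] .
    next
      case True
      have t: "?lv (k - 1) j = (if j = d then ?e else if j \<in> w ` {1..i - 1} \<and> j \<noteq> ?e then j else 0)"
      proof -
        have "lv (i - 1) j = (if j \<in> ?w ` {1..i - 1} then j else 0)" by (rule L.bottom)
        then show ?thesis using True i wN b unfolding im1 by (auto simp: add_row_def relabel_def)
      qed
      have v: "?lv k j = (if j = w i \<or> j \<in> w ` {1..i - 1} then j else 0)"
        using True im by (auto simp: add_row_def home_def)
      have h: "?lh k j = (if ?e \<le> j \<and> j < d then ?e else if w i \<le> j then w i else 0)" for j
        using True by (simp add: add_row_def)
      have dn': "d \<notin> w ` {1..i - 1}" "d \<noteq> w i" using dn im by auto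
      show ?thesis unfolding t v h
      proof (rule droop_cell)
        show "j = w i \<Longrightarrow> j \<notin> w ` {1..i - 1}" using wi by (simp only: not_False_eq_True)
        show "j = w b \<Longrightarrow> j \<in> w ` {1..i - 1}" using eb by (simp only:)
        show "j = d \<Longrightarrow> j \<notin> w ` {1..i - 1}" using dn' by (simp only: not_False_eq_True)
      qed (use wN b kj in blast)+
    qed
  next
    fix k assume k: "1 \<le> k" "k \<le> i"
    show "?lh k 0 = 0"
    proof (cases "k = i")
      case True then show ?thesis using wN by (simp add: add_row_def)
    next
      case False
      then have "lh k 0 = 0" using L.left_empty k by simp
      then show ?thesis using False b by (simp add: add_row_def relabel_def)
    qed
  next
    fix j
    have "relabel d ?e lv 0 j = 0" using L.top_empty[of j] b unfolding relabel_def by simp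
    then show "?lv 0 j = 0" using i by (simp add: add_row_def)
  next
    fix k j assume kj: "k \<le> i" "j = 0 \<or> N < j"
    show "?lv k j = 0"
    proof (cases "k = i")
      case True
      then show ?thesis using inN[of j] kj by (auto simp: add_row_def home_def)
    next
      case False
      then have "lv k j = 0" using L.outside[of k j] kj by simp
      then show ?thesis using False b by (simp add: add_row_def relabel_def)
    qed
  next
    fix j show "?lv i j = (if j \<in> w ` {1..i} then j else 0)" by (simp add: add_row_def home_def)
  next
    fix k assume k: "1 \<le> k" "k \<le> i"
    show "?lh k N = w k"
    proof (cases "k = i")
      case True then show ?thesis using wN b by (simp add: add_row_def)
    next
      case False
      then have "lh k N = ?w k" using L.exits[of k] k by simp
      moreover have "w k \<noteq> d" using droop_ne[OF dr] k by simp
      ultimately show ?thesis using False by (simp add: add_row_def relabel_def)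
    qed
  next
    show "inj_on w {1..i}" "w ` {1..i} \<subseteq> {1..N}" using w by (auto simp: admissible_def)
  qed
qed

section \<open>Co-pipes in diagrams with fewer rows\<close>

text \<open>A piece of a co-pipe from \<open>s\<close> on in a diagram with \<open>m\<close> rows; it may end
just below the last row.\<close>

inductive copath :: "nat \<Rightarrow> (nat \<Rightarrow> nat \<Rightarrow> nat) \<Rightarrow> (nat \<Rightarrow> nat \<Rightarrow> nat) \<Rightarrow> nat \<times> nat \<times> edge \<Rightarrow> nat \<times> nat \<times> edge \<Rightarrow> bool"
  for m lv lh s where
  start: "copath m lv lh s s"
| down: "\<lbrakk>copath m lv lh s (i, j, e); i \<le> m; co_down lv lh i j e\<rbrakk> \<Longrightarrow> copath m lv lh s (Suc i, j, Top)"
| right: "\<lbrakk>copath m lv lh s (i, j, e); i \<le> m; co_right lv lh i j e\<rbrakk> \<Longrightarrow> copath m lv lh s (i, Suc j, Left)"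

text \<open>Co-pipes depend only on which edges are empty, so this says that they agree above row
\<open>i\<close>.\<close>

definition same_shape :: "nat \<Rightarrow> (nat \<Rightarrow> nat \<Rightarrow> nat) \<Rightarrow> (nat \<Rightarrow> nat \<Rightarrow> nat) \<Rightarrow> bool" where
  "same_shape i l l' \<longleftrightarrow> (\<forall>k j. k < i \<longrightarrow> (l' k j = 0 \<longleftrightarrow> l k j = 0))"

lemma copath_trans:
  assumes "copath m lv lh t u" "copath m lv lh s t" shows "copath m lv lh s u"
  using assms by (induction rule: copath.induct) (auto intro: copath.intros)

lemma copath_extend:
  assumes "copath m lv lh s t" "same_shape (Suc m) lv lv'" "same_shape (Suc m) lh lh'" "m \<le> m'"
  shows "copath m' lv' lh' s t"
  using assms(1)
proof (induction rule: copath.induct)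
  case start show ?case by (rule copath.start)
next
  case (down i j e)
  have "co_down lv' lh' i j e" using down(2,3) assms(2,3) unfolding co_down_def same_shape_def by simp
  then show ?case using down assms(4) by (intro copath.down) auto
next
  case (right i j e)
  have "co_right lv' lh' i j e" using right(2,3) assms(2,3) unfolding co_right_def same_shape_def by simp
  then show ?case using right assms(4) by (intro copath.right) auto
qed

lemma cocrossing_extend:
  assumes "cocrossing lv lh i j" "same_shape (Suc m) lv lv'" "same_shape (Suc m) lh lh'" "i \<le> m"
  shows "cocrossing lv' lh' i j"
  using assms unfolding cocrossing_def same_shape_def by simp

lemma copath_turn:
  assumes "lv (i - 1) j = 0" "lv i j \<noteq> 0" "i \<le> m" "j < c" "\<forall>k. j \<le> k \<and> k < c \<longrightarrow> lh i k \<noteq> 0"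
  shows "copath m lv lh (i, j, Top) (i, c, Left)"
  using assms(4,5)
proof (induction c)
  case 0 then show ?case by simp
next
  case (Suc c)
  show ?case
  proof (cases "j = c")
    case True
    have "co_right lv lh i j Top" using assms(1,2) unfolding co_right_def by simp
    then show ?thesis using copath.right[OF copath.start assms(3)] True by blast
  next
    case False
    then have "copath m lv lh (i, j, Top) (i, c, Left)" using Suc by simp
    moreover have "j \<le> c - 1" "c - 1 < Suc c" "j \<le> c" "c < Suc c" using Suc.prems(1) False by auto
    then have "co_right lv lh i c Left" using Suc.prems(2) unfolding co_right_def by blast
    ultimately show ?thesis using assms(3) by (intro copath.right)
  qed
qed

lemma copath_run:
  assumes "i \<le> m" "j \<le> c" "1 \<le> j" "\<forall>k. j - 1 \<le> k \<and> k < c \<longrightarrow> lh i k \<noteq> 0"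
  shows "copath m lv lh (i, j, Left) (i, c, Left)"
  using assms(2,4)
proof (induction c)
  case 0 then show ?case using assms(3) by simp
next
  case (Suc c)
  show ?case
  proof (cases "j = Suc c")
    case True then show ?thesis using copath.start by simp
  next
    case False
    then have "copath m lv lh (i, j, Left) (i, c, Left)" using Suc by simp
    moreover have "j - 1 \<le> c - 1" "c - 1 < Suc c" "j - 1 \<le> c" "c < Suc c"
      using Suc.prems(1) False by auto
    then have "co_right lv lh i c Left" using Suc.prems(2) unfolding co_right_def by blast
    ultimately show ?thesis using assms(1) by (intro copath.right)
  qed
qed

lemma copath_fall:
  assumes "lv (i - 1) j = 0" "lv i j = 0" "i \<le> m"
  shows "copath m lv lh (i, j, Top) (Suc i, j, Top)"
  using copath.down[OF copath.start assms(3)] assms unfolding co_down_def by blast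

lemma copath_bend:
  assumes "lh i (j - 1) \<noteq> 0" "lh i j = 0" "i \<le> m"
  shows "copath m lv lh (i, j, Left) (Suc i, j, Top)"
  using copath.down[OF copath.start assms(3)] assms unfolding co_down_def by blast

text \<open>Two co-pipes that cross within the first \<open>i\<close> rows come out of row \<open>i\<close> in
the columns \<open>q\<close> and \<open>c\<close>; the one in column \<open>q\<close> came into the
crossing from above, the one in column \<open>c\<close> from the left. They cross again as soon as
the first one runs to the right across column \<open>c\<close>.\<close>

definition crossed_pair :: "nat \<Rightarrow> (nat \<Rightarrow> nat \<Rightarrow> nat) \<Rightarrow> (nat \<Rightarrow> nat \<Rightarrow> nat) \<Rightarrow> nat \<Rightarrow> nat \<Rightarrow> nat \<Rightarrow> bool" where
  "crossed_pair N lv lh i q c \<longleftrightarrow> c \<le> N \<and> (\<exists>k j. 1 \<le> k \<and> k \<le> i \<and> j \<in> {1..N} \<and> cocrossing lv lh k j \<and>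
     copath i lv lh (k, j, Top) (Suc i, q, Top) \<and> copath i lv lh (k, j, Left) (Suc i, c, Top))"

definition twice_crossed :: "nat \<Rightarrow> (nat \<Rightarrow> nat \<Rightarrow> nat) \<Rightarrow> (nat \<Rightarrow> nat \<Rightarrow> nat) \<Rightarrow> nat \<Rightarrow> bool" where
  "twice_crossed N lv lh i \<longleftrightarrow> (\<exists>k j k' j'. 1 \<le> k \<and> k \<le> i \<and> j \<in> {1..N} \<and> k < k' \<and> cocrossing lv lh k j \<and>
     cocrossing lv lh k' j' \<and> k' \<le> i \<and> j' \<le> N \<and>
     copath i lv lh (k, j, Top) (k', j', Left) \<and> copath i lv lh (k, j, Left) (k', j', Top))"

lemma twice_crossed_extend:
  assumes "twice_crossed N lv lh i" "same_shape (Suc i) lv lv'" "same_shape (Suc i) lh lh'" "i \<le> i'"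
  shows "twice_crossed N lv' lh' i'"
proof -
  obtain k j k' j' where *: "1 \<le> k" "k \<le> i" "j \<in> {1..N}" "k < k'" "cocrossing lv lh k j"
     "cocrossing lv lh k' j'" "k' \<le> i" "j' \<le> N"
     "copath i lv lh (k, j, Top) (k', j', Left)" "copath i lv lh (k, j, Left) (k', j', Top)"
    using assms(1) unfolding twice_crossed_def by blast
  have "cocrossing lv' lh' k j" "cocrossing lv' lh' k' j'"
    using cocrossing_extend[OF *(5) assms(2,3) *(2)] cocrossing_extend[OF *(6) assms(2,3) *(7)] .
  moreover have "copath i' lv' lh' (k, j, Top) (k', j', Left)" "copath i' lv' lh' (k, j, Left) (k', j', Top)"
    using copath_extend[OF *(9) assms(2-4)] copath_extend[OF *(10) assms(2-4)] .
  moreover have "k \<le> i'" "k' \<le> i'" using *(2,7) assms(4) by auto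
  ultimately show ?thesis using *(1,3,4,8) unfolding twice_crossed_def by blast
qed

lemma crossed_pair_extend:
  assumes "crossed_pair N lv lh i q c" "same_shape (Suc i) lv lv'" "same_shape (Suc i) lh lh'"
    and "copath (Suc i) lv' lh' (Suc i, q, Top) (Suc (Suc i), q', Top)"
    and "copath (Suc i) lv' lh' (Suc i, c, Top) (Suc (Suc i), c', Top)" "c' \<le> N"
  shows "crossed_pair N lv' lh' (Suc i) q' c'"
proof -
  obtain k j where *: "1 \<le> k" "k \<le> i" "j \<in> {1..N}" "cocrossing lv lh k j"
     "copath i lv lh (k, j, Top) (Suc i, q, Top)" "copath i lv lh (k, j, Left) (Suc i, c, Top)"
    using assms(1) unfolding crossed_pair_def by blast
  have x: "cocrossing lv' lh' k j" by (rule cocrossing_extend[OF *(4) assms(2,3) *(2)])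
  have le: "i \<le> Suc i" by simp
  have p: "copath (Suc i) lv' lh' (k, j, Top) (Suc (Suc i), q', Top)"
    by (rule copath_trans[OF assms(4) copath_extend[OF *(5) assms(2,3) le]])
  have p': "copath (Suc i) lv' lh' (k, j, Left) (Suc (Suc i), c', Top)"
    by (rule copath_trans[OF assms(5) copath_extend[OF *(6) assms(2,3) le]])
  have "k \<le> Suc i" using *(2) by simp
  then show ?thesis using *(1,3) x p p' assms(6) unfolding crossed_pair_def by blast
qed

lemma crossed_pair_again:
  assumes "crossed_pair N lv lh i q c" "same_shape (Suc i) lv lv'" "same_shape (Suc i) lh lh'"
    and "copath (Suc i) lv' lh' (Suc i, q, Top) (Suc i, c, Left)" "cocrossing lv' lh' (Suc i) c"
  shows "twice_crossed N lv' lh' (Suc i)"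
proof -
  obtain k j where c: "c \<le> N" and *: "1 \<le> k" "k \<le> i" "j \<in> {1..N}" "cocrossing lv lh k j"
     "copath i lv lh (k, j, Top) (Suc i, q, Top)" "copath i lv lh (k, j, Left) (Suc i, c, Top)"
    using assms(1) unfolding crossed_pair_def by blast
  have x: "cocrossing lv' lh' k j" by (rule cocrossing_extend[OF *(4) assms(2,3) *(2)])
  have le: "i \<le> Suc i" by simp
  have p: "copath (Suc i) lv' lh' (k, j, Top) (Suc i, c, Left)"
    by (rule copath_trans[OF assms(4) copath_extend[OF *(5) assms(2,3) le]])
  have p': "copath (Suc i) lv' lh' (k, j, Left) (Suc i, c, Top)"
    by (rule copath_extend[OF *(6) assms(2,3) le])
  have "k \<le> Suc i" "k < Suc i" using *(2) by auto
  then show ?thesis using *(1,3) x p p' assms(5) c unfolding twice_crossed_def by blast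
qed

definition can_cross :: "nat \<Rightarrow> (nat \<Rightarrow> nat) \<Rightarrow> nat \<Rightarrow> nat \<Rightarrow> nat \<Rightarrow> bool" where
  "can_cross N w i q c \<longleftrightarrow> (\<exists>lv lh. labelling N i w lv lh \<and> crossed_pair N lv lh i q c)"

definition can_cross_twice :: "nat \<Rightarrow> (nat \<Rightarrow> nat) \<Rightarrow> nat \<Rightarrow> bool" where
  "can_cross_twice N w i \<longleftrightarrow> (\<exists>lv lh. labelling N i w lv lh \<and> twice_crossed N lv lh i)"

lemma add_row_shape: "same_shape i l (add_row i f l)"
  unfolding same_shape_def add_row_def by simp

lemma relabel_shape:
  assumes "d \<noteq> 0" "e \<noteq> 0" shows "same_shape i l (add_row i f (relabel d e l))"
  using assms unfolding same_shape_def add_row_def relabel_def by simp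

lemma labelling_exists:
  assumes "admissible N w i" shows "\<exists>lv lh. labelling N i w lv lh"
  using assms
proof (induction i)
  case 0 then show ?case using empty_labelling by blast
next
  case (Suc i)
  have "admissible N w i" using admissible_mono[OF Suc.prems] by simp
  then obtain lv lh where "labelling N (Suc i - 1) w lv lh" using Suc.IH by auto
  from straight_row[OF this _ Suc.prems] show ?case by auto
qed

lemma notin_mono: "\<lbrakk>x \<notin> w ` {1..i}; i' \<le> (i::nat)\<rbrakk> \<Longrightarrow> x \<notin> w ` {1..i'}"
  using image_mono[of "{1..i'}" "{1..i}" w] by auto

lemma straight_lines:
  assumes L: "labelling N i w lv lh" and "c \<notin> w ` {1..Suc i}"
  shows "add_row (Suc i) (home w (Suc i)) lv i c = 0" "add_row (Suc i) (home w (Suc i)) lv (Suc i) c = 0"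
proof -
  interpret L: labelling N i w lv lh by fact
  have "c \<notin> w ` {1..i}" using notin_mono[OF assms(2)] by simp
  then have "lv i c = 0" using L.bottom[of c] by simp
  then show "add_row (Suc i) (home w (Suc i)) lv i c = 0" by (simp add: add_row_def)
  show "add_row (Suc i) (home w (Suc i)) lv (Suc i) c = 0" unfolding add_row_def home_def using assms(2) by simp
qed

text \<open>A straight row lets co-pipes fall through every column that stays empty.\<close>

lemma can_cross_straight:
  assumes "can_cross N w i q c" "admissible N w (Suc i)" "q \<notin> w ` {1..Suc i}" "c \<notin> w ` {1..Suc i}"
  shows "can_cross N w (Suc i) q c"
proof -
  obtain lv lh where L: "labelling N i w lv lh" and G: "crossed_pair N lv lh i q c"
    using assms(1) unfolding can_cross_def by blast
  let ?lv = "add_row (Suc i) (home w (Suc i)) lv"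
  let ?lh = "add_row (Suc i) (\<lambda>j. if w (Suc i) \<le> j then w (Suc i) else 0) lh"
  have L': "labelling N (Suc i) w ?lv ?lh" using straight_row[of N "Suc i" w lv lh] L assms(2) by simp
  have "copath (Suc i) ?lv ?lh (Suc i, q, Top) (Suc (Suc i), q, Top)"
    "copath (Suc i) ?lv ?lh (Suc i, c, Top) (Suc (Suc i), c, Top)"
    by (rule copath_fall; use straight_lines[OF L assms(3)] straight_lines[OF L assms(4)] in simp)+
  moreover have "c \<le> N" using G unfolding crossed_pair_def by blast
  ultimately have "crossed_pair N ?lv ?lh (Suc i) q c"
    by (rule crossed_pair_extend[OF G add_row_shape add_row_shape])
  then show ?thesis using L' unfolding can_cross_def by blast
qed

lemma can_cross_descend:
  assumes "can_cross N w i q c" "admissible N w i'" "q \<notin> w ` {1..i'}" "c \<notin> w ` {1..i'}" "i \<le> i'"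
  shows "can_cross N w i' q c"
  using assms(5,2,3,4)
proof (induction i' rule: dec_induct)
  case base then show ?case using assms(1) by simp
next
  case (step m)
  have "can_cross N w m q c"
    by (rule step.IH) (use step.prems notin_mono admissible_mono in \<open>meson le_SucI order_refl\<close>)+
  then show ?case by (rule can_cross_straight) (use step.prems in blast)+
qed

lemma can_cross_twice_descend:
  assumes "can_cross_twice N w i" "admissible N w i'" "i \<le> i'"
  shows "can_cross_twice N w i'"
  using assms(3,2)
proof (induction i' rule: dec_induct)
  case base then show ?case using assms(1) by simp
next
  case (step m)
  have "can_cross_twice N w m" by (rule step.IH) (use step.prems admissible_mono in \<open>meson le_SucI order_refl\<close>)
  then obtain lv lh where L: "labelling N m w lv lh" and B: "twice_crossed N lv lh m"
    unfolding can_cross_twice_def by blast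
  have "labelling N (Suc m) w (add_row (Suc m) (home w (Suc m)) lv)
      (add_row (Suc m) (\<lambda>j. if w (Suc m) \<le> j then w (Suc m) else 0) lh)"
    using straight_row[of N "Suc m" w lv lh] L step.prems by simp
  moreover have "m \<le> Suc m" by simp
  ultimately show ?case
    using twice_crossed_extend[OF B add_row_shape add_row_shape] unfolding can_cross_twice_def by blast
qed

text \<open>When the row with exit \<open>q\<close> comes, the co-pipe in column \<open>q\<close> is sent to the
right along the exiting pipe, and it runs across column \<open>c\<close>.\<close>

lemma cross_at_exit:
  assumes "can_cross N w m q c" "admissible N w k" "c \<notin> w ` {1..k}" "m < j" "j \<le> k" "w j = q" "q < c"
  shows "can_cross_twice N w k"
proof -
  obtain i where i: "j = Suc i" "m \<le> i" using assms(4) by (cases j) auto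
  have adm: "admissible N w (Suc i)" "admissible N w i"
    using admissible_mono[OF assms(2)] assms(5) i by auto
  have qi: "q \<notin> w ` {1..i}" using admissible_last[OF adm(1)] assms(6) i by auto
  have cj: "c \<notin> w ` {1..Suc i}" using notin_mono[OF assms(3)] assms(5) i by simp
  have ci: "c \<notin> w ` {1..i}" using notin_mono[OF cj] by simp
  obtain lv lh where L: "labelling N i w lv lh" and G: "crossed_pair N lv lh i q c"
    using can_cross_descend[OF assms(1) adm(2) qi ci i(2)] unfolding can_cross_def by blast
  interpret L: labelling N i w lv lh by fact
  have q: "w (Suc i) = q" using assms(6) i by simp
  have q1: "1 \<le> q" using admissible_label[OF adm(1), of "Suc i"] q by simp
  let ?lv = "add_row (Suc i) (home w (Suc i)) lv"
  let ?lh = "add_row (Suc i) (\<lambda>j. if w (Suc i) \<le> j then w (Suc i) else 0) lh"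
  have L': "labelling N (Suc i) w ?lv ?lh" using straight_row[of N "Suc i" w lv lh] L adm(1) by simp
  have "copath (Suc i) ?lv ?lh (Suc i, q, Top) (Suc i, c, Left)"
  proof (rule copath_turn)
    show "?lv (Suc i - 1) q = 0" using L.bottom[of q] qi by (simp add: add_row_def)
    have "q \<in> w ` {1..Suc i}" using q by auto
    then show "?lv (Suc i) q \<noteq> 0" using q1 by (simp add: add_row_def home_def)
  qed (use assms(7) q q1 in \<open>auto simp: add_row_def\<close>)
  moreover have "cocrossing ?lv ?lh (Suc i) c"
    using straight_lines[OF L cj] q q1 assms(7) unfolding cocrossing_def by (simp add: add_row_def)
  ultimately have "twice_crossed N ?lv ?lh (Suc i)"
    by (rule crossed_pair_again[OF G add_row_shape add_row_shape])
  then have "can_cross_twice N w (Suc i)" using L' unfolding can_cross_twice_def by blast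
  then show ?thesis by (rule can_cross_twice_descend) (use assms i in auto)
qed

section \<open>Co-pipes and droops\<close>

lemma droop_extend:
  assumes L: "labelling N i (w(b := d)) lv lh" and w: "admissible N w (Suc i)" and dr: "droop w b (Suc i) d"
  obtains lv' lh' where "labelling N (Suc i) w lv' lh'" "same_shape (Suc i) lv lv'" "same_shape (Suc i) lh lh'"
    and "\<And>c. \<lbrakk>c \<notin> w ` {1..Suc i}; c \<noteq> d\<rbrakk> \<Longrightarrow> lv' i c = 0 \<and> lv' (Suc i) c = 0"
    and "lv' i (w b) = 0" "lv' (Suc i) (w b) \<noteq> 0" "\<And>j. \<lbrakk>w b \<le> j; j < d\<rbrakk> \<Longrightarrow> lh' (Suc i) j \<noteq> 0" "lh' (Suc i) d = 0"
proof
  interpret L: labelling N i "w(b := d)" lv lh by fact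
  let ?lv = "add_row (Suc i) (home w (Suc i)) (relabel d (w b) lv)"
  let ?lh = "add_row (Suc i) (\<lambda>j. if w b \<le> j \<and> j < d then w b else if w (Suc i) \<le> j then w (Suc i) else 0) (relabel d (w b) lh)"
  have b: "1 \<le> b" "b < Suc i" "w b < d" "d < w (Suc i)" using dr by (auto simp: droop_def)
  have e: "w b \<noteq> 0" "d \<noteq> 0" using admissible_label[OF w b(1)] b by auto
  show "labelling N (Suc i) w ?lv ?lh" using droop_row[of N "Suc i" w b d lv lh] L w dr by simp
  show "same_shape (Suc i) lv ?lv" "same_shape (Suc i) lh ?lh" using relabel_shape[OF e(2,1)] by blast+
  have z: "?lv i c = 0" if "c \<notin> (w(b := d)) ` {1..i}" for c
  proof -
    have "lv i c = 0" using L.bottom[of c] that by simp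
    then show ?thesis using e unfolding add_row_def relabel_def by simp
  qed
  show "?lv i c = 0 \<and> ?lv (Suc i) c = 0" if c: "c \<notin> w ` {1..Suc i}" "c \<noteq> d" for c
  proof -
    have "c \<notin> w ` {1..i}" using notin_mono[OF c(1)] by simp
    then have "?lv i c = 0" by (rule z[OF droop_notin]) (rule c(2))
    moreover have "?lv (Suc i) c = 0" unfolding add_row_def home_def using c(1) by simp
    ultimately show ?thesis by blast
  qed
  have le: "i \<le> Suc i" "b \<le> i" using b by auto
  show "?lv i (w b) = 0" by (rule z[OF droop_source_notin[OF admissible_mono[OF w le(1)] dr le(2)]])
  have "w b \<in> w ` {1..Suc i}" by (rule imageI) (use b in auto)
  then show "?lv (Suc i) (w b) \<noteq> 0" using e unfolding add_row_def home_def by simp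
  show "?lh (Suc i) j \<noteq> 0" if "w b \<le> j" "j < d" for j using that e by (simp add: add_row_def)
  show "?lh (Suc i) d = 0" using b by (simp add: add_row_def)
qed

lemma droop_pred:
  assumes "droop w b i d" obtains m where "i = Suc m" "b \<le> m"
  using assms by (cases i) (auto simp: droop_def)

lemma can_cross_twice_droop:
  assumes "droop w b i d" "admissible N w i" "can_cross_twice N (w(b := d)) m" "m < i"
  shows "can_cross_twice N w i"
proof -
  obtain k where k: "i = Suc k" using droop_pred[OF assms(1)] by blast
  have "admissible N (w(b := d)) k" using droop_admissible[OF assms(2,1)] k by simp
  then have "can_cross_twice N (w(b := d)) k"
    using can_cross_twice_descend[OF assms(3)] assms(4) k by simp
  then obtain lv lh where L: "labelling N k (w(b := d)) lv lh" and B: "twice_crossed N lv lh k"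
    unfolding can_cross_twice_def by blast
  obtain lv' lh' where "labelling N (Suc k) w lv' lh'" "same_shape (Suc k) lv lv'" "same_shape (Suc k) lh lh'"
    using droop_extend[OF L] assms(1,2) k by metis
  then show ?thesis using twice_crossed_extend[OF B, of lv' lh' "Suc k"] k unfolding can_cross_twice_def by auto
qed

text \<open>The co-pipe in column \<open>w b\<close> follows the drooping pipe and falls at its end, in column
\<open>d\<close>.\<close>

lemma can_cross_droop:
  assumes dr: "droop w b i d" and w: "admissible N w i" and G: "can_cross N (w(b := d)) m q (w b)" "m < i"
    and q: "q \<notin> w ` {1..i}" "q \<noteq> d"
  shows "can_cross N w i q d"
proof -
  obtain k where k: "i = Suc k" "b \<le> k" using droop_pred[OF dr] by blast
  have adm: "admissible N (w(b := d)) k" using droop_admissible[OF w dr] k by simp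
  have kk: "k \<le> i" using k by simp
  have e: "w b \<notin> (w(b := d)) ` {1..k}"
    by (rule droop_source_notin[OF admissible_mono[OF w kk] dr k(2)])
  have qk: "q \<notin> (w(b := d)) ` {1..k}" by (rule droop_notin[OF notin_mono[OF q(1) kk] q(2)])
  have "m \<le> k" using G(2) k by simp
  from can_cross_descend[OF G(1) adm qk e this] obtain lv lh where
    L: "labelling N k (w(b := d)) lv lh" and C: "crossed_pair N lv lh k q (w b)"
    unfolding can_cross_def by blast
  obtain lv' lh' where L': "labelling N (Suc k) w lv' lh'" and S: "same_shape (Suc k) lv lv'" "same_shape (Suc k) lh lh'"
    and c: "\<And>c. \<lbrakk>c \<notin> w ` {1..Suc k}; c \<noteq> d\<rbrakk> \<Longrightarrow> lv' k c = 0 \<and> lv' (Suc k) c = 0"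
    and b: "lv' k (w b) = 0" "lv' (Suc k) (w b) \<noteq> 0" "\<And>j. \<lbrakk>w b \<le> j; j < d\<rbrakk> \<Longrightarrow> lh' (Suc k) j \<noteq> 0" "lh' (Suc k) d = 0"
    using droop_extend[OF L w[unfolded k(1)] dr[unfolded k(1)]] by blast
  have ed: "w b < d" using dr by (simp add: droop_def)
  have "copath (Suc k) lv' lh' (Suc k, q, Top) (Suc (Suc k), q, Top)"
    by (rule copath_fall) (use c[of q] q k in auto)
  moreover have "copath (Suc k) lv' lh' (Suc k, w b, Top) (Suc (Suc k), d, Top)"
  proof (rule copath_trans)
    show "copath (Suc k) lv' lh' (Suc k, w b, Top) (Suc k, d, Left)"
      by (rule copath_turn) (use b ed in auto)
    have "w b \<le> d - 1" "d - 1 < d" using ed by auto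
    then have "lh' (Suc k) (d - 1) \<noteq> 0" by (rule b(3))
    then show "copath (Suc k) lv' lh' (Suc k, d, Left) (Suc (Suc k), d, Top)"
      by (rule copath_bend) (use b in auto)
  qed
  moreover have "d \<le> N"
    using dr admissible_label[OF w, of i] unfolding droop_def by linarith
  ultimately have "crossed_pair N lv' lh' (Suc k) q d" by (rule crossed_pair_extend[OF C S])
  then show ?thesis using L' k unfolding can_cross_def by blast
qed

text \<open>The co-pipe in column \<open>w b\<close> follows the drooping pipe and runs across column
\<open>c\<close>.\<close>

lemma cross_at_droop:
  assumes dr: "droop w b i d" and w: "admissible N w i" and G: "can_cross N (w(b := d)) m (w b) c" "m < i"
    and q: "c \<notin> w ` {1..i}" "w b < c" "c < d"
  shows "can_cross_twice N w i"
proof -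
  obtain k where k: "i = Suc k" "b \<le> k" using droop_pred[OF dr] by blast
  have adm: "admissible N (w(b := d)) k" using droop_admissible[OF w dr] k by simp
  have kk: "k \<le> i" using k by simp
  have e: "w b \<notin> (w(b := d)) ` {1..k}"
    by (rule droop_source_notin[OF admissible_mono[OF w kk] dr k(2)])
  have cd: "c \<noteq> d" using q by simp
  have qk: "c \<notin> (w(b := d)) ` {1..k}" by (rule droop_notin[OF notin_mono[OF q(1) kk] cd])
  have "m \<le> k" using G(2) k by simp
  from can_cross_descend[OF G(1) adm e qk this] obtain lv lh where
    L: "labelling N k (w(b := d)) lv lh" and C: "crossed_pair N lv lh k (w b) c"
    unfolding can_cross_def by blast
  obtain lv' lh' where L': "labelling N (Suc k) w lv' lh'" and S: "same_shape (Suc k) lv lv'" "same_shape (Suc k) lh lh'"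
    and c: "\<And>c. \<lbrakk>c \<notin> w ` {1..Suc k}; c \<noteq> d\<rbrakk> \<Longrightarrow> lv' k c = 0 \<and> lv' (Suc k) c = 0"
    and b: "lv' k (w b) = 0" "lv' (Suc k) (w b) \<noteq> 0" "\<And>j. \<lbrakk>w b \<le> j; j < d\<rbrakk> \<Longrightarrow> lh' (Suc k) j \<noteq> 0" "lh' (Suc k) d = 0"
    using droop_extend[OF L w[unfolded k(1)] dr[unfolded k(1)]] by blast
  have "copath (Suc k) lv' lh' (Suc k, w b, Top) (Suc k, c, Left)"
    by (rule copath_turn) (use b q in auto)
  moreover have "cocrossing lv' lh' (Suc k) c"
  proof -
    have "w b \<le> c - 1" "c - 1 < d" "w b \<le> c" using q by auto
    then have "lh' (Suc k) (c - 1) \<noteq> 0" "lh' (Suc k) c \<noteq> 0" using b(3) q by blast+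
    then show ?thesis using c[OF _ cd] q(1) k unfolding cocrossing_def by simp
  qed
  ultimately have "twice_crossed N lv' lh' (Suc k)" by (rule crossed_pair_again[OF C S])
  then show ?thesis using L' k unfolding can_cross_twice_def by blast
qed

text \<open>The crossing is new: the co-pipe that falls through column \<open>q\<close> meets the one that
follows the drooping pipe.\<close>

lemma crosses_in_droop:
  assumes dr: "droop w b i d" and w: "admissible N w i" and q: "w b < q" "q < d" "q \<notin> w ` {1..i}"
  shows "can_cross N w i q d"
proof -
  obtain k where k: "i = Suc k" "b \<le> k" using droop_pred[OF dr] by blast
  have "admissible N (w(b := d)) k" using droop_admissible[OF w dr] k by simp
  from labelling_exists[OF this] obtain lv lh where L: "labelling N k (w(b := d)) lv lh"
    by (elim exE) (rule that)
  obtain lv' lh' where L': "labelling N (Suc k) w lv' lh'" and S: "same_shape (Suc k) lv lv'" "same_shape (Suc k) lh lh'"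
    and c: "\<And>c. \<lbrakk>c \<notin> w ` {1..Suc k}; c \<noteq> d\<rbrakk> \<Longrightarrow> lv' k c = 0 \<and> lv' (Suc k) c = 0"
    and b0: "lv' k (w b) = 0" "lv' (Suc k) (w b) \<noteq> 0" and b: "\<And>j. \<lbrakk>w b \<le> j; j < d\<rbrakk> \<Longrightarrow> lh' (Suc k) j \<noteq> 0" "lh' (Suc k) d = 0"
    using droop_extend[OF L w[unfolded k(1)] dr[unfolded k(1)]] by blast
  have v: "lv' k q = 0" "lv' (Suc k) q = 0" using c[of q] q k by auto
  have "w b \<le> q - 1" "q - 1 < d" "w b \<le> q" using q by auto
  then have h: "lh' (Suc k) (q - 1) \<noteq> 0" "lh' (Suc k) q \<noteq> 0" using b(1) q by blast+
  have x: "cocrossing lv' lh' (Suc k) q" using v h unfolding cocrossing_def by simp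
  have p: "copath (Suc k) lv' lh' (Suc k, q, Top) (Suc (Suc k), q, Top)"
    by (rule copath_fall) (use v in auto)
  have p': "copath (Suc k) lv' lh' (Suc k, q, Left) (Suc (Suc k), d, Top)"
  proof (rule copath_trans)
    show "copath (Suc k) lv' lh' (Suc k, q, Left) (Suc k, d, Left)"
    proof (rule copath_run)
      show "\<forall>j. q - 1 \<le> j \<and> j < d \<longrightarrow> lh' (Suc k) j \<noteq> 0"
        using b(1) \<open>w b \<le> q - 1\<close> order_trans by blast
    qed (use q in auto)
    have "w b \<le> d - 1" "d - 1 < d" using q by auto
    then have "lh' (Suc k) (d - 1) \<noteq> 0" by (rule b(1))
    then show "copath (Suc k) lv' lh' (Suc k, d, Left) (Suc (Suc k), d, Top)"
      by (rule copath_bend) (use b in auto)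
  qed
  have "d < w i" using dr by (simp add: droop_def)
  moreover have "1 \<le> w i \<and> w i \<le> N" by (rule admissible_label[OF w]) (use k in auto)
  ultimately have "q \<in> {1..N}" "d \<le> N" using q by auto
  moreover have "1 \<le> Suc k" "Suc k \<le> Suc k" by auto
  ultimately have "crossed_pair N lv' lh' (Suc k) q d" using x p p' unfolding crossed_pair_def by blast
  then show ?thesis using L' k unfolding can_cross_def by blast
qed

text \<open>Among the rows from \<open>a\<close> on that exit with a label between \<open>w a\<close> and
\<open>l\<close>, the last one can droop.\<close>

lemma droop_at_corner:
  assumes w: "admissible N w k" and l: "l < w k" "l \<notin> w ` {1..k}" and a: "1 \<le> a" "a < k" "w a < l"
  obtains b where "a \<le> b" "b < k" "w a \<le> w b" "w b < l" "droop w b k l"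
proof -
  let ?S = "{j. a \<le> j \<and> j < k \<and> w a \<le> w j \<and> w j < l}"
  have fin: "finite ?S" and ne: "a \<in> ?S" using a by auto
  define b where "b = Max ?S"
  have b: "b \<in> ?S" unfolding b_def by (rule Max_in[OF fin]) (use ne in blast)
  have "\<not> (w b < w j \<and> w j < l)" if "b < j" "j < k" for j
  proof
    assume "w b < w j \<and> w j < l"
    then have "j \<in> ?S" using b that by auto
    then have "j \<le> b" unfolding b_def by (rule Max_ge[OF fin])
    then show False using that by simp
  qed
  then have "droop w b k l" using b a(1) l unfolding droop_def by auto
  then show thesis using that b by blast
qed

section \<open>Patterns that produce a double crossing\<close>

text \<open>Let the last label \<open>w b\<close> between \<open>w a\<close> and \<open>c\<close> droop to
column \<open>c\<close> in row \<open>r\<close>. If \<open>w b < q\<close>, the droop makes the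
crossing. Otherwise the pair is produced in the columns \<open>q\<close> and \<open>w b\<close>
above, by induction on \<open>c\<close>, and the droop moves the second co-pipe to column
\<open>c\<close>.\<close>

lemma can_cross_at_corner:
  assumes "admissible N w r" "c < w r" "q < c" "q \<notin> w ` {1..r}" "c \<notin> w ` {1..r}"
    and "1 \<le> a" "a < r" "w a < q"
  shows "can_cross N w r q c"
  using assms
proof (induction c arbitrary: w r rule: less_induct)
  case (less c)
  note w = less.prems(1) and c = less.prems(2) and qc = less.prems(3) and qn = less.prems(4)
    and cn = less.prems(5) and a = less.prems(6-8)
  have "w a < c" using a(3) qc by simp
  from droop_at_corner[OF w c cn a(1,2) this] obtain b
    where b: "a \<le> b" "b < r" "w a \<le> w b" "w b < c" and dr: "droop w b r c" by blast
  have "w b \<in> w ` {1..r}" by (rule imageI) (use a b in auto)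
  then have "w b \<noteq> q" using qn by blast
  then consider "w b < q" | "q < w b" by linarith
  then show ?case
  proof cases
    case 1 show ?thesis by (rule crosses_in_droop[OF dr w 1 qc qn])
  next
    case 2
    have br: "b \<le> r" "b \<le> b" using b by auto
    have "a \<noteq> b" using a(3) 2 by auto
    have "can_cross N (w(b := c)) b q (w b)"
    proof (rule less.IH)
      show "w b < c" by (rule b(4))
      show "admissible N (w(b := c)) b" by (rule droop_admissible[OF w dr b(2)])
      show "q \<notin> (w(b := c)) ` {1..b}" by (rule droop_notin[OF notin_mono[OF qn br(1)]]) (use qc in simp)
      show "w b \<notin> (w(b := c)) ` {1..b}"
        by (rule droop_source_notin[OF admissible_mono[OF w br(1)] dr br(2)])
    qed (use a b 2 \<open>a \<noteq> b\<close> in auto)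
    from can_cross_droop[OF dr w this b(2) qn] show ?thesis using qc by simp
  qed
qed

text \<open>Let \<open>w b\<close> droop to column \<open>l\<close> in row \<open>k\<close>; above, row
\<open>b\<close> exits with \<open>l\<close>. If row \<open>bq\<close> comes after row
\<open>b\<close>, then in row \<open>b\<close> there can be a crossed pair in the columns \<open>w
bq\<close> and \<open>w b\<close>, which crosses again at the exit of row \<open>bq\<close>.
Otherwise the same situation occurs above with \<open>b\<close> and \<open>w b\<close> in place of
\<open>k\<close> and \<open>l\<close>.\<close>

lemma crosses_twice_13254:
  assumes "admissible N w k" "l < w k" "l \<notin> w ` {1..k}"
    and "1 \<le> a" "a < rg" "rg < bq" "bq < k" "w a < w bq" "w bq < w rg" "w rg < l"
  shows "can_cross_twice N w k"
  using assms
proof (induction k arbitrary: w l rule: less_induct)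
  case (less k)
  note w = less.prems(1) and l = less.prems(2,3) and a = less.prems(4-7) and v = less.prems(8-10)
  have "1 \<le> rg" "rg < k" using a by auto
  from droop_at_corner[OF w l this v(3)] obtain b
    where b: "rg \<le> b" "b < k" "w rg \<le> w b" "w b < l" and dr: "droop w b k l" by blast
  have bb: "b \<le> b" "b \<le> k" using b by auto
  have ad: "admissible N (w(b := l)) b" by (rule droop_admissible[OF w dr b(2)])
  have eb: "w b \<notin> (w(b := l)) ` {1..b}" by (rule droop_source_notin[OF admissible_mono[OF w bb(2)] dr bb(1)])
  have "b \<noteq> bq" using b v by auto
  then consider "b < bq" | "bq < b" by linarith
  then show ?case
  proof cases
    case 1
    have "can_cross N (w(b := l)) b (w bq) (w b)"
    proof (rule can_cross_at_corner[OF ad])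
      have "w bq \<notin> w ` {1..b}"
      proof -
        have "admissible N w bq" using admissible_mono[OF w] a by simp
        then have "w bq \<notin> w ` {1..bq - 1}" using a by (intro admissible_last) auto
        then show ?thesis by (rule notin_mono) (use 1 in simp)
      qed
      then show "w bq \<notin> (w(b := l)) ` {1..b}" by (rule droop_notin) (use v in simp)
      show "w b \<notin> (w(b := l)) ` {1..b}" by (rule eb)
      show "1 \<le> a" by (rule a)
    qed (use a b v in auto)
    moreover have "admissible N (w(b := l)) (k - 1)" by (rule droop_admissible[OF w dr]) (use b in simp)
    moreover have "w b \<notin> (w(b := l)) ` {1..k - 1}"
      by (rule droop_source_notin[OF admissible_mono[OF w] dr]) (use b in auto)
    ultimately have "can_cross_twice N (w(b := l)) (k - 1)"
      by (rule cross_at_exit[where j = bq]) (use 1 a b v in auto)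
    then show ?thesis by (rule can_cross_twice_droop[OF dr w]) (use b in simp)
  next
    case 2
    have "can_cross_twice N (w(b := l)) b"
    proof (rule less.IH[OF b(2) ad _ eb a(1,2,3) 2])
      have "w rg \<noteq> w b" by (rule admissible_ne[OF w]) (use a b 2 in auto)
      then show "(w(b := l)) rg < w b" using b 2 a by simp
    qed (use a b v 2 in auto)
    then show ?thesis by (rule can_cross_twice_droop[OF dr w _ b(2)])
  qed
qed

text \<open>Let \<open>w b\<close> droop to column \<open>l\<close> in row \<open>k\<close>. If \<open>w b <
h\<close>, a crossed pair in the columns \<open>w b\<close> and \<open>h\<close> crosses again in
this droop. Otherwise the same situation occurs above with \<open>b\<close> and \<open>w b\<close>
in place of \<open>k\<close> and \<open>l\<close>.\<close>

lemma crosses_twice_12543: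
  assumes "admissible N w k" "l < w k" "l \<notin> w ` {1..k}"
    and "1 \<le> a" "a < rb" "rb < k" "w a < w rb" "w rb < h" "h < l" "h \<notin> w ` {1..k}"
  shows "can_cross_twice N w k"
  using assms
proof (induction k arbitrary: w l rule: less_induct)
  case (less k)
  note w = less.prems(1) and l = less.prems(2,3) and a = less.prems(4-6) and v = less.prems(7-9) and h = less.prems(10)
  have "1 \<le> rb" "w rb < l" using a v by auto
  from droop_at_corner[OF w l this(1) a(3) this(2)] obtain b
    where b: "rb \<le> b" "b < k" "w rb \<le> w b" "w b < l" and dr: "droop w b k l" by blast
  have bb: "b \<le> b" "b \<le> k" using b by auto
  have ad: "admissible N (w(b := l)) b" by (rule droop_admissible[OF w dr b(2)])
  have eb: "w b \<notin> (w(b := l)) ` {1..b}" by (rule droop_source_notin[OF admissible_mono[OF w bb(2)] dr bb(1)])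
  have hb: "h \<notin> (w(b := l)) ` {1..b}" by (rule droop_notin[OF notin_mono[OF h bb(2)]]) (use v in simp)
  have "w b \<in> w ` {1..k}" by (rule imageI) (use a b in auto)
  then have "w b \<noteq> h" using h by blast
  then consider "w b < h" | "h < w b" by linarith
  then show ?case
  proof cases
    case 1
    have "can_cross N (w(b := l)) b (w b) h"
      by (rule can_cross_at_corner[OF ad _ 1 eb hb a(1)]) (use a b v in auto)
    then show ?thesis by (rule cross_at_droop[OF dr w _ b(2) h 1 v(3)])
  next
    case 2
    then have "rb \<noteq> b" using v by auto
    have "can_cross_twice N (w(b := l)) b"
      by (rule less.IH[OF b(2) ad _ eb a(1,2) _ _ _ 2 hb]) (use a b v \<open>rb \<noteq> b\<close> in auto)
    then show ?thesis by (rule can_cross_twice_droop[OF dr w _ b(2)])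
  qed
qed

text \<open>Rows \<open>r\<close> and \<open>k\<close> both exit with labels above \<open>l\<close>. Let
\<open>w b\<close> droop to column \<open>l\<close> in row \<open>k\<close>. If \<open>w b <
h\<close>, a crossed pair in the columns \<open>w b\<close> and \<open>h\<close> crosses again in
this droop. It is produced at row \<open>r\<close> or at row \<open>b\<close>, whichever comes
later; this row is below row \<open>r2\<close>, whose label is small enough. Otherwise the same
situation occurs above in the last of these two rows, with \<open>w b\<close> in place of
\<open>l\<close>. The last premise keeps \<open>b\<close> out of the rows between \<open>r1\<close>
and \<open>r2\<close> in that case.\<close>

lemma crosses_twice_2156x:
  assumes "admissible N w k" "l < w k" "l \<notin> w ` {1..k}"
    and "1 \<le> r1" "r1 < r2" "r2 < r" "r < k" "w r2 < w r1" "w r1 < h" "h < l" "h \<notin> w ` {1..k}" "l < w r"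
    and "\<And>j. \<lbrakk>r1 < j; j < r2; h < w j\<rbrakk> \<Longrightarrow> l \<le> w j"
  shows "can_cross_twice N w k"
  using assms
proof (induction k arbitrary: w l r rule: less_induct)
  case (less k)
  note w = less.prems(1) and l = less.prems(2,3) and a = less.prems(4-7) and v = less.prems(8-10)
    and h = less.prems(11) and lr = less.prems(12) and nz = less.prems(13)
  have "r1 < k" "w r1 < l" using a v by auto
  from droop_at_corner[OF w l a(1) this] obtain b
    where b: "r1 \<le> b" "b < k" "w r1 \<le> w b" "w b < l" and dr: "droop w b k l" by blast
  have ad: "admissible N (w(b := l)) m" if "m < k" for m by (rule droop_admissible[OF w dr that])
  have eb: "w b \<notin> (w(b := l)) ` {1..m}" if "b \<le> m" "m < k" for m
    by (rule droop_source_notin[OF admissible_mono[OF w] dr]) (use that in auto)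
  have hb: "h \<notin> (w(b := l)) ` {1..m}" if "m < k" for m
    by (rule droop_notin[OF notin_mono[OF h]]) (use v that in auto)
  have "w b \<in> w ` {1..k}" by (rule imageI) (use a b in auto)
  then have "w b \<noteq> h" using h by blast
  have br: "b \<noteq> r2" "b \<noteq> r" using b v lr by auto
  consider "w b < h" "b < r" | "w b < h" "r < b" | "h < w b" "r < b" | "h < w b" "b < r"
    using br \<open>w b \<noteq> h\<close> by linarith
  then show ?case
  proof cases
    case 1
    have "1 \<le> r2" "b \<le> r" using a 1 by auto
    have "can_cross N (w(b := l)) r (w b) h"
      by (rule can_cross_at_corner[OF ad _ 1(1) eb hb \<open>1 \<le> r2\<close>]) (use a b v br lr 1 in auto)
    then show ?thesis by (rule cross_at_droop[OF dr w _ a(4) h 1(1) v(3)])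
  next
    case 2
    have "1 \<le> r2" using a by auto
    have "can_cross N (w(b := l)) b (w b) h"
      by (rule can_cross_at_corner[OF ad _ 2(1) eb hb \<open>1 \<le> r2\<close>]) (use a b v br lr 2 in auto)
    then show ?thesis by (rule cross_at_droop[OF dr w _ b(2) h 2(1) v(3)])
  next
    case 3
    have "can_cross_twice N (w(b := l)) b"
    proof (rule less.IH[OF b(2) ad[OF b(2)] _ eb[OF order_refl b(2)] a(1-3) 3(2) _ _ 3(1) hb[OF b(2)]])
      fix j assume j: "r1 < j" "j < r2" "h < (w(b := l)) j"
      then have "j \<noteq> b" using a 3 by auto
      then have "l \<le> w j" using nz j by simp
      then show "w b \<le> (w(b := l)) j" using \<open>j \<noteq> b\<close> b by simp
    qed (use a b v lr 3 in auto)
    then show ?thesis by (rule can_cross_twice_droop[OF dr w _ b(2)])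
  next
    case 4
    have b2: "r2 < b"
    proof (rule ccontr)
      assume "\<not> r2 < b"
      then have "b < r2" "r1 < b" using br b 4 v by (auto simp: le_less)
      from nz[OF this(2,1) 4(1)] show False using b by simp
    qed
    have br': "b \<le> r" using 4 by simp
    have "can_cross_twice N (w(b := l)) r"
    proof (rule less.IH[OF a(4) ad[OF a(4)] _ eb[OF br' a(4)] a(1,2) b2 4(2) _ _ 4(1) hb[OF a(4)]])
      fix j assume j: "r1 < j" "j < r2" "h < (w(b := l)) j"
      then have "j \<noteq> b" using b2 by auto
      then have "l \<le> w j" using nz j by simp
      then show "w b \<le> (w(b := l)) j" using \<open>j \<noteq> b\<close> b by simp
    qed (use a b v lr 4 b2 in auto)
    then show ?thesis by (rule can_cross_twice_droop[OF dr w _ a(4)])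
  qed
qed

text \<open>The value 4 allows a crossed pair in the columns of 2 and 3, which crosses again when 2 exits.\<close>

lemma crosses_twice_1423:
  assumes w: "admissible N w c" and "1 \<le> a" "a < b" "b < c" "w a < w c" "w c < d" "d < w b" "d \<notin> w ` {1..c}"
  shows "can_cross_twice N w c"
proof -
  have bc: "b \<le> c" "b \<le> c - 1" "1 \<le> c" using assms by auto
  have "can_cross N w b (w c) d"
  proof (rule can_cross_at_corner[OF admissible_mono[OF w bc(1)] assms(7,6) _ _ assms(2,3,5)])
    show "w c \<notin> w ` {1..b}" by (rule notin_mono[OF admissible_last[OF w bc(3)] bc(2)])
    show "d \<notin> w ` {1..b}" by (rule notin_mono[OF assms(8) bc(1)])
  qed
  then show ?thesis by (rule cross_at_exit[OF _ w assms(8) assms(4) order_refl refl assms(6)])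
qed

text \<open>A droop to column \<open>h\<close> in row \<open>k\<close> makes some row \<open>b\<close> between
exit with \<open>h\<close> above. So 1423 occurs there, formed by \<open>w a\<close>, \<open>w
r\<close>, \<open>h\<close> and the label \<open>w k\<close>, which exits later.\<close>

lemma crosses_twice_25143:
  assumes w: "admissible N w k" and "1 \<le> a" "a < r" "r < b0" "b0 < k" "w b0 < w a" "w a < h" "h < w k" "w k < w r"
    and h: "h \<notin> w ` {1..k}"
  shows "can_cross_twice N w k"
proof -
  have b0: "1 \<le> b0" "w b0 < h" "1 \<le> k" using assms by auto
  from droop_at_corner[OF w assms(8) h b0(1) assms(5) b0(2)] obtain b
    where b: "b0 \<le> b" "b < k" "w b0 \<le> w b" "w b < h" and dr: "droop w b k h" by blast
  let ?w = "w(b := h)"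
  have rb: "r < b" "r < k" "r \<le> k" "r \<le> k - 1" using assms(4,5) b by auto
  have same: "?w ` {1..r} = w ` {1..r}" by (rule image_cong) (use rb in auto)
  have wk: "w k \<notin> w ` {1..k - 1}" by (rule admissible_last[OF w b0(3)])
  have "can_cross N ?w r h (w k)"
  proof (rule can_cross_at_corner[OF droop_admissible[OF w dr rb(2)] _ assms(8) _ _ assms(2,3)])
    show "h \<notin> ?w ` {1..r}" unfolding same by (rule notin_mono[OF h rb(3)])
    show "w k \<notin> ?w ` {1..r}" unfolding same by (rule notin_mono[OF wk rb(4)])
    show "w k < ?w r" using assms(9) rb by simp
    show "?w a < h" using assms(3,7) rb by simp
  qed
  moreover have "admissible N ?w (k - 1)" by (rule droop_admissible[OF w dr]) (use b in simp)
  moreover have "w k \<notin> ?w ` {1..k - 1}" by (rule droop_notin[OF wk]) (use assms(8) in simp)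
  ultimately have "can_cross_twice N ?w (k - 1)"
    by (rule cross_at_exit[where j = b]) (use rb b assms(8) in auto)
  then show ?thesis by (rule can_cross_twice_droop[OF dr w]) (use b in simp)
qed

text \<open>A droop to column \<open>d\<close> in row \<open>h\<close> makes some row \<open>b\<close> exit with
\<open>d\<close> above. Before row \<open>k\<close>, this completes 13254, formed by \<open>w
a\<close>, \<open>w r\<close>, \<open>d\<close>, \<open>w k\<close> and \<open>w h\<close>; after
row \<open>k\<close> it completes 1423, formed by \<open>w a\<close>, \<open>w k\<close>,
\<open>d\<close> and \<open>w h\<close>.\<close>

lemma crosses_twice_241653:
  assumes w: "admissible N w h" and "1 \<le> a" "a < r" "r < b0" "b0 < k" "k < h"
    and v: "w b0 < w a" "w a < d" "d < w r" "w r < w h" "w h < w k" and d: "d \<notin> w ` {1..h}"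
  shows "can_cross_twice N w h"
proof -
  have b0: "1 \<le> b0" "b0 < h" "w b0 < d" "d < w h" "1 \<le> h" using assms by auto
  from droop_at_corner[OF w b0(4) d b0(1,2,3)] obtain b
    where b: "b0 \<le> b" "b < h" "w b0 \<le> w b" "w b < d" and dr: "droop w b h d" by blast
  let ?w = "w(b := d)"
  have "b \<noteq> k" using b v by auto
  have kh: "k \<le> h" "k \<le> h - 1" using assms(6) by auto
  have wh: "w h \<notin> w ` {1..h - 1}" by (rule admissible_last[OF w b0(5)])
  have wk: "w h \<notin> ?w ` {1..k}" by (rule droop_notin[OF notin_mono[OF wh kh(2)]]) (use b0 in simp)
  have ad: "admissible N ?w k" by (rule droop_admissible[OF w dr assms(6)])
  from \<open>b \<noteq> k\<close> consider "b < k" | "k < b" by linarith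
  then show ?thesis
  proof cases
    case 1
    have "can_cross_twice N ?w k"
      by (rule crosses_twice_13254[OF ad _ wk assms(2,3) _ 1]) (use assms(3-6) v b 1 in auto)
    then show ?thesis by (rule can_cross_twice_droop[OF dr w _ assms(6)])
  next
    case 2
    have same: "?w ` {1..k} = w ` {1..k}" by (rule image_cong) (use 2 in auto)
    have "can_cross N ?w k d (w h)"
    proof (rule can_cross_at_corner[OF ad _ b0(4) _ wk assms(2)])
      show "d \<notin> ?w ` {1..k}" unfolding same by (rule notin_mono[OF d kh(1)])
    qed (use assms(3-6) v 2 in auto)
    moreover have "admissible N ?w (h - 1)" by (rule droop_admissible[OF w dr]) (use b in simp)
    moreover have "w h \<notin> ?w ` {1..h - 1}" by (rule droop_notin[OF wh]) (use b0 in simp)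
    ultimately have "can_cross_twice N ?w (h - 1)"
      by (rule cross_at_exit[where j = b]) (use 2 b b0 in auto)
    then show ?thesis by (rule can_cross_twice_droop[OF dr w]) (use b in simp)
  qed
qed

section \<open>Double crossings in a full diagram\<close>

context full
begin

text \<open>Each edge that co-pipes can use is used by one: some edge before it can also be used, and this leads
back to the top.\<close>

lemma entered:
  assumes "i \<in> {1..n}" "j \<in> {1..n}"
  shows "(lv (i - 1) j = 0 \<longrightarrow> (\<exists>p. centers p i j Top)) \<and> (lh i (j - 1) \<noteq> 0 \<longrightarrow> (\<exists>p. centers p i j Left))"
  using assms
proof (induction "i + j" arbitrary: i j rule: less_induct)
  case less
  show ?case
  proof (intro conjI impI)
    assume z: "lv (i - 1) j = 0"
    show "\<exists>p. centers p i j Top"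
    proof (cases "i = 1")
      case True
      have "centers j 1 j Top" by (rule enters.from_top[OF refl less.prems(2)])
      then show ?thesis using True by blast
    next
      case False
      then obtain k where k: "i = Suc k" "1 \<le> k" "k < n" using less.prems(1) by (cases i) auto
      have g: "k \<in> {1..n}" "k + j < i + j" using k by auto
      have z': "lv k j = 0" using z k by simp
      note IH = less.hyps[OF g(2,1) less.prems(2)]
      show ?thesis
      proof (cases "lv (k - 1) j = 0")
        case True
        then obtain p where "centers p k j Top" using IH by blast
        moreover have "goes_down k j Top" using True z' unfolding co_down_def by simp
        ultimately have "centers p (Suc k) j Top" using centers_step(1) k(3) by blast
        then show ?thesis using k(1) by blast
      next
        case False
        then have "lh k (j - 1) \<noteq> 0" "lh k j = 0"
          using grid_cell[OF g(1) less.prems(2)] z' unfolding cell_def by (auto split: if_splits)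
        then have "\<exists>p. centers p k j Left" "goes_down k j Left" using IH unfolding co_down_def by auto
        then have "\<exists>p. centers p (Suc k) j Top" using centers_step(1) k(3) by blast
        then show ?thesis using k(1) by blast
      qed
    qed
  next
    assume z: "lh i (j - 1) \<noteq> 0"
    have "j \<noteq> 1"
    proof
      assume "j = 1"
      then show False using z left_empty[of i] less.prems(1) by simp
    qed
    then obtain k where k: "j = Suc k" "1 \<le> k" "k < n" using less.prems(2) by (cases j) auto
    have g: "k \<in> {1..n}" "i + k < i + j" using k by auto
    have z': "lh i k \<noteq> 0" using z k by simp
    note IH = less.hyps[OF g(2) less.prems(1) g(1)]
    show "\<exists>p. centers p i j Left"
    proof (cases "lh i (k - 1) = 0")
      case False
      then have "\<exists>p. centers p i k Left" "goes_right i k Left" using IH z' unfolding co_right_def by auto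
      then have "\<exists>p. centers p i (Suc k) Left" using centers_step(2) k(3) by blast
      then show ?thesis using k(1) by blast
    next
      case True
      then have "lv (i - 1) k = 0" "lv i k \<noteq> 0"
        using grid_cell[OF less.prems(1) g(1)] z' unfolding cell_def by (auto split: if_splits)
      then have "\<exists>p. centers p i k Top" "goes_right i k Top" using IH unfolding co_right_def by auto
      then have "\<exists>p. centers p i (Suc k) Left" using centers_step(2) k(3) by blast
      then show ?thesis using k(1) by blast
    qed
  qed
qed

lemma centers_copath:
  assumes "copath n lv lh (i, j, e) t" "centers p i j e" "fst t \<le> n" "fst (snd t) \<le> n"
  shows "centers p (fst t) (fst (snd t)) (snd (snd t))"
  using assms(1,3,4)
proof (induction rule: copath.induct)
  case start then show ?case using assms(2) by simp
next
  case (down i' j' e')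
  then have "centers p i' j' e'" by simp
  from centers_step(1)[OF this down.hyps(3)] down.prems show ?case by simp
next
  case (right i' j' e')
  then have "centers p i' j' e'" by simp
  from centers_step(2)[OF this right.hyps(3)] right.prems show ?case by simp
qed

lemma cocrossing_tile:
  assumes "cocrossing lv lh i j" "i \<in> {1..n}" "j \<in> {1..n}" shows "co B i j = Cross"
  by (rule cocross_tile) (use assms in \<open>simp add: cocross_def cocrossing_def\<close>)

lemma not_co_reduced:
  assumes "twice_crossed n lv lh n"
  shows "\<not> co_reduced n (co B)"
proof
  assume red: "co_reduced n (co B)"
  obtain k j k' j' where x: "1 \<le> k" "k \<le> n" "j \<in> {1..n}" "k < k'" "cocrossing lv lh k j"
     "cocrossing lv lh k' j'" "k' \<le> n" "j' \<le> n"
     "copath n lv lh (k, j, Top) (k', j', Left)" "copath n lv lh (k, j, Left) (k', j', Top)"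
    using assms unfolding twice_crossed_def by blast
  have k: "k \<in> {1..n}" using x by simp
  have "lv (k - 1) j = 0" "lh k (j - 1) \<noteq> 0" using x(5) by (auto simp: cocrossing_def)
  then obtain p q where p: "centers p k j Top" and q: "centers q k j Left"
    using entered[OF k x(3)] by blast
  have pq: "p \<noteq> q" using centers_unique[OF p, of k j Left] q by auto
  have p': "centers p k' j' Left" using centers_copath[OF x(9) p] x(7,8) by simp
  have q': "centers q k' j' Top" using centers_copath[OF x(10) q] x(7,8) by simp
  have g': "k' \<in> {1..n}" "j' \<in> {1..n}" using centers_grid[OF p'] by auto
  have "cross_at n (co B) Top p q k j"
    using pq p q cocrossing_tile[OF x(5) k x(3)] unfolding cross_at_def passes_def by blast
  moreover have "cross_at n (co B) Top p q k' j'"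
    using pq p' q' cocrossing_tile[OF x(6) g'] unfolding cross_at_def passes_def by blast
  ultimately have "(k, j) = (k', j')" using red unfolding co_reduced_def by blast
  then show False using x(4) by simp
qed

end

lemma BPD_not_co_reduced:
  assumes w: "w permutes {1..n}" and "can_cross_twice n w k" "k \<le> n"
  shows "\<exists>B \<in> BPD n w. \<not> co_reduced n (co B)"
proof -
  have im: "w ` {1..n} = {1..n}" by (rule permutes_image[OF w])
  have "admissible n w n" unfolding admissible_def using im permutes_inj_on[OF w] by simp
  from can_cross_twice_descend[OF assms(2) this assms(3)] obtain lv lh
    where L: "labelling n n w lv lh" and T: "twice_crossed n lv lh n"
    unfolding can_cross_twice_def by blast
  interpret L: labelling n n w lv lh by fact
  interpret full n lv lh using L.tableau_axioms im by (simp add: full_def)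
  show ?thesis using labelling_BPD[OF L] not_co_reduced[OF T] by blast
qed

text \<open>Here \<open>p\<close> lists the positions of the pattern by increasing value, so that all
comparisons in the definition amount to two increasing lists.\<close>

lemma contains_patternI:
  assumes "sorted_wrt (<) rs" "set rs \<subseteq> {1..n}" "length rs = length v"
    and "set p = {..<length v}" "sorted_wrt (<) (map (\<lambda>i. v ! i) p)" "sorted_wrt (<) (map (\<lambda>i. w (rs ! i)) p)"
  shows "contains_pattern n w v"
  unfolding contains_pattern_def
proof (intro exI conjI allI impI)
  show "strict_mono_on {..<length v} ((!) rs)"
  proof (rule strict_mono_onI)
    fix r s assume "r \<in> {..<length v}" "s \<in> {..<length v}" "r < s"
    then show "rs ! r < rs ! s" using sorted_wrt_nth_less[OF assms(1)] assms(3) by simp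
  qed
  show "(!) rs ` {..<length v} \<subseteq> {1..n}"
  proof (rule image_subsetI)
    fix r assume "r \<in> {..<length v}"
    then have "rs ! r \<in> set rs" using assms(3) by simp
    then show "rs ! r \<in> {1..n}" using assms(2) by blast
  qed
  fix r s assume "r < length v" "s < length v"
  then have "r \<in> set p" "s \<in> set p" using assms(4) by auto
  then obtain i j where ij: "i < length p" "j < length p" "r = p ! i" "s = p ! j"
    by (metis in_set_conv_nth)
  have up: "v ! (p ! i) < v ! (p ! j) \<and> w (rs ! (p ! i)) < w (rs ! (p ! j))" if "i < j" "j < length p" for i j
    using sorted_wrt_nth_less[OF assms(5), of i j] sorted_wrt_nth_less[OF assms(6), of i j] that by simp
  from ij show "w (rs ! r) < w (rs ! s) \<longleftrightarrow> v ! r < v ! s"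
    using up[of i j] up[of j i] by (cases i j rule: linorder_cases) auto
qed

lemma contains_patternE:
  assumes "contains_pattern n w v"
    and "set p = {..<length v}" "sorted_wrt (<) (map (\<lambda>i. v ! i) p)"
  obtains rs where "length rs = length v" "sorted_wrt (<) rs" "set rs \<subseteq> {1..n}"
    "sorted_wrt (<) (map (\<lambda>i. w (rs ! i)) p)"
proof -
  from assms(1) obtain f where "strict_mono_on {..<length v} f \<and> f ` {..<length v} \<subseteq> {1..n} \<and>
      (\<forall>r<length v. \<forall>s<length v. w (f r) < w (f s) \<longleftrightarrow> v ! r < v ! s)"
    unfolding contains_pattern_def by (elim exE) (rule that)
  then have f: "strict_mono_on {..<length v} f" "f ` {..<length v} \<subseteq> {1..n}"
    "\<forall>r<length v. \<forall>s<length v. w (f r) < w (f s) \<longleftrightarrow> v ! r < v ! s" by simp_all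
  let ?rs = "map f [0..<length v]"
  have "sorted_wrt (<) ?rs"
    unfolding sorted_wrt_iff_nth_less
  proof (intro allI impI)
    fix i j assume "i < j" "j < length ?rs"
    then show "?rs ! i < ?rs ! j" using strict_mono_onD[OF f(1), of i j] by simp
  qed
  moreover have "set ?rs \<subseteq> {1..n}" using f(2) by auto
  moreover have "sorted_wrt (<) (map (\<lambda>i. w (?rs ! i)) p)"
  proof -
    have p: "p ! i < length v" if "i < length p" for i using nth_mem[OF that] assms(2) by auto
    have "w (?rs ! (p ! i)) < w (?rs ! (p ! j))" if ij: "i < j" "j < length p" for i j
    proof -
      have "v ! (p ! i) < v ! (p ! j)" using sorted_wrt_nth_less[OF assms(3) ij(1)] ij by simp
      then show ?thesis using f(3) p[of i] p[of j] ij by simp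
    qed
    then show ?thesis unfolding sorted_wrt_iff_nth_less by simp
  qed
  ultimately show thesis using that[of ?rs] by simp
qed

lemma length_eq_4: "length xs = 4 \<Longrightarrow> \<exists>a b c d. xs = [a, b, c, d]"
  by (auto simp: numeral_eq_Suc length_Suc_conv)

lemma length_eq_5: "length xs = 5 \<Longrightarrow> \<exists>a b c d e. xs = [a, b, c, d, e]"
  by (auto simp: numeral_eq_Suc length_Suc_conv)

lemma length_eq_6: "length xs = 6 \<Longrightarrow> \<exists>a b c d e f. xs = [a, b, c, d, e, f]"
  by (auto simp: numeral_eq_Suc length_Suc_conv)

section \<open>The characterization\<close>

lemma avoids_avoiding:
  assumes "labelling n n w lv lh" and av: "\<forall>v \<in> patterns. avoids_pattern n w v"
  shows "avoiding n w lv lh"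
proof -
  interpret L: labelling n n w lv lh by fact
  have no: False if "contains_pattern n w v" "v \<in> patterns" for v
    using av that unfolding avoids_pattern_def by blast
  show ?thesis
  proof
    fix a b c d :: nat
    assume A: "1 \<le> a" "a < b" "b < c" "c < d" "d \<le> n" "w a < w c" "w c < w d" "w d < w b"
    have "contains_pattern n w [1,4,2,3]"
      by (rule contains_patternI[where rs = "[a,b,c,d]" and p = "[0,2,3,1]"])
        (use A in \<open>auto simp: lessThan_Suc numeral_eq_Suc\<close>)
    then show False by (rule no) (simp add: patterns_def)
  next
    fix a b c d e :: nat
    assume A: "1 \<le> a" "a < b" "b < c" "c < d" "d < e" "e \<le> n" "w a < w b" "w b < w e" "w e < w d" "w d < w c"
    have "contains_pattern n w [1,2,5,4,3]"
      by (rule contains_patternI[where rs = "[a,b,c,d,e]" and p = "[0,1,4,3,2]"])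
        (use A in \<open>auto simp: lessThan_Suc numeral_eq_Suc\<close>)
    then show False by (rule no) (simp add: patterns_def)
  next
    fix a b c d e :: nat
    assume A: "1 \<le> a" "a < b" "b < c" "c < d" "d < e" "e \<le> n" "w a < w c" "w c < w b" "w b < w e" "w e < w d"
    have "contains_pattern n w [1,3,2,5,4]"
      by (rule contains_patternI[where rs = "[a,b,c,d,e]" and p = "[0,2,1,4,3]"])
        (use A in \<open>auto simp: lessThan_Suc numeral_eq_Suc\<close>)
    then show False by (rule no) (simp add: patterns_def)
  next
    fix a b c d e :: nat
    assume A: "1 \<le> a" "a < b" "b < c" "c < d" "d < e" "e \<le> n" "w c < w a" "w a < w e" "w e < w d" "w d < w b"
    have "contains_pattern n w [2,5,1,4,3]"
      by (rule contains_patternI[where rs = "[a,b,c,d,e]" and p = "[2,0,4,3,1]"])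
        (use A in \<open>auto simp: lessThan_Suc numeral_eq_Suc\<close>)
    then show False by (rule no) (simp add: patterns_def)
  next
    fix a b c d e f :: nat
    assume A: "1 \<le> a" "a < b" "b < c" "c < d" "d < e" "e < f" "f \<le> n"
      "w b < w a" "w a < w f" "w f < w e" "w e < w c" "w e < w d"
    have "w c \<noteq> w d"
    proof
      assume "w c = w d"
      then have "c = d" by (rule L.exit_inj) (use A in auto)
      then show False using A by simp
    qed
    then consider "w c < w d" | "w d < w c" by linarith
    then show False
    proof cases
      case 1
      have "contains_pattern n w [2,1,5,6,4,3]"
        by (rule contains_patternI[where rs = "[a,b,c,d,e,f]" and p = "[1,0,5,4,2,3]"])
          (use A 1 in \<open>auto simp: lessThan_Suc numeral_eq_Suc\<close>)
      then show False by (rule no) (simp add: patterns_def)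
    next
      case 2
      have "contains_pattern n w [2,1,6,5,4,3]"
        by (rule contains_patternI[where rs = "[a,b,c,d,e,f]" and p = "[1,0,5,4,3,2]"])
          (use A 2 in \<open>auto simp: lessThan_Suc numeral_eq_Suc\<close>)
      then show False by (rule no) (simp add: patterns_def)
    qed
  next
    fix a b c d e f :: nat
    assume A: "1 \<le> a" "a < b" "b < c" "c < d" "d < e" "e < f" "f \<le> n"
      "w c < w a" "w a < w f" "w f < w b" "w b < w e" "w e < w d"
    have "contains_pattern n w [2,4,1,6,5,3]"
      by (rule contains_patternI[where rs = "[a,b,c,d,e,f]" and p = "[2,0,5,1,4,3]"])
        (use A in \<open>auto simp: lessThan_Suc numeral_eq_Suc\<close>)
    then show False by (rule no) (simp add: patterns_def)
  qed
qed

lemma later_label: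
  assumes w: "admissible N w n" and "k < h" "h \<le> n" shows "w h \<notin> w ` {1..k}"
proof -
  have "w h \<notin> w ` {1..h - 1}" by (rule admissible_last[OF admissible_mono[OF w assms(3)]]) (use assms in simp)
  then show ?thesis by (rule notin_mono) (use assms in simp)
qed

text \<open>Either \<open>crosses_twice_2156x\<close> applies, or the row that violates its last premise turns
the occurrence into one of 241653.\<close>

lemma crosses_twice_2156:
  assumes w: "admissible n w n" and r: "1 \<le> a" "a < b" "b < c" "c < d" "d < e" "e < f" "f \<le> n"
    and x: "w b < w a" "w a < w f" "w f < w e" "w e < w c" "w e < w d"
  shows "\<exists>k \<le> n. can_cross_twice n w k"
proof (cases "\<exists>j. a < j \<and> j < b \<and> w f < w j \<and> w j < w e")
  case True
  then obtain j where j: "a < j" "j < b" "w f < w j" "w j < w e" by blast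
  have en: "e \<le> n" using r by simp
  have "can_cross_twice n w e"
    by (rule crosses_twice_241653[OF admissible_mono[OF w en] r(1) j(1,2) _ r(5) x(1,2) j(3,4) x(5)
          later_label[OF w r(6,7)]]) (use r in simp)
  then show ?thesis using en by blast
next
  case False
  have dn: "d \<le> n" "d < f" "e \<le> n" using r by auto
  have "can_cross_twice n w d"
    by (rule crosses_twice_2156x[OF admissible_mono[OF w dn(1)] x(5) later_label[OF w r(5) dn(3)] r(1-4) x(1-3)
          later_label[OF w dn(2) r(7)] x(4)]) (use False in \<open>meson not_less\<close>)
  then show ?thesis using dn by blast
qed

lemma pattern_crosses_twice:
  assumes w: "admissible n w n" and v: "v \<in> patterns" and c: "contains_pattern n w v"
  shows "\<exists>k \<le> n. can_cross_twice n w k"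
proof -
  have ad: "admissible n w k" if "k \<le> n" for k by (rule admissible_mono[OF w that])
  consider "v = [1,4,2,3]" | "v = [1,2,5,4,3]" | "v = [1,3,2,5,4]" | "v = [2,5,1,4,3]"
    | "v = [2,1,5,6,4,3]" | "v = [2,1,6,5,4,3]" | "v = [2,4,1,6,5,3]"
    using v unfolding patterns_def by blast
  then show ?thesis
  proof cases
    case 1
    obtain rs where rs: "length rs = length v" "sorted_wrt (<) rs" "set rs \<subseteq> {1..n}"
      "sorted_wrt (<) (map (\<lambda>i. w (rs ! i)) [0,2,3,1])"
      by (rule contains_patternE[OF c, of "[0,2,3,1]"]) (auto simp: 1 lessThan_Suc numeral_eq_Suc)
    obtain a b c d where e: "rs = [a,b,c,d]" using length_eq_4[of rs] rs(1) 1 by auto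
    have r: "1 \<le> a" "a < b" "b < c" "c < d" "d \<le> n" using rs(2,3) unfolding e by auto
    have x: "w a < w c" "w c < w d" "w d < w b" using rs(4) unfolding e by auto
    have "can_cross_twice n w c"
      by (rule crosses_twice_1423[OF ad r(1,2,3) x later_label[OF w r(4,5)]]) (use r in simp)
    then show ?thesis using r by (intro exI[of _ c]) simp
  next
    case 2
    obtain rs where rs: "length rs = length v" "sorted_wrt (<) rs" "set rs \<subseteq> {1..n}"
      "sorted_wrt (<) (map (\<lambda>i. w (rs ! i)) [0,1,4,3,2])"
      by (rule contains_patternE[OF c, of "[0,1,4,3,2]"]) (auto simp: 2 lessThan_Suc numeral_eq_Suc)
    obtain a b c d e where e: "rs = [a,b,c,d,e]" using length_eq_5[of rs] rs(1) 2 by auto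
    have r: "1 \<le> a" "a < b" "b < c" "c < d" "d < e" "e \<le> n" using rs(2,3) unfolding e by auto
    have x: "w a < w b" "w b < w e" "w e < w d" "w d < w c" using rs(4) unfolding e by auto
    have "can_cross_twice n w c"
      by (rule crosses_twice_12543[OF ad x(4) later_label[OF w] r(1-3) x(1-3) later_label[OF w]]) (use r in auto)
    then show ?thesis using r by (intro exI[of _ c]) simp
  next
    case 3
    obtain rs where rs: "length rs = length v" "sorted_wrt (<) rs" "set rs \<subseteq> {1..n}"
      "sorted_wrt (<) (map (\<lambda>i. w (rs ! i)) [0,2,1,4,3])"
      by (rule contains_patternE[OF c, of "[0,2,1,4,3]"]) (auto simp: 3 lessThan_Suc numeral_eq_Suc)
    obtain a b c d e where e: "rs = [a,b,c,d,e]" using length_eq_5[of rs] rs(1) 3 by auto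
    have r: "1 \<le> a" "a < b" "b < c" "c < d" "d < e" "e \<le> n" using rs(2,3) unfolding e by auto
    have x: "w a < w c" "w c < w b" "w b < w e" "w e < w d" using rs(4) unfolding e by auto
    have "can_cross_twice n w d"
      by (rule crosses_twice_13254[OF ad x(4) later_label[OF w] r(1-4) x(1-3)]) (use r in auto)
    then show ?thesis using r by (intro exI[of _ d]) simp
  next
    case 4
    obtain rs where rs: "length rs = length v" "sorted_wrt (<) rs" "set rs \<subseteq> {1..n}"
      "sorted_wrt (<) (map (\<lambda>i. w (rs ! i)) [2,0,4,3,1])"
      by (rule contains_patternE[OF c, of "[2,0,4,3,1]"]) (auto simp: 4 lessThan_Suc numeral_eq_Suc)
    obtain a b c d e where e: "rs = [a,b,c,d,e]" using length_eq_5[of rs] rs(1) 4 by auto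
    have r: "1 \<le> a" "a < b" "b < c" "c < d" "d < e" "e \<le> n" using rs(2,3) unfolding e by auto
    have x: "w c < w a" "w a < w e" "w e < w d" "w d < w b" using rs(4) unfolding e by auto
    have "can_cross_twice n w d"
      by (rule crosses_twice_25143[OF ad r(1-4) x later_label[OF w r(5,6)]]) (use r in simp)
    then show ?thesis using r by (intro exI[of _ d]) simp
  next
    case 5
    obtain rs where rs: "length rs = length v" "sorted_wrt (<) rs" "set rs \<subseteq> {1..n}"
      "sorted_wrt (<) (map (\<lambda>i. w (rs ! i)) [1,0,5,4,2,3])"
      by (rule contains_patternE[OF c, of "[1,0,5,4,2,3]"]) (auto simp: 5 lessThan_Suc numeral_eq_Suc)
    obtain a b c d e f where e: "rs = [a,b,c,d,e,f]" using length_eq_6[of rs] rs(1) 5 by auto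
    have r: "1 \<le> a" "a < b" "b < c" "c < d" "d < e" "e < f" "f \<le> n" using rs(2,3) unfolding e by auto
    have x: "w b < w a" "w a < w f" "w f < w e" "w e < w c" "w e < w d" using rs(4) unfolding e by auto
    show ?thesis by (rule crosses_twice_2156[OF w r x])
  next
    case 6
    obtain rs where rs: "length rs = length v" "sorted_wrt (<) rs" "set rs \<subseteq> {1..n}"
      "sorted_wrt (<) (map (\<lambda>i. w (rs ! i)) [1,0,5,4,3,2])"
      by (rule contains_patternE[OF c, of "[1,0,5,4,3,2]"]) (auto simp: 6 lessThan_Suc numeral_eq_Suc)
    obtain a b c d e f where e: "rs = [a,b,c,d,e,f]" using length_eq_6[of rs] rs(1) 6 by auto
    have r: "1 \<le> a" "a < b" "b < c" "c < d" "d < e" "e < f" "f \<le> n" using rs(2,3) unfolding e by auto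
    have x: "w b < w a" "w a < w f" "w f < w e" "w e < w c" "w e < w d" using rs(4) unfolding e by auto
    show ?thesis by (rule crosses_twice_2156[OF w r x])
  next
    case 7
    obtain rs where rs: "length rs = length v" "sorted_wrt (<) rs" "set rs \<subseteq> {1..n}"
      "sorted_wrt (<) (map (\<lambda>i. w (rs ! i)) [2,0,5,1,4,3])"
      by (rule contains_patternE[OF c, of "[2,0,5,1,4,3]"]) (auto simp: 7 lessThan_Suc numeral_eq_Suc)
    obtain a b c d e f where e: "rs = [a,b,c,d,e,f]" using length_eq_6[of rs] rs(1) 7 by auto
    have r: "1 \<le> a" "a < b" "b < c" "c < d" "d < e" "e < f" "f \<le> n" using rs(2,3) unfolding e by auto
    have x: "w c < w a" "w a < w f" "w f < w b" "w b < w e" "w e < w d" using rs(4) unfolding e by auto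
    have "can_cross_twice n w e"
      by (rule crosses_twice_241653[OF ad r(1-5) x later_label[OF w r(6,7)]]) (use r in simp)
    then show ?thesis using r by (intro exI[of _ e]) simp
  qed
qed

theorem theorem1p1:
  fixes n :: nat and w :: "nat \<Rightarrow> nat"
  assumes "n \<ge> 1" and "w permutes {1..n}"
  shows "(\<forall>B \<in> BPD n w. co_reduced n (co B)) \<longleftrightarrow> (\<forall>v \<in> patterns. avoids_pattern n w v)"
proof
  assume red: "\<forall>B \<in> BPD n w. co_reduced n (co B)"
  show "\<forall>v \<in> patterns. avoids_pattern n w v"
  proof (rule ccontr)
    assume "\<not> (\<forall>v \<in> patterns. avoids_pattern n w v)"
    then obtain v where v: "v \<in> patterns" "contains_pattern n w v" unfolding avoids_pattern_def by blast
    have "admissible n w n"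
      unfolding admissible_def using permutes_image[OF assms(2)] permutes_inj_on[OF assms(2)] by simp
    from pattern_crosses_twice[OF this v] obtain k where "k \<le> n" "can_cross_twice n w k" by blast
    then show False using BPD_not_co_reduced[OF assms(2)] red by blast
  qed
next
  assume av: "\<forall>v \<in> patterns. avoids_pattern n w v"
  show "\<forall>B \<in> BPD n w. co_reduced n (co B)"
  proof
    fix B assume "B \<in> BPD n w"
    from BPD_labelling[OF this assms(2)] obtain lv lh
      where L: "labelling n n w lv lh" and B: "B = tiling_of n lv lh" by blast
    interpret A: avoiding n w lv lh by (rule avoids_avoiding[OF L av])
    have "full n lv lh"
      using A.tableau_axioms permutes_image[OF assms(2)] by (simp add: full_def)
    from A.co_reduced[OF this] show "co_reduced n (co B)" unfolding B .
  qed
qed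

end
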